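(* Let $X,Y$ be real Hilbert spaces, $G:X\to Y$ a (possibly nonlinear) map, and consider the inverse problem $y=G(u)+\eta$ with noise $\eta\sim N(0,\Gamma)$, Gaussian prior $\mu_0=N(0,C_0)$ on $X$, data misfit $\Phi(u)=\frac12\|y-G(u)\|_\Gamma^2$, and posterior measure $\mu$ given by $\frac{\mathrm d\mu}{\mathrm d\mu_0}(u)=\exp(-\Phi(u))/\int_X\exp(-\Phi)\,\mathrm d\mu_0$. Let $I(u)=\Phi(u)+\frac12\|u\|_{C_0}^2$, let $u_{\mathrm{MAP}}=\operatorname{arginf}_uI(u)$, and assume that $I$ is $C^2$ in a neighborhood of $u_{\mathrm{MAP}}$ (in the sense made precise in the context). Let $\nu=N(u_{\mathrm{MAP}},HI(u_{\mathrm{MAP}})^{-1})$ be the Laplace approximation of $\mu$ and let $T\Phi(u)=\Phi(u_{\mathrm{MAP}})+D\Phi(u_{\mathrm{MAP}})(u-u_{\mathrm{MAP}})+\frac12H\Phi(u_{\mathrm{MAP}})[u-u_{\mathrm{MAP}},u-u_{\mathrm{MAP}}]$. If for some $K\in(0,1)$ $$\left\|\exp\left(-\tfrac{\Phi}{2}\right)-\exp\left(-\tfrac{T\Phi}{2}\right)\right\|_{L^2(X,\mu_0)}\le K\cdot\frac{\exp\left(-\tfrac12 I(u_{\mathrm{MAP}})\right)}{\sqrt[4]{\det\big(C_0^{1/2}\,HI(u_{\mathrm{MAP}})\,C_0^{1/2}\big)}}=K\cdot\frac{\exp\left(-\tfrac12 I(u_{\mathrm{MAP}})\right)}{\sqrt[4]{\det\big(\mathrm{Id}+C_0^{1/2}\,H\Phi(u_{\mathrm{MAP}})\,C_0^{1/2}\big)}},$$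 then $$d_H(\mu,\nu)\le\frac{K}{\sqrt{1+(1-K)^2}}.$$
   Context: $X$ may be infinite-dimensional. $N(m,C)$ denotes the Gaussian measure with mean $m$ and covariance operator $C$. For a covariance operator $C$, $\|w\|_C^2=\langle C^{-1}w,w\rangle=\|C^{-1/2}w\|^2$; in particular $\|u\|_{C_0}$ is finite exactly on the range of $C_0^{1/2}$ (and $I(u)=+\infty$ elsewhere). The covariance $C_0$ is a symmetric, positive definite (injective), trace-class operator on $X$, and the posterior is assumed well defined ($\Phi$ real-valued and measurable). The point $u_{\mathrm{MAP}}$ is a point at which the infimum of $I$ is attained. $D$ denotes the Fréchet derivative and $H$ the second Fréchet derivative (Hessian); a bounded symmetric bilinear form $K$ is identified with an operator via $K[w,z]=\langle Kw,z\rangle$. The $C^2$ assumption is understood as: $\Phi$ is $C^2$ (Fréchet) on a neighborhood of $u_{\mathrm{MAP}}$ in $X$, and $HI(u_{\mathrm{MAP}})=H\Phi(u_{\mathrm{MAP}})+C_0^{-1}$, so that $C_0^{1/2}HI(u_{\mathrm{MAP}})C_0^{1/2}$ is the operator $\mathrm{Id}+C_0^{1/2}H\Phi(u_{\mathrm{MAP}})C_0^{1/2}$, an identity plus trace-class operator whose $\det$ is the Fredholm determinant. The Laplace approximation $\nu$ is assumed to be a well-defined Gaussian measure, i.e. $HI(u_{\mathrm{MAP}})$ is positive definite: $\langle (\mathrm{Id}+C_0^{1/2}H\Phi(u_{\mathrm{MAP}})C_0^{1/2})w,w\rangle>0$ for all $0\neq w\in X$; the covariance of $\nu$ is $HI(u_{\mathrm{MAP}})^{-1}=C_0^{1/2}(\mathrm{Id}+C_0^{1/2}H\Phi(u_{\mathrm{MAP}})C_0^{1/2})^{-1}C_0^{1/2}$.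 The Hellinger distance between probability measures $\mu,\nu$ absolutely continuous with respect to $\mu_0$ is defined by $$d_H(\mu,\nu)^2=\frac12\int\left(\sqrt{\frac{\mathrm d\mu}{\mathrm d\mu_0}}-\sqrt{\frac{\mathrm d\nu}{\mathrm d\mu_0}}\right)^2\mathrm d\mu_0=1-\int\sqrt{\frac{\mathrm d\mu}{\mathrm d\mu_0}}\sqrt{\frac{\mathrm d\nu}{\mathrm d\mu_0}}\,\mathrm d\mu_0 ,$$ and does not depend on the choice of the dominating measure $\mu_0$; here $d_H\ge 0$. *)

theory Defs
  imports "HOL-Probability.Probability"
begin

definition orthonormal_basis :: "'a::real_inner set \<Rightarrow> bool" where
  "orthonormal_basis B \<longleftrightarrow>
     (\<forall>e\<in>B. norm e = 1) \<and> pairwise orthogonal B \<and> closure (span B) = UNIV"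

definition symmetric_op :: "('a::real_inner \<Rightarrow> 'a) \<Rightarrow> bool" where
  "symmetric_op C \<longleftrightarrow> bounded_linear C \<and> (\<forall>x y. C x \<bullet> y = x \<bullet> C y)"

text \<open>For a nonnegative symmetric operator, being trace class means that the trace converges
  along one (equivalently, every) orthonormal basis.\<close>

definition covariance_op :: "('a::real_inner \<Rightarrow> 'a) \<Rightarrow> bool" where
  "covariance_op C \<longleftrightarrow> symmetric_op C \<and> (\<forall>x. 0 \<le> C x \<bullet> x) \<and>
     (\<exists>B. orthonormal_basis B \<and> (\<lambda>e. C e \<bullet> e) summable_on B)"

definition positive_definite_op :: "('a::real_inner \<Rightarrow> 'a) \<Rightarrow> bool" where
  "positive_definite_op C \<longleftrightarrow> (\<forall>x. x \<noteq> 0 \<longrightarrow> 0 < C x \<bullet> x)"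

definition op_sqrt :: "('a::real_inner \<Rightarrow> 'a) \<Rightarrow> 'a \<Rightarrow> 'a" where
  "op_sqrt C = (THE S. symmetric_op S \<and> (\<forall>x. 0 \<le> S x \<bullet> x) \<and> S \<circ> S = C)"

text \<open>The norm of \<open>C\<^sup>-\<^sup>1\<^sup>/\<^sup>2 w\<close>, for injective \<open>C\<close>.\<close>

definition cov_norm :: "('a::real_inner \<Rightarrow> 'a) \<Rightarrow> 'a \<Rightarrow> ereal" where
  "cov_norm C w =
     (if w \<in> range (op_sqrt C) then ereal (norm (inv (op_sqrt C) w)) else \<infinity>)"

text \<open>The one-dimensional Gaussian with mean \<open>a\<close> and variance \<open>v\<close>; the second parameter of
  \<^const>\<open>normal_density\<close> is the standard deviation.\<close>

definition real_gaussian :: "real \<Rightarrow> real \<Rightarrow> real measure" where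
  "real_gaussian a v =
     (if v = 0 then return borel a else density lborel (normal_density a (sqrt v)))"

definition gaussian_measure ::
    "'a::real_inner measure \<Rightarrow> 'a \<Rightarrow> ('a \<Rightarrow> 'a) \<Rightarrow> bool" where
  "gaussian_measure M m C \<longleftrightarrow> prob_space M \<and> sets M = sets borel \<and>
     (\<forall>w. distr M borel (\<lambda>u. u \<bullet> w) = real_gaussian (m \<bullet> w) (C w \<bullet> w))"

definition C2_on :: "'a::real_normed_vector set \<Rightarrow> ('a \<Rightarrow> real) \<Rightarrow>
    ('a \<Rightarrow> 'a \<Rightarrow>\<^sub>L real) \<Rightarrow> ('a \<Rightarrow> 'a \<Rightarrow>\<^sub>L 'a \<Rightarrow>\<^sub>L real) \<Rightarrow> bool" where
  "C2_on U f Df Hf \<longleftrightarrow>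
     (\<forall>x\<in>U. (f has_derivative blinfun_apply (Df x)) (at x)) \<and>
     (\<forall>x\<in>U. (Df has_derivative blinfun_apply (Hf x)) (at x)) \<and>
     continuous_on U Hf"

text \<open>The operator representing a bounded bilinear form (Riesz).\<close>

definition form_op :: "('a::real_inner \<Rightarrow>\<^sub>L 'a \<Rightarrow>\<^sub>L real) \<Rightarrow> 'a \<Rightarrow> 'a" where
  "form_op K = (THE T. \<forall>w z. K w z = T w \<bullet> z)"

text \<open>The Fredholm determinant \<open>det (Id + A)\<close> of a symmetric trace-class operator \<open>A\<close>: the
  (unconditional) product of \<open>1 + \<lambda>\<close> over the eigenvalues \<open>\<lambda>\<close> of \<open>A\<close>, repeated according to
  multiplicity. Only real eigenvalues are considered, so the definition is meaningful for
  symmetric \<open>A\<close> only. The eigenvalue 0, whose multiplicity may be infinite, contributes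
  the factor 1 and is left out.\<close>

definition eigenspace :: "('a::real_vector \<Rightarrow> 'a) \<Rightarrow> real \<Rightarrow> 'a set" where
  "eigenspace A l = {v. A v = l *\<^sub>R v}"

definition fredholm_det :: "('a::real_vector \<Rightarrow> 'a) \<Rightarrow> real" where
  "fredholm_det A =
     Lim (finite_subsets_at_top {l. l \<noteq> 0 \<and> eigenspace A l \<noteq> {0}})
       (\<lambda>F. \<Prod>l\<in>F. (1 + l) ^ dim (eigenspace A l))"

definition regularized_misfit ::
    "('a::real_inner \<Rightarrow> 'a) \<Rightarrow> ('a \<Rightarrow> real) \<Rightarrow> 'a \<Rightarrow> ereal" where
  "regularized_misfit C0 \<Phi> u = ereal (\<Phi> u) + ereal (1/2) * (cov_norm C0 u)\<^sup>2"

definition posterior :: "'a measure \<Rightarrow> ('a \<Rightarrow> real) \<Rightarrow> 'a measure" where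
  "posterior \<mu>0 \<Phi> = density \<mu>0 (\<lambda>u. ennreal (exp (- \<Phi> u) / (LINT v|\<mu>0. exp (- \<Phi> v))))"

text \<open>\<open>C0\<^sup>1\<^sup>/\<^sup>2 H C0\<^sup>1\<^sup>/\<^sup>2\<close>, where \<open>H\<close> is the Hessian of \<open>\<Phi>\<close> at the MAP point. The Hessian of
  \<open>I\<close> there is the unbounded operator \<open>H + C0\<^sup>-\<^sup>1\<close>; its inverse and its conjugation by
  \<open>C0\<^sup>1\<^sup>/\<^sup>2\<close> are expressed through the bounded operator \<open>Id + C0\<^sup>1\<^sup>/\<^sup>2 H C0\<^sup>1\<^sup>/\<^sup>2\<close>.\<close>

definition prior_conj :: "('a::real_inner \<Rightarrow> 'a) \<Rightarrow> ('a \<Rightarrow> 'a) \<Rightarrow> 'a \<Rightarrow> 'a" where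
  "prior_conj C0 H = op_sqrt C0 \<circ> H \<circ> op_sqrt C0"

definition laplace_cov :: "('a::real_inner \<Rightarrow> 'a) \<Rightarrow> ('a \<Rightarrow> 'a) \<Rightarrow> 'a \<Rightarrow> 'a" where
  "laplace_cov C0 H = op_sqrt C0 \<circ> inv (\<lambda>w. w + prior_conj C0 H w) \<circ> op_sqrt C0"

definition second_order_taylor :: "('a::real_normed_vector \<Rightarrow> real) \<Rightarrow>
    ('a \<Rightarrow> 'a \<Rightarrow>\<^sub>L real) \<Rightarrow> ('a \<Rightarrow> 'a \<Rightarrow>\<^sub>L 'a \<Rightarrow>\<^sub>L real) \<Rightarrow> 'a \<Rightarrow> 'a \<Rightarrow> real" where
  "second_order_taylor f Df Hf a u = f a + Df a (u - a) + 1/2 * Hf a (u - a) (u - a)"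

text \<open>The Bochner integral of a non-integrable function is 0, so a bound on \<open>L2_norm\<close> expresses
  a bound on the \<open>L\<^sup>2\<close> norm only together with \<open>in_L2\<close>.\<close>

definition in_L2 :: "'a measure \<Rightarrow> ('a \<Rightarrow> real) \<Rightarrow> bool" where
  "in_L2 M f \<longleftrightarrow> f \<in> borel_measurable M \<and> integrable M (\<lambda>x. (f x)\<^sup>2)"

definition L2_norm :: "'a measure \<Rightarrow> ('a \<Rightarrow> real) \<Rightarrow> real" where
  "L2_norm M f = sqrt (LINT x|M. (f x)\<^sup>2)"

text \<open>Meaningful for probability measures that are absolutely continuous with respect to \<open>M\<close>;
  \<^const>\<open>RN_deriv\<close> is 0 for other measures.\<close>

definition hellinger_dist :: "'a measure \<Rightarrow> 'a measure \<Rightarrow> 'a measure \<Rightarrow> real" where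
  "hellinger_dist M \<mu> \<nu> =
     sqrt (1/2 * (LINT x|M. (sqrt (enn2real (RN_deriv M \<mu> x))
                              - sqrt (enn2real (RN_deriv M \<nu> x)))\<^sup>2))"

end

theory Submission
  imports Defs
begin

text \<open>Write \<open>S = C0\<^sup>1\<^sup>/\<^sup>2\<close> and let \<open>v\<^sub>i\<close> be an orthonormal eigenbasis of the trace-class operator
  \<open>A = S H S\<close>, with eigenvalues \<open>l\<^sub>i > - 1\<close>. Stationarity of \<open>I\<close> at \<open>u_MAP = S h\<close> gives
  \<open>D\<Phi> (S k) = - \<langle>h, k\<rangle>\<close>, so that in the coordinates \<open>u = u_MAP + (\<Sum>i. z\<^sub>i S v\<^sub>i)\<close> the function \<open>T\<Phi>\<close>
  separates. In these coordinates \<open>\<mu>0\<close> is the law of independent \<open>z\<^sub>i \<sim> N(- \<langle>h, v\<^sub>i\<rangle>, 1)\<close> and \<open>\<nu>\<close> that of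
  independent \<open>z\<^sub>i \<sim> N(0, 1 / (1 + l\<^sub>i))\<close>, and comparing the densities one coordinate at a time yields
  \<open>exp (- T\<Phi>) d\<mu>0 = Z d\<nu>\<close> with \<open>Z = exp (- I(u_MAP)) / sqrt (det (Id + A))\<close>. The hypothesis therefore says
  \<open>\<parallel>f - g\<parallel> \<le> K \<parallel>g\<parallel>\<close> in \<open>L\<^sup>2(\<mu>0)\<close> for \<open>f = exp (- \<Phi> / 2)\<close> and \<open>g = exp (- T\<Phi> / 2)\<close>, which bounds the cosine of
  the angle between \<open>f\<close> and \<open>g\<close>, that is \<open>1 - d_H\<^sup>2\<close>, from below by \<open>sqrt (1 - K\<^sup>2)\<close>.\<close>

section \<open>Orthonormal sequences\<close>

text \<open>The passage from one coordinate to infinitely many shapes the proof. In infinite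
  dimension the coordinates \<open>z_i\<close> are almost surely not square summable under the
  prior, so the product Gaussian lives on real sequences, and only the smoothed series in
  \<open>S v_i\<close> converges in the space. Both measures are images of product measures under
  one and the same function of the sequence. A Gaussian measure is given only by its one-dimensional
  projections, so identifying the images requires uniqueness of characteristic functions on the
  space. The weight exp (- T Phi) may be unbounded, since \<open>l_i\<close> may be negative, so the
  finite-dimensional identities do not pass to the limit by domination; Fatou's lemma gives one
  inequality, and exchanging the roles of the two measures gives the other. Separability comes from
  the injectivity of the trace-class operator \<open>C0\<close>. That \<open>u_MAP\<close> has the
  form \<open>S h\<close> holds because \<open>I\<close> is infinite off the range of
  \<open>S\<close>. The angle bound gives d_H^2 <= 1 - sqrt (1 - K^2), which is stronger than the
  stated estimate; an elementary inequality in \<open>K\<close> links the two.\<close>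

definition orthonormal_seq :: "(nat \<Rightarrow> 'a::real_inner) \<Rightarrow> bool" where
  "orthonormal_seq v \<longleftrightarrow> (\<forall>i. norm (v i) = 0 \<or> norm (v i) = 1) \<and> (\<forall>i j. i \<noteq> j \<longrightarrow> v i \<bullet> v j = 0)"

definition basis_seq :: "(nat \<Rightarrow> 'a::real_inner) \<Rightarrow> bool" where
  "basis_seq v \<longleftrightarrow> orthonormal_seq v \<and> closure (span (range v)) = UNIV"

lemma orthonormal_seqD:
  assumes "orthonormal_seq v"
  shows "v i = 0 \<or> v i \<bullet> v i = 1" "i \<noteq> j \<Longrightarrow> v i \<bullet> v j = 0" "norm (v i) \<le> 1"
  using assms unfolding orthonormal_seq_def
  by (metis norm_eq_zero norm_eq_1, blast, metis order_refl zero_le_one)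

lemma orthonormal_seq_inner_sum:
  assumes "orthonormal_seq v" "finite F" "j \<in> F"
  shows "(\<Sum>i\<in>F. a i *\<^sub>R v i) \<bullet> v j = a j * (v j \<bullet> v j)"
proof -
  have "(\<Sum>i\<in>F. a i *\<^sub>R v i) \<bullet> v j = (\<Sum>i\<in>F. if i = j then a j * (v j \<bullet> v j) else 0)"
    unfolding inner_sum_left using orthonormal_seqD(2)[OF assms(1)] by (intro sum.cong) auto
  then show ?thesis using assms by simp
qed

lemma orthonormal_seq_norm_sum:
  assumes "orthonormal_seq v" "finite F"
  shows "(norm (\<Sum>i\<in>F. a i *\<^sub>R v i))\<^sup>2 = (\<Sum>i\<in>F. (a i)\<^sup>2 * (v i \<bullet> v i))"
proof -
  have "(norm (\<Sum>i\<in>F. a i *\<^sub>R v i))\<^sup>2 = (\<Sum>j\<in>F. a j * ((\<Sum>i\<in>F. a i *\<^sub>R v i) \<bullet> v j))"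
    by (simp add: power2_norm_eq_inner inner_sum_right)
  also have "\<dots> = (\<Sum>i\<in>F. (a i)\<^sup>2 * (v i \<bullet> v i))"
    using orthonormal_seq_inner_sum[OF assms] by (intro sum.cong) (auto simp: power2_eq_square)
  finally show ?thesis .
qed

lemma orthonormal_seq_norm_sum_le:
  assumes "orthonormal_seq v" "finite F"
  shows "(norm (\<Sum>i\<in>F. a i *\<^sub>R v i))\<^sup>2 \<le> (\<Sum>i\<in>F. (a i)\<^sup>2)"
  unfolding orthonormal_seq_norm_sum[OF assms]
  using orthonormal_seqD(1)[OF assms(1)] by (intro sum_mono) (metis inner_zero_left mult.right_neutral mult_zero_right order_refl zero_le_power2)

text \<open>Pythagoras. The factors \<open>v i \<bullet> v i\<close> disappear because where
  \<open>v i = 0\<close> the coefficient \<open>x \<bullet> v i\<close> is 0 as well.\<close>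

lemma bessel_diff:
  assumes "orthonormal_seq v" "finite F"
  shows "(norm (x - (\<Sum>i\<in>F. (x \<bullet> v i) *\<^sub>R v i)))\<^sup>2 = (norm x)\<^sup>2 - (\<Sum>i\<in>F. (x \<bullet> v i)\<^sup>2)"
proof -
  let ?p = "\<Sum>i\<in>F. (x \<bullet> v i) *\<^sub>R v i"
  have e: "(x \<bullet> v i)\<^sup>2 * (v i \<bullet> v i) = (x \<bullet> v i)\<^sup>2" for i
    using orthonormal_seqD(1)[OF assms(1), of i] by auto
  have "(norm (x - ?p))\<^sup>2 = (norm x)\<^sup>2 - 2 * (x \<bullet> ?p) + (norm ?p)\<^sup>2"
    by (simp add: power2_norm_eq_inner inner_diff inner_commute algebra_simps)
  also have "(norm ?p)\<^sup>2 = (\<Sum>i\<in>F. (x \<bullet> v i)\<^sup>2)"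
    unfolding orthonormal_seq_norm_sum[OF assms] e ..
  also have "x \<bullet> ?p = (\<Sum>i\<in>F. (x \<bullet> v i)\<^sup>2)"
    by (simp add: inner_sum_right power2_eq_square)
  finally show ?thesis by simp
qed

lemma bessel:
  assumes "orthonormal_seq v" "finite F"
  shows "(\<Sum>i\<in>F. (x \<bullet> v i)\<^sup>2) \<le> (norm x)\<^sup>2"
  using bessel_diff[OF assms, of x] zero_le_power2[of "norm (x - (\<Sum>i\<in>F. (x \<bullet> v i) *\<^sub>R v i))"] by linarith

lemma bessel_summable:
  assumes "orthonormal_seq v"
  shows "summable (\<lambda>i. (x \<bullet> v i)\<^sup>2)"
  by (rule summableI_nonneg_bounded[where x="(norm x)\<^sup>2"]) (auto intro: bessel[OF assms])

lemma sums_inner_left: "f sums x \<Longrightarrow> (\<lambda>i. f i \<bullet> y) sums (x \<bullet> y)"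
  by (rule bounded_linear.sums[OF bounded_linear_inner_left])

lemma riesz_fischer:
  fixes v :: "nat \<Rightarrow> 'a::{real_inner, complete_space}"
  assumes "orthonormal_seq v" "summable (\<lambda>i. (a i)\<^sup>2)"
  shows "summable (\<lambda>i. a i *\<^sub>R v i)"
proof -
  have "Cauchy (\<lambda>n. \<Sum>i<n. a i *\<^sub>R v i)"
  proof (rule metric_CauchyI)
    fix e :: real assume e: "e > 0"
    have "\<exists>N. \<forall>m\<ge>N. \<forall>n. norm (\<Sum>i=m..<n. (a i)\<^sup>2) < e\<^sup>2"
      using assms(2)[unfolded summable_Cauchy, rule_format, of "e\<^sup>2"] e by simp
    then obtain N where N: "\<And>m n. m \<ge> N \<Longrightarrow> (\<Sum>i=m..<n. (a i)\<^sup>2) < e\<^sup>2"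
      by (auto simp: sum_nonneg)
    have *: "dist (\<Sum>i<n. a i *\<^sub>R v i) (\<Sum>i<m. a i *\<^sub>R v i) < e" if "m \<ge> N" "n \<ge> m" for m n
    proof -
      have "(\<Sum>i<n. a i *\<^sub>R v i) - (\<Sum>i<m. a i *\<^sub>R v i) = (\<Sum>i=m..<n. a i *\<^sub>R v i)"
        using that(2) unfolding lessThan_atLeast0 by (intro sum_diff_nat_ivl) auto
      then have "(dist (\<Sum>i<n. a i *\<^sub>R v i) (\<Sum>i<m. a i *\<^sub>R v i))\<^sup>2 < e\<^sup>2"
        using orthonormal_seq_norm_sum_le[OF assms(1), of "{m..<n}" a] N[OF that(1), of n]
        by (simp add: dist_norm)
      then show ?thesis using e by (simp add: power_less_imp_less_base)
    qed
    show "\<exists>M. \<forall>m\<ge>M. \<forall>n\<ge>M. dist (\<Sum>i<m. a i *\<^sub>R v i) (\<Sum>i<n. a i *\<^sub>R v i) < e"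
    proof (intro exI[of _ N] allI impI)
      fix m n assume "N \<le> m" "N \<le> n"
      then show "dist (\<Sum>i<m. a i *\<^sub>R v i) (\<Sum>i<n. a i *\<^sub>R v i) < e"
        using *[of m n] *[of n m] by (cases "m \<le> n") (auto simp: dist_commute)
    qed
  qed
  then show ?thesis
    unfolding summable_iff_convergent by (rule Cauchy_convergent)
qed

lemma basis_seqD: "basis_seq v \<Longrightarrow> orthonormal_seq v"
  by (simp add: basis_seq_def)

text \<open>The partial sum operator \<open>P n\<close> satisfies
  \<open>norm (x - P n x) \<le> norm x\<close> and eventually fixes each finite combination y of the
  basis. Applied to \<open>x - y\<close>, the contraction bound turns a good approximant y from the
  span into a bound on the error of \<open>P n x\<close>.\<close>

lemma fourier_sums:
  assumes v: "basis_seq v"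
  shows "(\<lambda>i. (x \<bullet> v i) *\<^sub>R v i) sums x"
proof -
  note o = basis_seqD[OF v]
  define P where "P n x = (\<Sum>i<n. (x \<bullet> v i) *\<^sub>R v i)" for n x
  have Plin: "linear (P n)" for n
    unfolding P_def by (rule linearI) (simp_all add: inner_add_left scaleR_add_left sum.distrib scaleR_sum_right)
  have Ple: "norm (x - P n x) \<le> norm x" for n x
  proof -
    have "(norm (x - P n x))\<^sup>2 \<le> (norm x)\<^sup>2"
      unfolding P_def bessel_diff[OF o finite_lessThan] by (simp add: sum_nonneg)
    then show ?thesis by (rule power2_le_imp_le) simp
  qed
  have span: "\<exists>N. \<forall>n\<ge>N. P n y = y" if "y \<in> span (range v)" for y
    using that
  proof (induction rule: span_induct_alt)
    case base then show ?case by (simp add: P_def)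
  next
    case (step c z y)
    then obtain N j where N: "\<forall>n\<ge>N. P n y = y" and z: "z = v j" by auto
    have "P n (v j) = v j" if "n > j" for n
    proof -
      have "P n (v j) = (\<Sum>i<n. if i = j then (v j \<bullet> v j) *\<^sub>R v j else 0)"
        unfolding P_def using orthonormal_seqD(2)[OF o] by (intro sum.cong) auto
      also have "\<dots> = v j" using that orthonormal_seqD(1)[OF o, of j] by auto
      finally show ?thesis .
    qed
    then have "\<forall>n\<ge>max N (Suc j). P n (c *\<^sub>R z + y) = c *\<^sub>R z + y"
      using N by (auto simp: linear_add[OF Plin] linear_scale[OF Plin] z)
    then show ?case by blast
  qed
  have "(\<lambda>n. P n x) \<longlonglongrightarrow> x"
  proof (rule metric_LIMSEQ_I)
    fix e :: real assume e: "e > 0"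
    have "x \<in> closure (span (range v))" using v by (simp add: basis_seq_def)
    then obtain y where y: "y \<in> span (range v)" "dist y x < e"
      using e by (auto simp: closure_approachable)
    obtain N where N: "\<forall>n\<ge>N. P n y = y" using span[OF y(1)] by auto
    have "dist (P n x) x < e" if "n \<ge> N" for n
    proof -
      have "x - P n x = (x - y) - P n (x - y)"
        using N that by (simp add: linear_diff[OF Plin])
      then have "norm (x - P n x) \<le> norm (x - y)" using Ple by metis
      then show ?thesis using y(2) by (simp add: dist_norm norm_minus_commute)
    qed
    then show "\<exists>N. \<forall>n\<ge>N. dist (P n x) x < e" by blast
  qed
  then show ?thesis unfolding sums_def P_def .
qed

lemma parseval_inner:
  assumes "basis_seq v"
  shows "(\<lambda>i. (x \<bullet> v i) * (y \<bullet> v i)) sums (x \<bullet> y)"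
  using sums_inner_left[OF fourier_sums[OF assms, of x], of y] by (simp add: inner_commute)

lemma parseval:
  assumes "basis_seq v"
  shows "(\<lambda>i. (x \<bullet> v i)\<^sup>2) sums (norm x)\<^sup>2"
  using parseval_inner[OF assms, of x x] by (simp only: power2_norm_eq_inner power2_eq_square[of "x \<bullet> _"])

lemma basis_seq_eqI:
  assumes "basis_seq v" "\<And>i. x \<bullet> v i = y \<bullet> v i"
  shows "x = y"
  using fourier_sums[OF assms(1), of x] fourier_sums[OF assms(1), of y] assms(2)
  by (auto intro: sums_unique2)

lemma sums_inner_basis:
  assumes "basis_seq v" "(\<lambda>i. a i *\<^sub>R v i) sums x"
  shows "x \<bullet> v j = a j * (v j \<bullet> v j)"
proof -
  have "(\<lambda>i. (a i *\<^sub>R v i) \<bullet> v j) sums (x \<bullet> v j)" by (rule sums_inner_left[OF assms(2)])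
  moreover have "(\<lambda>i. (a i *\<^sub>R v i) \<bullet> v j) sums (a j * (v j \<bullet> v j))"
  proof -
    have "(\<lambda>i. (a i *\<^sub>R v i) \<bullet> v j) = (\<lambda>i. if i = j then a i * (v i \<bullet> v i) else 0)"
      using orthonormal_seqD(2)[OF basis_seqD[OF assms(1)]] by auto
    then show ?thesis using sums_single[of j "\<lambda>i. a i * (v i \<bullet> v i)"] by simp
  qed
  ultimately show ?thesis by (rule sums_unique2)
qed

lemma basis_seq_cases: "basis_seq v \<Longrightarrow> v i = 0 \<or> v i \<bullet> v i = 1"
  using orthonormal_seqD(1) basis_seqD by blast

text \<open>Indices that do not enumerate an element of \<open>B\<close> receive the value 0.
  Whether such indices exist depends on \<open>B\<close>, so 0 is inserted on both sides of the
  equation.\<close>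

lemma orthonormal_set_enum:
  assumes B: "countable B" "\<forall>e\<in>B. norm e = 1" "pairwise orthogonal B"
  obtains v where "orthonormal_seq v" "insert 0 (range v) = insert 0 B"
proof
  define v where "v i = (if i \<in> to_nat_on B ` B then from_nat_into B i else 0)" for i
  have vB: "v i = 0 \<or> (v i \<in> B \<and> to_nat_on B (v i) = i)" for i
    using B(1) by (auto simp: v_def from_nat_into_to_nat_on)
  have "norm (v i) = 0 \<or> norm (v i) = 1" for i using vB[of i] B(2) by auto
  moreover have "v i \<bullet> v j = 0" if "i \<noteq> j" for i j
    using vB[of i] vB[of j] that B(3) by (metis inner_zero_left inner_zero_right orthogonal_def pairwiseD)
  ultimately show "orthonormal_seq v" by (auto simp: orthonormal_seq_def)
  have "b \<in> range v" if "b \<in> B" for b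
    using that B(1) by (intro range_eqI[of _ _ "to_nat_on B b"]) (auto simp: v_def)
  then show "insert 0 (range v) = insert 0 B" using vB by auto
qed

lemma orthonormal_basis_enum:
  assumes "orthonormal_basis B" "countable B"
  obtains v where "basis_seq v" "insert 0 (range v) = insert 0 B"
proof -
  obtain v where v: "orthonormal_seq v" "insert 0 (range v) = insert 0 B"
    using orthonormal_set_enum[of B] assms unfolding orthonormal_basis_def by blast
  have "span (range v) = span B" using span_insert_0 v(2) by metis
  then have "basis_seq v" using v assms(1) by (simp add: basis_seq_def orthonormal_basis_def)
  then show thesis using that v(2) by blast
qed

text \<open>The representer is the series of \<open>f (v i) *\<^sub>R v i\<close>. With s the n-th
  partial sum of the squared coefficients and y that of the series, s = f y is at most K times the
  norm of y, hence at most K sqrt s; so s is bounded by K^2 and Riesz-Fischer applies.\<close>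

lemma riesz_representation:
  fixes v :: "nat \<Rightarrow> 'a::{real_inner, complete_space}"
    and f :: "'a \<Rightarrow> real"
  assumes v: "basis_seq v" and f: "bounded_linear f"
  obtains w where "\<And>z. f z = w \<bullet> z"
proof -
  note o = basis_seqD[OF v]
  obtain K where K: "K > 0" "\<And>x. norm (f x) \<le> norm x * K" using bounded_linear.pos_bounded[OF f] by auto
  have "summable (\<lambda>i. (f (v i))\<^sup>2)"
  proof (rule summableI_nonneg_bounded[where x="K\<^sup>2"])
    fix n
    define s where "s = (\<Sum>i<n. (f (v i))\<^sup>2)"
    define y where "y = (\<Sum>i<n. f (v i) *\<^sub>R v i)"
    have "s = f y" unfolding y_def s_def
      by (simp add: linear_sum[OF bounded_linear.linear[OF f]] linear_scale[OF bounded_linear.linear[OF f]] power2_eq_square)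
    also have "\<dots> \<le> norm y * K" using K(2)[of y] by simp
    finally have "s \<le> norm y * K" .
    moreover have "(norm y)\<^sup>2 \<le> s" unfolding y_def s_def by (rule orthonormal_seq_norm_sum_le[OF o]) simp
    moreover have "s \<ge> 0" unfolding s_def by (simp add: sum_nonneg)
    ultimately have "s\<^sup>2 \<le> (norm y * K)\<^sup>2" "(norm y)\<^sup>2 * K\<^sup>2 \<le> s * K\<^sup>2"
      by (blast intro: power_mono, blast intro: mult_right_mono zero_le_power2)
    then have "s\<^sup>2 \<le> s * K\<^sup>2" by (simp only: power_mult_distrib)
    then have "s * s \<le> K\<^sup>2 * s" by (simp add: power2_eq_square mult.commute)
    then show "s \<le> K\<^sup>2" using \<open>s \<ge> 0\<close> by (cases "s = 0") (auto simp: mult_le_cancel_right)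
  qed simp
  from summable_sums[OF riesz_fischer[OF o this]] obtain w where w: "(\<lambda>i. f (v i) *\<^sub>R v i) sums w" by blast
  have "f z = w \<bullet> z" for z
  proof -
    have "(\<lambda>i. f ((z \<bullet> v i) *\<^sub>R v i)) sums f z" by (rule bounded_linear.sums[OF f fourier_sums[OF v]])
    moreover have "f ((z \<bullet> v i) *\<^sub>R v i) = (f (v i) *\<^sub>R v i) \<bullet> z" for i
      by (simp add: linear_scale[OF bounded_linear.linear[OF f]] inner_commute)
    ultimately show ?thesis using sums_inner_left[OF w, of z] by (simp add: sums_unique2)
  qed
  then show thesis using that by blast
qed

section \<open>The spectral theorem for symmetric Hilbert-Schmidt operators\<close>

text \<open>A Hilbert-Schmidt operator is a uniform limit of finite-rank operators on the unit ball:
  Cauchy-Schwarz splits the tail into Fourier coefficients of x, controlled by Bessel, and a tail of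
  the convergent sum of \<open>(norm (A (v i)))\<^sup>2\<close>.\<close>

lemma hs_tail_bound:
  fixes A :: "'a::real_inner \<Rightarrow> 'a"
  assumes v: "basis_seq v" and A: "bounded_linear A" and hs: "summable (\<lambda>i. (norm (A (v i)))\<^sup>2)"
    and e: "e > 0"
  obtains N where "\<And>x. norm x \<le> 1 \<Longrightarrow> norm (A x - (\<Sum>i<N. (x \<bullet> v i) *\<^sub>R A (v i))) \<le> e"
proof -
  note o = basis_seqD[OF v]
  have "\<exists>N. \<forall>m\<ge>N. \<forall>n. norm (\<Sum>i=m..<n. (norm (A (v i)))\<^sup>2) < e\<^sup>2"
    using hs[unfolded summable_Cauchy, rule_format, of "e\<^sup>2"] e by simp
  then obtain N where N: "\<And>m n. m \<ge> N \<Longrightarrow> (\<Sum>i=m..<n. (norm (A (v i)))\<^sup>2) < e\<^sup>2"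
    by (auto simp: sum_nonneg)
  have "norm (A x - (\<Sum>i<N. (x \<bullet> v i) *\<^sub>R A (v i))) \<le> e" if x: "norm x \<le> 1" for x
  proof -
    have s: "(\<lambda>i. (x \<bullet> v i) *\<^sub>R A (v i)) sums A x"
      using bounded_linear.sums[OF A fourier_sums[OF v, of x]]
      by (simp add: linear_scale[OF bounded_linear.linear[OF A]])
    have "(\<lambda>n. norm ((\<Sum>i<n. (x \<bullet> v i) *\<^sub>R A (v i)) - (\<Sum>i<N. (x \<bullet> v i) *\<^sub>R A (v i))))
        \<longlonglongrightarrow> norm (A x - (\<Sum>i<N. (x \<bullet> v i) *\<^sub>R A (v i)))"
      using s unfolding sums_def by (intro tendsto_intros)
    moreover have "norm ((\<Sum>i<n. (x \<bullet> v i) *\<^sub>R A (v i)) - (\<Sum>i<N. (x \<bullet> v i) *\<^sub>R A (v i))) \<le> e"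
      if n: "n \<ge> N" for n
    proof -
      have "(\<Sum>i<n. (x \<bullet> v i) *\<^sub>R A (v i)) - (\<Sum>i<N. (x \<bullet> v i) *\<^sub>R A (v i))
          = (\<Sum>i=N..<n. (x \<bullet> v i) *\<^sub>R A (v i))"
        using n unfolding lessThan_atLeast0 by (intro sum_diff_nat_ivl) auto
      also have "norm \<dots> \<le> (\<Sum>i=N..<n. \<bar>x \<bullet> v i\<bar> * \<bar>norm (A (v i))\<bar>)"
        by (rule order_trans[OF norm_sum]) simp
      also have "\<dots> \<le> L2_set (\<lambda>i. x \<bullet> v i) {N..<n} * L2_set (\<lambda>i. norm (A (v i))) {N..<n}"
        by (rule L2_set_mult_ineq)
      also have "\<dots> \<le> 1 * e"
      proof (rule mult_mono)
        have "(\<Sum>i=N..<n. (x \<bullet> v i)\<^sup>2) \<le> (norm x)\<^sup>2" by (rule bessel[OF o]) simp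
        also have "\<dots> \<le> 1" using x by (simp add: power_le_one)
        finally show "L2_set (\<lambda>i. x \<bullet> v i) {N..<n} \<le> 1" by (simp add: L2_set_def)
        show "L2_set (\<lambda>i. norm (A (v i))) {N..<n} \<le> e"
          unfolding L2_set_def using N[of N n] e by (intro real_le_lsqrt) auto
      qed auto
      finally show ?thesis by simp
    qed
    ultimately show ?thesis
      by (intro tendsto_upperbound[where F=sequentially]) (auto intro: eventually_sequentiallyI)
  qed
  then show thesis using that by blast
qed

text \<open>The set of these combinations is a Minkowski sum of segments, and sums of compact sets
  are compact.\<close>

lemma compact_bounded_combinations:
  fixes y :: "nat \<Rightarrow> 'a::real_normed_vector"
  obtains K where "compact K" "\<And>a. (\<And>i. \<bar>a i\<bar> \<le> 1) \<Longrightarrow> (\<Sum>i<n. a i *\<^sub>R y i) \<in> K"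
proof (induction n arbitrary: thesis)
  case 0
  show ?case by (rule 0[of "{0}"]) auto
next
  case (Suc n)
  obtain K where K: "compact K" "\<And>a. (\<And>i. \<bar>a i\<bar> \<le> 1) \<Longrightarrow> (\<Sum>i<n. a i *\<^sub>R y i) \<in> K"
    using Suc.IH by blast
  have "compact ((\<lambda>c. c *\<^sub>R y n) ` {-1..1})"
    by (intro compact_continuous_image continuous_intros) auto
  from compact_sums[OF K(1) this] show ?case
    by (rule Suc.prems) (use K(2) in \<open>force simp: abs_le_iff\<close>)
qed

text \<open>Total boundedness: the finite-rank truncation maps the unit ball into a compact set,
  whose finite net is inherited by the image of \<open>A\<close>. Three errors of \<open>e/4\<close>
  occur, for the net, for the truncation and for the passage to the closure.\<close>

lemma hs_compact:
  fixes A :: "'a::{real_inner, complete_space} \<Rightarrow> 'a"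
  assumes v: "basis_seq v" and A: "bounded_linear A" and hs: "summable (\<lambda>i. (norm (A (v i)))\<^sup>2)"
  shows "compact (closure (A ` cball 0 1))"
  unfolding compact_eq_totally_bounded
proof (intro conjI allI impI)
  show "uniform_space_class.complete (closure (A ` cball 0 1))" by (simp add: complete_eq_closed)
  fix e :: real assume e: "e > 0"
  obtain N where N: "\<And>x. norm x \<le> 1 \<Longrightarrow> norm (A x - (\<Sum>i<N. (x \<bullet> v i) *\<^sub>R A (v i))) \<le> e/4"
    using hs_tail_bound[OF v A hs, of "e/4"] e by auto
  obtain K where K: "compact K" "\<And>a. (\<And>i. \<bar>a i\<bar> \<le> 1) \<Longrightarrow> (\<Sum>i<N. a i *\<^sub>R A (v i)) \<in> K"
    by (rule compact_bounded_combinations[where y = "\<lambda>i. A (v i)" and n = N]) blast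
  obtain k where k: "finite k" "K \<subseteq> (\<Union>x\<in>k. ball x (e/4))"
    using K(1)[unfolded compact_eq_totally_bounded] e by (meson zero_less_divide_iff zero_less_numeral)
  have "closure (A ` cball 0 1) \<subseteq> (\<Union>x\<in>k. ball x e)"
  proof
    fix y assume "y \<in> closure (A ` cball 0 1)"
    then obtain x where x: "norm x \<le> 1" "dist (A x) y < e/4"
      using e unfolding closure_approachable by (fastforce dest: spec[of _ "e/4"])
    have "\<bar>x \<bullet> v i\<bar> \<le> 1" for i
      using Cauchy_Schwarz_ineq2[of x "v i"] x(1) orthonormal_seqD(3)[OF basis_seqD[OF v], of i]
        mult_mono[of "norm x" 1 "norm (v i)" 1] by simp
    then have "(\<Sum>i<N. (x \<bullet> v i) *\<^sub>R A (v i)) \<in> K" by (rule K(2))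
    then obtain z where z: "z \<in> k" "dist z (\<Sum>i<N. (x \<bullet> v i) *\<^sub>R A (v i)) < e/4"
      using k(2) by auto
    have "dist z y \<le> dist z (\<Sum>i<N. (x \<bullet> v i) *\<^sub>R A (v i)) + dist (\<Sum>i<N. (x \<bullet> v i) *\<^sub>R A (v i)) (A x) + dist (A x) y"
      using dist_triangle[of z y "A x"] dist_triangle[of z "A x" "\<Sum>i<N. (x \<bullet> v i) *\<^sub>R A (v i)"] by linarith
    also have "dist (\<Sum>i<N. (x \<bullet> v i) *\<^sub>R A (v i)) (A x) \<le> e/4"
      using N[OF x(1)] by (simp add: dist_norm norm_minus_commute)
    finally have "dist z y < e" using z(2) x(2) e by linarith
    then show "y \<in> (\<Union>x\<in>k. ball x e)" using z(1) by auto
  qed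
  then show "\<exists>k. finite k \<and> closure (A ` cball 0 1) \<subseteq> (\<Union>x\<in>k. ball x e)" using k(1) by blast
qed

lemma unit_eigenvector_of_nonzero:
  fixes A :: "'a::real_inner \<Rightarrow> 'a"
  assumes "subspace V" "linear A" "x \<in> V" "x \<noteq> 0" "A x = l *\<^sub>R x"
  shows "\<exists>x\<in>V. norm x = 1 \<and> (\<exists>l. A x = l *\<^sub>R x)"
proof (intro bexI[of _ "(1 / norm x) *\<^sub>R x"] conjI exI[of _ l])
  show "A ((1 / norm x) *\<^sub>R x) = l *\<^sub>R (1 / norm x) *\<^sub>R x"
    using assms(5) by (simp add: linear_scale[OF assms(2)])
qed (use assms in \<open>auto simp: subspace_scale\<close>)

text \<open>If \<open>\<parallel>A x\<^sub>n\<parallel>\<close> approaches the norm \<open>M\<close> of \<open>A\<close> on \<open>V\<close>, then a limit point \<open>z\<close> of \<open>A x\<^sub>n\<close> satisfies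
  \<open>A\<^sup>2 z = M\<^sup>2 z\<close>, and one of \<open>z\<close>, \<open>A z + M z\<close> is an eigenvector of \<open>A\<close>.\<close>

lemma compact_symmetric_eigenvector:
  fixes A :: "'a::real_inner \<Rightarrow> 'a"
  assumes V: "subspace V" "closed V" "x0 \<in> V" "x0 \<noteq> 0"
    and A: "symmetric_op A" "\<And>x. x \<in> V \<Longrightarrow> A x \<in> V"
    and cpt: "compact (closure (A ` cball 0 1))"
  shows "\<exists>x\<in>V. norm x = 1 \<and> (\<exists>l. A x = l *\<^sub>R x)"
proof -
  have bl: "bounded_linear A" and sym: "\<And>x y. A x \<bullet> y = x \<bullet> A y"
    using A(1) by (auto simp: symmetric_op_def)
  note lin = bounded_linear.linear[OF bl]
  define S where "S = (\<lambda>x. norm (A x)) ` (V \<inter> cball 0 1)"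
  obtain K where K: "K > 0" "\<And>x. norm (A x) \<le> norm x * K"
    using bounded_linear.pos_bounded[OF bl] by auto
  have bdd: "bdd_above S" unfolding S_def
  proof (rule bdd_aboveI2[where M=K])
    fix x assume "x \<in> V \<inter> cball 0 1"
    then have "norm x * K \<le> 1 * K" using K(1) by (intro mult_right_mono) auto
    then show "norm (A x) \<le> K" using K(2)[of x] by linarith
  qed
  have ne: "S \<noteq> {}" using subspace_0[OF V(1)] unfolding S_def by fastforce
  define M where "M = Sup S"
  have Mle: "norm (A x) \<le> M" if "x \<in> V" "norm x \<le> 1" for x
    unfolding M_def using that by (intro cSup_upper[OF _ bdd]) (auto simp: S_def)
  have M0: "M \<ge> 0" using Mle[of 0] V(1) by (simp add: subspace_0 order_trans[OF norm_ge_zero])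
  have MleV: "norm (A x) \<le> M * norm x" if "x \<in> V" for x
  proof (cases "x = 0")
    case False
    have "norm (A ((1 / norm x) *\<^sub>R x)) \<le> M" using that V(1) False by (intro Mle) (auto simp: subspace_scale)
    then show ?thesis using False by (simp add: linear_scale[OF lin] field_simps)
  qed (simp add: linear_0[OF lin])
  show ?thesis
  \<comment> \<open>If \<open>M = 0\<close>, the operator vanishes on \<open>V\<close> and the given
    nonzero \<open>x0\<close> is itself an eigenvector, with eigenvalue 0.\<close>
  proof (cases "M = 0")
    case True
    then have "A x0 = 0 *\<^sub>R x0" using MleV[OF V(3)] by simp
    then show ?thesis using unit_eigenvector_of_nonzero[OF V(1) lin V(3,4)] by blast
  next
    case False
    then have M: "M > 0" using M0 by simp
    have "\<exists>x. x \<in> V \<and> norm x \<le> 1 \<and> M - 1 / Suc n < norm (A x)" for n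
    proof -
      have "M - 1 / Suc n < Sup S" unfolding M_def by simp
      then show ?thesis using less_cSup_iff[OF ne bdd] by (auto simp: S_def)
    qed
    then obtain X where X: "\<And>n. X n \<in> V" "\<And>n. norm (X n) \<le> 1" "\<And>n. M - 1 / Suc n < norm (A (X n))"
      by metis
    have "(\<lambda>n. M - 1 / Suc n) \<longlonglongrightarrow> M"
      using tendsto_diff[OF tendsto_const LIMSEQ_inverse_real_of_nat, of M] by (simp add: inverse_eq_divide)
    then have lim: "(\<lambda>n. norm (A (X n))) \<longlonglongrightarrow> M"
      by (rule tendsto_sandwich[OF _ _ _ tendsto_const, rotated 2])
        (use X(3) in \<open>auto intro!: always_eventually Mle X simp: less_imp_le\<close>)
    have "\<forall>n. A (X n) \<in> closure (A ` cball 0 1)"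
      using X(2) by (auto intro!: subsetD[OF closure_subset])
    then obtain z r where z: "strict_mono r" "((\<lambda>n. A (X n)) \<circ> r) \<longlonglongrightarrow> z"
      using cpt unfolding compact_def by meson
    define Y where "Y n = X (r n)" for n
    have Y: "Y n \<in> V" "norm (Y n) \<le> 1" for n using X by (auto simp: Y_def)
    have Az: "(\<lambda>n. A (Y n)) \<longlonglongrightarrow> z" using z(2) by (simp add: o_def Y_def)
    have nA: "(\<lambda>n. norm (A (Y n))) \<longlonglongrightarrow> M"
      using LIMSEQ_subseq_LIMSEQ[OF lim z(1)] by (simp add: o_def Y_def)
    have "norm z = M" using LIMSEQ_unique[OF tendsto_norm[OF Az] nA] .
    then have z0: "z \<noteq> 0" using M by auto
    have zV: "z \<in> V" using closed_sequentially[OF V(2) _ Az] A(2) Y(1) by blast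
    \<comment> \<open>The square is expanded; by symmetry the cross term is a multiple of the
      squared norm of \<open>A (Y n)\<close>, and
      \<open>norm (A (A (Y n))) \<le> M * norm (A (Y n))\<close>. What remains is M^2 times the
      defect of \<open>norm (A (Y n))\<close> from its limit \<open>M\<close>.\<close>
    have "(\<lambda>n. (norm (A (A (Y n)) - M\<^sup>2 *\<^sub>R Y n))\<^sup>2) \<longlonglongrightarrow> 0"
    proof (rule tendsto_sandwich[OF _ _ tendsto_const])
      have "(\<lambda>n. M\<^sup>2 * (M\<^sup>2 - (norm (A (Y n)))\<^sup>2)) \<longlonglongrightarrow> M\<^sup>2 * (M\<^sup>2 - M\<^sup>2)"
        by (intro tendsto_intros nA)
      then show "(\<lambda>n. M\<^sup>2 * (M\<^sup>2 - (norm (A (Y n)))\<^sup>2)) \<longlonglongrightarrow> 0" by simp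
      have "(norm (A (A (Y n)) - M\<^sup>2 *\<^sub>R Y n))\<^sup>2 \<le> M\<^sup>2 * (M\<^sup>2 - (norm (A (Y n)))\<^sup>2)" for n
      proof -
        have "(norm (A (A (Y n)) - M\<^sup>2 *\<^sub>R Y n))\<^sup>2
            = (norm (A (A (Y n))))\<^sup>2 - 2 * M\<^sup>2 * (A (A (Y n)) \<bullet> Y n) + M\<^sup>2 * M\<^sup>2 * (norm (Y n))\<^sup>2"
          by (simp add: power2_norm_eq_inner inner_diff inner_commute algebra_simps)
        also have "A (A (Y n)) \<bullet> Y n = (norm (A (Y n)))\<^sup>2" by (simp add: sym power2_norm_eq_inner)
        also have "(norm (A (A (Y n))))\<^sup>2 \<le> (M * norm (A (Y n)))\<^sup>2"
          by (intro power_mono MleV A(2) Y) auto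
        also have "M\<^sup>2 * M\<^sup>2 * (norm (Y n))\<^sup>2 \<le> M\<^sup>2 * M\<^sup>2 * 1"
          using Y(2)[of n] by (intro mult_left_mono power_le_one) auto
        finally show ?thesis by (simp add: power_mult_distrib algebra_simps)
      qed
      then show "\<forall>\<^sub>F n in sequentially. (norm (A (A (Y n)) - M\<^sup>2 *\<^sub>R Y n))\<^sup>2 \<le> M\<^sup>2 * (M\<^sup>2 - (norm (A (Y n)))\<^sup>2)"
        by simp
    qed simp
    then have "(\<lambda>n. sqrt ((norm (A (A (Y n)) - M\<^sup>2 *\<^sub>R Y n))\<^sup>2)) \<longlonglongrightarrow> sqrt 0"
      by (rule tendsto_real_sqrt)
    then have "(\<lambda>n. A (A (Y n)) - M\<^sup>2 *\<^sub>R Y n) \<longlonglongrightarrow> 0"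
      by (simp add: tendsto_norm_zero_iff)
    \<comment> \<open>\<open>A\<close> is applied once more because only \<open>A (Y n)\<close> is
      known to converge, not \<open>Y n\<close>.\<close>
    from bounded_linear.tendsto[OF bl this]
    have "(\<lambda>n. A (A (A (Y n))) - M\<^sup>2 *\<^sub>R A (Y n)) \<longlonglongrightarrow> 0"
      by (simp add: linear_diff[OF lin] linear_scale[OF lin] linear_0[OF lin])
    moreover have "(\<lambda>n. A (A (A (Y n))) - M\<^sup>2 *\<^sub>R A (Y n)) \<longlonglongrightarrow> A (A z) - M\<^sup>2 *\<^sub>R z"
      by (intro tendsto_intros bounded_linear.tendsto[OF bl] Az)
    ultimately have AAz: "A (A z) = M\<^sup>2 *\<^sub>R z" using LIMSEQ_unique by fastforce
    show ?thesis
    proof (cases "A z + M *\<^sub>R z = 0")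
      case True
      then have "A z = (- M) *\<^sub>R z" by (simp add: eq_neg_iff_add_eq_0)
      then show ?thesis using unit_eigenvector_of_nonzero[OF V(1) lin zV z0] by blast
    next
      case False
      have "A (A z + M *\<^sub>R z) = M *\<^sub>R (A z + M *\<^sub>R z)"
        by (simp add: linear_add[OF lin] linear_scale[OF lin] AAz power2_eq_square algebra_simps)
      then show ?thesis
        using unit_eigenvector_of_nonzero[OF V(1) lin _ False] V(1) zV A(2)
        by (auto simp: subspace_add subspace_scale)
    qed
  qed
qed

text \<open>Finite rational combinations of the basis vectors, coded by lists of rationals. This set
  replaces second countability in the countability and measurability arguments below.\<close>

lemma basis_seq_countable_dense:
  fixes v :: "nat \<Rightarrow> 'a::real_inner"
  assumes v: "basis_seq v"
  obtains D :: "'a set" where "countable D" "\<And>x e. e > 0 \<Longrightarrow> \<exists>d\<in>D. dist d x < e"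
proof -
  define f where "f qs = (\<Sum>i<length qs. real_of_rat (qs ! i) *\<^sub>R v i)" for qs :: "rat list"
  have "\<exists>d\<in>range f. dist d x < e" if e: "e > 0" for x e
  proof -
    have "(\<lambda>n. \<Sum>i<n. (x \<bullet> v i) *\<^sub>R v i) \<longlonglongrightarrow> x"
      using fourier_sums[OF v, of x] by (simp add: sums_def)
    from metric_LIMSEQ_D[OF this, of "e/2"] obtain n where n: "dist (\<Sum>i<n. (x \<bullet> v i) *\<^sub>R v i) x < e/2"
      using e by auto
    \<comment> \<open>There are n coefficients sharing an error of e/2; \<open>Suc n\<close> in the
      denominator also covers n = 0.\<close>
    have "\<exists>q. \<bar>real_of_rat q - x \<bullet> v i\<bar> < e / (2 * Suc n)" for i
    proof -
      have "x \<bullet> v i - e / (2 * Suc n) < x \<bullet> v i + e / (2 * Suc n)" using e by simp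
      from of_rat_dense[OF this] obtain q where "x \<bullet> v i - e / (2 * Suc n) < real_of_rat q"
        "real_of_rat q < x \<bullet> v i + e / (2 * Suc n)" by auto
      then show ?thesis by (intro exI[of _ q]) (simp add: abs_less_iff)
    qed
    then obtain q where q: "\<And>i. \<bar>real_of_rat (q i) - x \<bullet> v i\<bar> < e / (2 * Suc n)" by metis
    have fq: "f (map q [0..<n]) = (\<Sum>i<n. real_of_rat (q i) *\<^sub>R v i)" by (simp add: f_def)
    have "dist (f (map q [0..<n])) (\<Sum>i<n. (x \<bullet> v i) *\<^sub>R v i)
        = norm (\<Sum>i<n. (real_of_rat (q i) - x \<bullet> v i) *\<^sub>R v i)"
      unfolding fq dist_norm by (simp add: sum_subtractf scaleR_diff_left)
    also have "\<dots> \<le> (\<Sum>i<n. e / (2 * Suc n) * 1)"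
    proof (intro order_trans[OF norm_sum] sum_mono)
      fix i
      have "\<bar>real_of_rat (q i) - x \<bullet> v i\<bar> * norm (v i) \<le> e / (2 * Suc n) * 1"
        using e by (intro mult_mono less_imp_le[OF q] orthonormal_seqD(3)[OF basis_seqD[OF v]]) auto
      then show "norm ((real_of_rat (q i) - x \<bullet> v i) *\<^sub>R v i) \<le> e / (2 * Suc n) * 1" by simp
    qed
    also have "\<dots> \<le> e / 2" using e by (simp add: field_simps)
    finally have "dist (f (map q [0..<n])) x < e"
      using n dist_triangle[of "f (map q [0..<n])" x "\<Sum>i<n. (x \<bullet> v i) *\<^sub>R v i"] by linarith
    then show ?thesis by blast
  qed
  then show thesis using that[of "range f"] by auto
qed

text \<open>Distinct orthonormal vectors have distance sqrt 2, whereas two vectors within 1/2 of the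
  same point of the dense set have distance below 1. Choosing such a point for each vector is
  therefore injective.\<close>

lemma countable_orthonormal_set:
  fixes v :: "nat \<Rightarrow> 'a::real_inner"
  assumes v: "basis_seq v" and E: "\<forall>e\<in>E. norm (e::'a) = 1" "pairwise orthogonal E"
  shows "countable E"
proof -
  obtain D :: "'a set" where D: "countable D" "\<And>x e. e > 0 \<Longrightarrow> \<exists>d\<in>D. dist d x < e"
    using basis_seq_countable_dense[OF v] by blast
  obtain f where f: "\<And>x::'a. f x \<in> D" "\<And>x. dist (f x) x < 1/2"
    using D(2)[of "1/2"] by (metis half_gt_zero zero_less_one)
  have "inj_on f E"
  proof (rule inj_onI, rule ccontr)
    fix x y assume xy: "x \<in> E" "y \<in> E" "f x = f y" "x \<noteq> y"
    then have o: "x \<bullet> y = 0" using E(2) by (auto simp: pairwise_def orthogonal_def)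
    have "(dist x y)\<^sup>2 = 2"
      using o E(1) xy by (simp add: dist_norm power2_norm_eq_inner inner_diff inner_commute norm_eq_1)
    moreover have "dist x y < 1"
      using dist_triangle2[of x y "f x"] f(2)[of x] f(2)[of y] xy(3) by (simp add: dist_commute)
    then have "(dist x y)\<^sup>2 < 1" by (simp add: power_less_one_iff)
    ultimately show False by simp
  qed
  moreover have "countable (f ` E)" using D(1) f(1) by (meson countable_subset image_subset_iff)
  ultimately show ?thesis by (simp add: countable_image_inj_eq)
qed

text \<open>Zorn's lemma gives a maximal orthonormal set of eigenvectors. Its orthogonal complement
  is closed and, by symmetry, invariant under \<open>A\<close>; if it were nonzero, compactness
  would supply a further eigenvector in it. The clause for \<open>v i = 0\<close> keeps padded
  indices from contributing to sums and products over the eigenvalues.\<close>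

theorem hs_spectral:
  fixes A :: "'a::{real_inner, complete_space} \<Rightarrow> 'a"
  assumes e: "basis_seq e" and A: "symmetric_op A" and hs: "summable (\<lambda>i. (norm (A (e i)))\<^sup>2)"
  obtains v l where "basis_seq v" "\<And>i. A (v i) = l i *\<^sub>R v i" "\<And>i. v i = 0 \<Longrightarrow> l i = 0"
proof -
  have bl: "bounded_linear A" and sym: "\<And>x y. A x \<bullet> y = x \<bullet> A y"
    using A by (auto simp: symmetric_op_def)
  note lin = bounded_linear.linear[OF bl]
  define \<E> where "\<E> = {E. (\<forall>x\<in>E. norm x = 1 \<and> (\<exists>l. A x = l *\<^sub>R x)) \<and> pairwise orthogonal E}"
  have "\<exists>M\<in>\<E>. \<forall>X\<in>\<E>. M \<subseteq> X \<longrightarrow> X = M"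
  proof (rule subset_Zorn')
    fix C assume C: "subset.chain \<E> C"
    have "pairwise orthogonal (\<Union>C)"
    proof (rule pairwiseI)
      fix x y assume xy: "x \<in> \<Union>C" "y \<in> \<Union>C" "x \<noteq> y"
      then obtain X Y where XY: "X \<in> C" "x \<in> X" "Y \<in> C" "y \<in> Y" by auto
      then have "X \<subseteq> Y \<or> Y \<subseteq> X" using C by (auto simp: subset_chain_def)
      then obtain Z where "Z \<in> C" "x \<in> Z" "y \<in> Z" using XY by blast
      then show "orthogonal x y" using C xy(3) by (auto simp: subset_chain_def \<E>_def pairwise_def)
    qed
    moreover have "\<forall>x\<in>\<Union>C. norm x = 1 \<and> (\<exists>l. A x = l *\<^sub>R x)"
      using C unfolding subset_chain_def \<E>_def by blast
    ultimately show "\<Union>C \<in> \<E>" by (simp add: \<E>_def)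
  qed
  then obtain E where E: "E \<in> \<E>" and max: "\<And>X. X \<in> \<E> \<Longrightarrow> E \<subseteq> X \<Longrightarrow> X = E" by blast
  have E1: "\<forall>x\<in>E. norm x = 1" and Eo: "pairwise orthogonal E" and Ee: "\<forall>x\<in>E. \<exists>l. A x = l *\<^sub>R x"
    using E by (auto simp: \<E>_def)
  obtain v where v: "orthonormal_seq v" "insert 0 (range v) = insert 0 E"
    using orthonormal_set_enum[OF countable_orthonormal_set[OF e E1 Eo] E1 Eo] by blast
  have ev: "\<exists>l. A (v i) = l *\<^sub>R v i \<and> (v i = 0 \<longrightarrow> l = 0)" for i
  proof (cases "v i = 0")
    case True then show ?thesis by (simp add: linear_0[OF lin])
  next
    case False
    then have "v i \<in> E" using v(2) by blast
    then show ?thesis using Ee False by blast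
  qed
  define V where "V = {y. \<forall>i. y \<bullet> v i = 0}"
  have V0: "y = 0" if y: "y \<in> V" for y
  proof (rule ccontr)
    assume "y \<noteq> 0"
    have sub: "subspace V" by (auto simp: V_def subspace_def inner_add_left)
    have "V = (\<Inter>i. {y. y \<bullet> v i = 0})" by (auto simp: V_def)
    then have cl: "closed V" by (auto intro!: closed_INT closed_Collect_eq continuous_intros)
    have AV: "A x \<in> V" if x: "x \<in> V" for x
      unfolding V_def
    proof safe
      fix i
      obtain l where "A (v i) = l *\<^sub>R v i" using ev by blast
      then show "A x \<bullet> v i = 0" using x by (simp add: sym V_def)
    qed
    obtain u where u: "u \<in> V" "norm u = 1" "\<exists>l. A u = l *\<^sub>R u"
      using compact_symmetric_eigenvector[OF sub cl y \<open>y \<noteq> 0\<close> A AV hs_compact[OF e bl hs]] by blast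
    have uE: "u \<bullet> x = 0" if "x \<in> E" for x
    proof -
      have "x \<in> insert 0 (range v)" using that v(2) by blast
      then show ?thesis using u(1) by (auto simp: V_def)
    qed
    have "pairwise orthogonal (insert u E)"
      using Eo uE by (auto simp: pairwise_insert orthogonal_def inner_commute)
    then have "insert u E \<in> \<E>" using u E1 Ee by (auto simp: \<E>_def)
    then have "u \<in> E" using max by blast
    then show False using uE[of u] u(2) by (auto simp: norm_eq_1)
  qed
  \<comment> \<open>The Fourier series of x has a limit w by Riesz-Fischer, and \<open>x - w\<close>
    is orthogonal to all \<open>v j\<close>. Since \<open>V\<close> is trivial, x is that
    limit.\<close>
  have "x \<in> closure (span (range v))" for x
  proof -
    obtain w where w: "(\<lambda>i. (x \<bullet> v i) *\<^sub>R v i) sums w"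
      using summable_sums[OF riesz_fischer[OF v(1) bessel_summable[OF v(1)]]] by blast
    have "(x - w) \<bullet> v j = 0" for j
    proof -
      have "(\<lambda>i. ((x \<bullet> v i) *\<^sub>R v i) \<bullet> v j) sums (w \<bullet> v j)" by (rule sums_inner_left[OF w])
      moreover have "(\<lambda>i. ((x \<bullet> v i) *\<^sub>R v i) \<bullet> v j) = (\<lambda>i. if i = j then x \<bullet> v i else 0)"
        using orthonormal_seqD[OF v(1)] by (intro ext) (metis inner_scaleR_left inner_zero_right mult.right_neutral mult_zero_right)
      ultimately have "w \<bullet> v j = x \<bullet> v j" using sums_single[of j "\<lambda>i. x \<bullet> v i"] by (simp add: sums_unique2)
      then show ?thesis by (simp add: inner_diff_left)
    qed
    then have "x = w" using V0[of "x - w"] by (simp add: V_def)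
    with w have lim: "(\<lambda>n. \<Sum>i<n. (x \<bullet> v i) *\<^sub>R v i) \<longlonglongrightarrow> x" by (simp add: sums_def)
    show ?thesis
      by (rule closed_sequentially[OF closed_closure _ lim])
        (intro subsetD[OF closure_subset] span_sum span_scale span_base rangeI)
  qed
  then have "basis_seq v" using v(1) by (auto simp: basis_seq_def)
  moreover obtain l where "\<And>i. A (v i) = l i *\<^sub>R v i" "\<And>i. v i = 0 \<Longrightarrow> l i = 0" using ev by metis
  ultimately show thesis using that by blast
qed

section \<open>Diagonal operators, square roots and Fredholm determinants\<close>

definition diag_op :: "(nat \<Rightarrow> 'a::real_inner) \<Rightarrow> (nat \<Rightarrow> real) \<Rightarrow> 'a \<Rightarrow> 'a" where
  "diag_op v d x = (\<Sum>i. (d i * (x \<bullet> v i)) *\<^sub>R v i)"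

lemma diag_op_sums:
  fixes v :: "nat \<Rightarrow> 'a::{real_inner, complete_space}"
  assumes v: "basis_seq v" and d: "\<And>i. \<bar>d i\<bar> \<le> K"
  shows "(\<lambda>i. (d i * (x \<bullet> v i)) *\<^sub>R v i) sums diag_op v d x"
proof -
  have "summable (\<lambda>i. (d i * (x \<bullet> v i))\<^sup>2)"
  proof (rule summable_comparison_test')
    show "summable (\<lambda>i. K\<^sup>2 * (x \<bullet> v i)\<^sup>2)"
      by (intro summable_mult bessel_summable basis_seqD v)
    show "norm ((d n * (x \<bullet> v n))\<^sup>2) \<le> K\<^sup>2 * (x \<bullet> v n)\<^sup>2" for n
      using power_mono[OF d[of n], of 2] by (auto simp: power_mult_distrib intro!: mult_right_mono)
  qed
  then show ?thesis
    unfolding diag_op_def by (intro summable_sums riesz_fischer basis_seqD v)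
qed

context
  fixes v :: "nat \<Rightarrow> 'a::{real_inner, complete_space}" and d :: "nat \<Rightarrow> real" and K :: real
  assumes v: "basis_seq v" and d: "\<And>i. \<bar>d i\<bar> \<le> K"
begin

lemma diag_op_inner: "diag_op v d x \<bullet> v j = d j * (x \<bullet> v j)"
proof -
  have "diag_op v d x \<bullet> v j = (d j * (x \<bullet> v j)) * (v j \<bullet> v j)"
    by (rule sums_inner_basis[OF v diag_op_sums[OF v d]])
  then show ?thesis using basis_seq_cases[OF v, of j] by auto
qed

lemma symmetric_diag_op: "symmetric_op (diag_op v d)"
  unfolding symmetric_op_def
proof (intro conjI allI)
  show "diag_op v d x \<bullet> y = x \<bullet> diag_op v d y" for x y
    using parseval_inner[OF v, of "diag_op v d x" y] parseval_inner[OF v, of x "diag_op v d y"]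
    by (intro sums_unique2) (simp_all add: diag_op_inner ac_simps)
  show "bounded_linear (diag_op v d)"
  proof (rule bounded_linear_intro[where K=K])
    show "diag_op v d (x + y) = diag_op v d x + diag_op v d y" for x y
      by (rule basis_seq_eqI[OF v]) (simp add: diag_op_inner inner_add_left algebra_simps)
    show "diag_op v d (r *\<^sub>R x) = r *\<^sub>R diag_op v d x" for r x
      by (rule basis_seq_eqI[OF v]) (simp add: diag_op_inner)
    show "norm (diag_op v d x) \<le> norm x * K" for x
    proof -
      have "(norm (diag_op v d x))\<^sup>2 \<le> K\<^sup>2 * (norm x)\<^sup>2"
      proof (rule sums_le)
        show "(\<lambda>i. (diag_op v d x \<bullet> v i)\<^sup>2) sums (norm (diag_op v d x))\<^sup>2" by (rule parseval[OF v])
        show "(\<lambda>i. K\<^sup>2 * (x \<bullet> v i)\<^sup>2) sums (K\<^sup>2 * (norm x)\<^sup>2)" by (intro sums_mult parseval v)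
        show "(diag_op v d x \<bullet> v n)\<^sup>2 \<le> K\<^sup>2 * (x \<bullet> v n)\<^sup>2" for n
          using power_mono[OF d[of n], of 2]
          by (auto simp: power_mult_distrib diag_op_inner intro!: mult_right_mono)
      qed
      then have "(norm (diag_op v d x))\<^sup>2 \<le> (norm x * K)\<^sup>2" by (simp only: power_mult_distrib mult.commute)
      moreover have "0 \<le> norm x * K" using d[of 0] by (intro mult_nonneg_nonneg) auto
      ultimately show ?thesis by (rule power2_le_imp_le)
    qed
  qed
qed

lemma diag_op_nonneg: "(\<And>i. 0 \<le> d i) \<Longrightarrow> 0 \<le> diag_op v d x \<bullet> x"
  by (rule sums_le[OF _ sums_zero parseval_inner[OF v, of "diag_op v d x" x]])
    (simp add: diag_op_inner mult.assoc)

end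

text \<open>Expand the nonnegative form of \<open>C\<close> at \<open>K *\<^sub>R x - C x\<close>,
  with \<open>K\<close> a norm bound. The inequality turns a summable trace into a summable
  Hilbert-Schmidt sum, which is what the spectral theorem asks for.\<close>

lemma nonneg_op_norm_le:
  assumes C: "symmetric_op C" "\<And>x. 0 \<le> C x \<bullet> x"
  obtains K where "K > 0" "\<And>x. (norm (C x))\<^sup>2 \<le> K * (C x \<bullet> x)"
proof -
  have bl: "bounded_linear C" and sym: "\<And>x y. C x \<bullet> y = x \<bullet> C y"
    using C(1) by (auto simp: symmetric_op_def)
  note lin = bounded_linear.linear[OF bl]
  obtain K where K: "K > 0" "\<And>x. norm (C x) \<le> norm x * K"
    using bounded_linear.pos_bounded[OF bl] by auto
  have "(norm (C x))\<^sup>2 \<le> K * (C x \<bullet> x)" for x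
  proof -
    let ?n = "(norm (C x))\<^sup>2"
    have "C (C x) \<bullet> C x \<le> norm (C (C x)) * norm (C x)" by (rule norm_cauchy_schwarz)
    also have "\<dots> \<le> norm (C x) * K * norm (C x)" by (intro mult_right_mono K) auto
    finally have 1: "C (C x) \<bullet> C x \<le> K * ?n" by (simp add: power2_eq_square ac_simps)
    have "0 \<le> C (K *\<^sub>R x - C x) \<bullet> (K *\<^sub>R x - C x)" by (rule C(2))
    also have "\<dots> = K * K * (C x \<bullet> x) - 2 * K * ?n + C (C x) \<bullet> C x"
      by (simp add: linear_diff[OF lin] linear_scale[OF lin] inner_diff sym power2_norm_eq_inner inner_commute algebra_simps)
    finally have "K * ?n \<le> K * (K * (C x \<bullet> x))" using 1 by (simp add: algebra_simps)
    then show ?thesis using K(1) by simp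
  qed
  then show thesis using that K(1) by blast
qed

text \<open>A positive definite covariance operator forces the space to be separable.\<close>

lemma covariance_basis:
  assumes C: "covariance_op C" "positive_definite_op C"
  obtains e where "basis_seq e" "summable (\<lambda>i. C (e i) \<bullet> e i)"
proof -
  obtain B where B: "orthonormal_basis B" "(\<lambda>e. C e \<bullet> e) summable_on B"
    using C(1) by (auto simp: covariance_op_def)
  have B1: "norm b = 1" if "b \<in> B" for b using B(1) that by (auto simp: orthonormal_basis_def)
  \<comment> \<open>A summable real family has only countably many nonzero terms. Positive
    definiteness makes every term nonzero, so \<open>B\<close> itself is countable.\<close>
  have "{b \<in> B. C b \<bullet> b \<noteq> 0} = B"
  proof -
    have "C b \<bullet> b \<noteq> 0" if "b \<in> B" for b
    proof -
      have "b \<noteq> 0" using B1[OF that] by auto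
      then show ?thesis using C(2) by (metis positive_definite_op_def less_irrefl)
    qed
    then show ?thesis by auto
  qed
  then have "countable B" using summable_countable_real[OF B(2)] by simp
  then obtain e where e: "basis_seq e" "insert 0 (range e) = insert 0 B"
    using orthonormal_basis_enum[OF B(1)] by blast
  have pos: "0 \<le> C x \<bullet> x" for x using C(1) by (simp add: covariance_op_def)
  have "summable (\<lambda>i. C (e i) \<bullet> e i)"
  proof (rule summableI_nonneg_bounded)
    fix n
    let ?I = "{i\<in>{..<n}. e i \<noteq> 0}"
    \<comment> \<open>A nonzero vector occurring at two indices would be orthogonal to itself. Away
      from the zeros the sequence thus enumerates \<open>B\<close> without repetition, and partial
      sums become finite subsums over \<open>B\<close>.\<close>
    have inj: "inj_on e ?I"
      using orthonormal_seqD(2)[OF basis_seqD[OF e(1)]] by (intro inj_onI) (metis (mono_tags, lifting) inner_eq_zero_iff mem_Collect_eq)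
    have sub: "e ` ?I \<subseteq> B" using e(2) by blast
    have "(\<Sum>i<n. C (e i) \<bullet> e i) = (\<Sum>i\<in>?I. C (e i) \<bullet> e i)"
      by (intro sum.mono_neutral_right) auto
    also have "\<dots> = (\<Sum>b\<in>e ` ?I. C b \<bullet> b)" using sum.reindex[OF inj, of "\<lambda>b. C b \<bullet> b"] by (simp add: comp_def)
    also have "\<dots> \<le> infsum (\<lambda>b. C b \<bullet> b) B"
      by (rule finite_sum_le_infsum[OF B(2) _ sub]) (auto simp: pos)
    finally show "(\<Sum>i<n. C (e i) \<bullet> e i) \<le> infsum (\<lambda>b. C b \<bullet> b) B" .
  qed (rule pos)
  then show thesis using that e(1) by blast
qed

text \<open>\<open>op_sqrt\<close> is a definite description, so existence and uniqueness are both
  required. Existence: take square roots of the eigenvalues in an eigenbasis of \<open>C\<close>.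
  Uniqueness: any nonnegative root is forced to act on that eigenbasis in the same way.\<close>

lemma op_sqrt:
  fixes C :: "'a::{real_inner, complete_space} \<Rightarrow> 'a"
  assumes C: "covariance_op C" "positive_definite_op C"
  shows "symmetric_op (op_sqrt C)" "\<And>x. op_sqrt C (op_sqrt C x) = C x"
proof -
  obtain e where e: "basis_seq e" "summable (\<lambda>i. C (e i) \<bullet> e i)"
    using covariance_basis[OF C] by blast
  have Csym: "symmetric_op C" and pos: "\<And>x. 0 \<le> C x \<bullet> x" using C(1) by (auto simp: covariance_op_def)
  then have sym: "C x \<bullet> y = x \<bullet> C y" for x y by (simp add: symmetric_op_def)
  obtain K where K: "K > 0" "\<And>x. (norm (C x))\<^sup>2 \<le> K * (C x \<bullet> x)"
    using nonneg_op_norm_le[OF Csym pos] by blast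
  have "summable (\<lambda>i. (norm (C (e i)))\<^sup>2)"
    by (rule summable_comparison_test'[OF summable_mult[OF e(2), of K]]) (simp add: K)
  from hs_spectral[OF e(1) Csym this] obtain v c where v: "basis_seq v"
    and Cv: "\<And>i. C (v i) = c i *\<^sub>R v i" and v0: "\<And>i. v i = 0 \<Longrightarrow> c i = 0" by blast
  have c: "0 \<le> c i \<and> c i \<le> K \<and> (v i \<noteq> 0 \<longrightarrow> 0 < c i)" for i
  proof (cases "v i = 0")
    case True then show ?thesis using v0 K by auto
  next
    case False
    then have v1: "v i \<bullet> v i = 1" using basis_seq_cases[OF v] by auto
    have "0 < C (v i) \<bullet> v i" using False C(2) by (auto simp: positive_definite_op_def)
    then have "0 < c i" using v1 by (simp add: Cv)
    moreover have "c i * c i \<le> K * c i"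
      using K(2)[of "v i"] v1 unfolding Cv power2_norm_eq_inner by simp
    ultimately show ?thesis by (simp add: mult_le_cancel_right)
  qed
  define d where "d i = sqrt (c i)" for i
  have dd: "d i * d i = c i" and d0: "0 \<le> d i" for i using c[of i] by (auto simp: d_def)
  have dK: "\<bar>d i\<bar> \<le> sqrt K" for i using c[of i] by (simp add: d_def)
  define S where "S = diag_op v d"
  have S: "S x \<bullet> v i = d i * (x \<bullet> v i)" for x i
    unfolding S_def by (rule diag_op_inner[OF v dK])
  have Ssym: "symmetric_op S" and Spos: "0 \<le> S x \<bullet> x" for x
    unfolding S_def using symmetric_diag_op[OF v dK] diag_op_nonneg[OF v dK d0] by auto
  have SS: "S \<circ> S = C"
  proof (rule ext, simp, rule basis_seq_eqI[OF v])
    show "S (S x) \<bullet> v i = C x \<bullet> v i" for x i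
      by (simp add: S sym[of x "v i"] Cv mult.assoc[symmetric] dd)
  qed
  have uniq: "T = S" if T: "symmetric_op T" "\<forall>x. 0 \<le> T x \<bullet> x" "T \<circ> T = C" for T
  proof -
    have bl: "bounded_linear T" and Tsym: "\<And>x y. T x \<bullet> y = x \<bullet> T y"
      using T(1) by (auto simp: symmetric_op_def)
    note lin = bounded_linear.linear[OF bl]
    have TT: "T (T x) = C x" for x using T(3) by (metis comp_apply)
    have Tv: "T (v i) = d i *\<^sub>R v i" for i
    proof (cases "v i = 0")
      case True then show ?thesis by (simp add: linear_0[OF lin])
    next
      case False
      then have di: "d i > 0" using c[of i] by (simp add: d_def)
      \<comment> \<open>From \<open>T (T (v i)) = (d i)\<^sup>2 *\<^sub>R v i\<close>, this defect
        satisfies \<open>T y = - d i *\<^sub>R y\<close>; a nonnegative operator has no negative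
        eigenvalue, so it is zero.\<close>
      let ?y = "T (v i) - d i *\<^sub>R v i"
      have "T ?y = (- d i) *\<^sub>R ?y"
        by (simp add: linear_diff[OF lin] linear_scale[OF lin] TT Cv dd[symmetric] algebra_simps)
      then have "0 \<le> - d i * (?y \<bullet> ?y)" using T(2)[rule_format, of ?y] by simp
      then have "?y \<bullet> ?y \<le> 0" using di by (simp add: mult_le_0_iff)
      then have "?y = 0" by (metis inner_eq_zero_iff inner_ge_zero order_antisym)
      then show ?thesis by simp
    qed
    show ?thesis
      by (rule ext, rule basis_seq_eqI[OF v]) (simp add: Tsym Tv S)
  qed
  have "op_sqrt C = S"
    unfolding op_sqrt_def
  proof (rule the_equality)
    show "symmetric_op S \<and> (\<forall>x. 0 \<le> S x \<bullet> x) \<and> S \<circ> S = C" using Ssym Spos SS by blast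
  qed (use uniq in blast)
  then show "symmetric_op (op_sqrt C)" "\<And>x. op_sqrt C (op_sqrt C x) = C x"
    using Ssym fun_cong[OF SS] by simp_all
qed

text \<open>Invariance of the Hilbert-Schmidt norm, in the direction that is used: Parseval in e and
  symmetry turn the sum over \<open>v j\<close> into a double sum of
  \<open>(S (e i) \<bullet> v j)\<^sup>2\<close>, whose inner sum over j is bounded by
  Bessel.\<close>

lemma hs_norm_basis:
  fixes S :: "'a::real_inner \<Rightarrow> 'a"
  assumes S: "symmetric_op S" and e: "basis_seq e" and v: "orthonormal_seq v"
    and hs: "summable (\<lambda>i. (norm (S (e i)))\<^sup>2)"
  shows "summable (\<lambda>i. (norm (S (v i)))\<^sup>2)"
proof (rule summableI_nonneg_bounded)
  fix n
  have sym: "S x \<bullet> y = x \<bullet> S y" for x y using S by (simp add: symmetric_op_def)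
  show "(\<Sum>j<n. (norm (S (v j)))\<^sup>2) \<le> (\<Sum>i. (norm (S (e i)))\<^sup>2)"
  proof (rule sums_le)
    show "(\<lambda>i. \<Sum>j<n. (S (v j) \<bullet> e i)\<^sup>2) sums (\<Sum>j<n. (norm (S (v j)))\<^sup>2)"
      by (intro sums_sum parseval e)
    show "(\<lambda>i. (norm (S (e i)))\<^sup>2) sums (\<Sum>i. (norm (S (e i)))\<^sup>2)" by (rule summable_sums[OF hs])
    show "(\<Sum>j<n. (S (v j) \<bullet> e i)\<^sup>2) \<le> (norm (S (e i)))\<^sup>2" for i
      proof -
      have "S (v j) \<bullet> e i = S (e i) \<bullet> v j" for j by (metis sym inner_commute)
      then show ?thesis using bessel[OF v, of "{..<n}" "S (e i)"] by simp
    qed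
  qed
qed simp

text \<open>By symmetry an eigenvector is orthogonal to each \<open>v i\<close> with a different
  eigenvalue, so its Fourier series runs over the finitely many indices in question and is a finite
  sum.\<close>

lemma eigenspace_span:
  fixes A :: "'a::real_inner \<Rightarrow> 'a"
  assumes v: "basis_seq v" and A: "symmetric_op A" and Av: "\<And>i. A (v i) = l i *\<^sub>R v i"
    and fin: "finite {i. l i = \<kappa>}"
  shows "eigenspace A \<kappa> = span (v ` {i. l i = \<kappa>})"
proof
  have bl: "bounded_linear A" and sym: "\<And>x y. A x \<bullet> y = x \<bullet> A y"
    using A by (auto simp: symmetric_op_def)
  note lin = bounded_linear.linear[OF bl]
  have "subspace (eigenspace A \<kappa>)"
    by (auto simp: subspace_def eigenspace_def linear_0[OF lin] linear_add[OF lin] linear_scale[OF lin] algebra_simps)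
  then show "span (v ` {i. l i = \<kappa>}) \<subseteq> eigenspace A \<kappa>"
    by (intro span_minimal) (auto simp: eigenspace_def Av)
  show "eigenspace A \<kappa> \<subseteq> span (v ` {i. l i = \<kappa>})"
  proof
    fix x assume x: "x \<in> eigenspace A \<kappa>"
    have "x \<bullet> v i = 0" if "l i \<noteq> \<kappa>" for i
    proof -
      have "\<kappa> * (x \<bullet> v i) = l i * (x \<bullet> v i)"
        using x sym[of x "v i"] by (simp add: eigenspace_def Av)
      then show ?thesis using that by auto
    qed
    then have "(\<lambda>i. (x \<bullet> v i) *\<^sub>R v i) sums (\<Sum>i\<in>{i. l i = \<kappa>}. (x \<bullet> v i) *\<^sub>R v i)"
      using fin by (intro sums_finite) auto
    then have "x = (\<Sum>i\<in>{i. l i = \<kappa>}. (x \<bullet> v i) *\<^sub>R v i)"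
      using fourier_sums[OF v, of x] sums_unique2 by blast
    also have "\<dots> \<in> span (v ` {i. l i = \<kappa>})" by (intro span_sum span_scale span_base) auto
    finally show "x \<in> span (v ` {i. l i = \<kappa>})" .
  qed
qed

text \<open>\<open>fredholm_det\<close> multiplies over distinct eigenvalues with multiplicities,
  along finite subsets, while the later limit argument needs products over the index i. Logarithms
  mediate: \<open>ln (1 + l i)\<close> is absolutely summable, so the sum may be regrouped by
  eigenvalue, and each group has as many indices as the dimension of the eigenspace.\<close>

lemma fredholm_det_eigenbasis:
  fixes A :: "'a::real_inner \<Rightarrow> 'a"
  assumes v: "basis_seq v" and A: "symmetric_op A"
    and Av: "\<And>i. A (v i) = l i *\<^sub>R v i" and v0: "\<And>i. v i = 0 \<Longrightarrow> l i = 0"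
    and l: "summable (\<lambda>i. \<bar>l i\<bar>)" and pos: "\<And>i. 0 < 1 + l i"
  shows "fredholm_det A > 0" "(\<lambda>n. \<Prod>i<n. 1 + l i) \<longlonglongrightarrow> fredholm_det A"
proof -
  have l0: "l \<longlonglongrightarrow> 0" using summable_LIMSEQ_zero[OF l] by (simp add: tendsto_rabs_zero_iff)
  have fin: "finite {i. l i = \<kappa>}" if "\<kappa> \<noteq> 0" for \<kappa>
  proof -
    have "eventually (\<lambda>i. l i \<noteq> \<kappa>) sequentially"
      using l0 that by (intro tendsto_imp_eventually_ne) auto
    then show ?thesis by (simp add: cofinite_eq_sequentially[symmetric] eventually_cofinite)
  qed
  define f where "f i = ln (1 + l i)" for i
  have "summable (\<lambda>i. norm (f i))"
  proof (rule summable_comparison_test_ev)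
    have "eventually (\<lambda>i. dist (l i) 0 < 1/2) sequentially" by (rule tendstoD[OF l0]) simp
    then show "eventually (\<lambda>i. norm (norm (f i)) \<le> 2 * \<bar>l i\<bar>) sequentially"
    proof eventually_elim
      case (elim i)
      then have a: "\<bar>l i\<bar> \<le> 1/2" by simp
      \<comment> \<open>The estimate of \<open>ln (1 + x) - x\<close> by 2 x^2 then gives
        \<open>\<bar>ln (1 + l i)\<bar> \<le> 2 * \<bar>l i\<bar>\<close>, valid for all large
        i.\<close>
      have "2 * (l i)\<^sup>2 \<le> \<bar>l i\<bar>"
        using a mult_right_mono[OF a, of "\<bar>l i\<bar>"] by (simp add: power2_eq_square abs_mult[symmetric])
      then show ?case using abs_ln_one_plus_x_minus_x_bound[OF a] by (simp add: f_def)
    qed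
    show "summable (\<lambda>i. 2 * \<bar>l i\<bar>)" by (intro summable_mult l)
  qed
  then have "summable f" and hs: "(f has_sum suminf f) UNIV"
    using summable_norm_cancel summable_sums norm_summable_imp_has_sum by blast+
  then have fs: "f sums suminf f" by (simp add: summable_sums)
  define \<Lambda> where "\<Lambda> = {\<kappa>. \<kappa> \<noteq> 0 \<and> eigenspace A \<kappa> \<noteq> {0}}"
  define J where "J \<kappa> = {i. l i = \<kappa>}" for \<kappa>
  have inj: "inj_on v (J \<kappa>)" if "\<kappa> \<noteq> 0" for \<kappa>
  proof (rule inj_onI, rule ccontr)
    fix i j assume "i \<in> J \<kappa>" "j \<in> J \<kappa>" "v i = v j" "i \<noteq> j"
    moreover have "v i \<noteq> 0" using \<open>i \<in> J \<kappa>\<close> that v0 by (auto simp: J_def)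
    ultimately show False
      using orthonormal_seqD(2)[OF basis_seqD[OF v], of i j] by simp
  qed
  have dim: "dim (eigenspace A \<kappa>) = card (J \<kappa>)" if "\<kappa> \<noteq> 0" for \<kappa>
  proof -
    have "pairwise orthogonal (v ` J \<kappa>)"
      using orthonormal_seqD(2)[OF basis_seqD[OF v]] by (auto simp: pairwise_def orthogonal_def) metis
    moreover have "0 \<notin> v ` J \<kappa>" using that v0 by (auto simp: J_def)
    ultimately have "independent (v ` J \<kappa>)" by (intro pairwise_orthogonal_independent) auto
    then show ?thesis
      unfolding eigenspace_span[OF v A Av fin[OF that]] J_def[symmetric]
      using real_vector.dim_span_eq_card_independent[of "v ` J \<kappa>"] card_image[OF inj[OF that]] by metis
  qed
  have \<Lambda>: "\<kappa> \<in> \<Lambda> \<longleftrightarrow> \<kappa> \<noteq> 0 \<and> J \<kappa> \<noteq> {}" for \<kappa>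
  proof (cases "\<kappa> = 0")
    case False
    have "eigenspace A \<kappa> = {0} \<longleftrightarrow> J \<kappa> = {}"
      unfolding eigenspace_span[OF v A Av fin[OF False]] J_def[symmetric]
    proof
      assume s: "span (v ` J \<kappa>) = {0}"
      have "v i = 0" if "i \<in> J \<kappa>" for i using span_base[of "v i" "v ` J \<kappa>"] that s by auto
      then show "J \<kappa> = {}" using v0 False by (auto simp: J_def)
    qed simp
    then show ?thesis by (simp add: \<Lambda>_def)
  qed (simp add: \<Lambda>_def)
  \<comment> \<open>Zero eigenvalues contribute ln 1 = 0. The remaining indices are paired with
    their eigenvalue, so that the sum becomes one over \<open>Sigma \<Lambda> J\<close> and can be
    taken fibre by fibre.\<close>
  have "(f has_sum suminf f) {i. l i \<noteq> 0}"
    using hs by (subst has_sum_cong_neutral[where T=UNIV and g=f]) (auto simp: f_def)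
  moreover have "bij_betw (\<lambda>i. (l i, i)) {i. l i \<noteq> 0} (Sigma \<Lambda> J)"
    by (rule bij_betwI[where g=snd]) (auto simp: \<Lambda> J_def)
  ultimately have "((\<lambda>p. f (snd p)) has_sum suminf f) (Sigma \<Lambda> J)"
    by (subst has_sum_reindex_bij_betw[symmetric]) auto
  then have "((\<lambda>\<kappa>. card (J \<kappa>) * ln (1 + \<kappa>)) has_sum suminf f) \<Lambda>"
  proof (rule has_sum_SigmaD)
    fix \<kappa> assume "\<kappa> \<in> \<Lambda>"
    then have "finite (J \<kappa>)" using fin by (auto simp: \<Lambda> J_def)
    then have "((\<lambda>i. f (snd (\<kappa>, i))) has_sum (\<Sum>i\<in>J \<kappa>. f i)) (J \<kappa>)" by (auto intro: has_sum_finite)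
    moreover have "(\<Sum>i\<in>J \<kappa>. f i) = card (J \<kappa>) * ln (1 + \<kappa>)" by (simp add: f_def J_def)
    ultimately show "((\<lambda>i. f (snd (\<kappa>, i))) has_sum card (J \<kappa>) * ln (1 + \<kappa>)) (J \<kappa>)" by simp
  qed
  then have "((\<lambda>F. exp (\<Sum>\<kappa>\<in>F. card (J \<kappa>) * ln (1 + \<kappa>))) \<longlongrightarrow> exp (suminf f)) (finite_subsets_at_top \<Lambda>)"
    unfolding has_sum_def by (rule tendsto_exp)
  then have "((\<lambda>F. \<Prod>\<kappa>\<in>F. (1 + \<kappa>) ^ dim (eigenspace A \<kappa>)) \<longlongrightarrow> exp (suminf f)) (finite_subsets_at_top \<Lambda>)"
  proof (rule Lim_transform_eventually, intro eventually_finite_subsets_at_top_weakI)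
    fix F assume F: "finite F" "F \<subseteq> \<Lambda>"
    have "exp (card (J \<kappa>) * ln (1 + \<kappa>)) = (1 + \<kappa>) ^ dim (eigenspace A \<kappa>)" if "\<kappa> \<in> F" for \<kappa>
    proof -
      have "\<kappa> \<noteq> 0" "J \<kappa> \<noteq> {}" using F(2) that \<Lambda> by auto
      then have "0 < 1 + \<kappa>" using pos by (auto simp: J_def)
      then show ?thesis using dim[OF \<open>\<kappa> \<noteq> 0\<close>] by (simp add: exp_of_nat_mult)
    qed
    then show "exp (\<Sum>\<kappa>\<in>F. card (J \<kappa>) * ln (1 + \<kappa>)) = (\<Prod>\<kappa>\<in>F. (1 + \<kappa>) ^ dim (eigenspace A \<kappa>))"
      using F(1) by (simp add: exp_sum)
  qed
  then have eq: "fredholm_det A = exp (suminf f)"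
    unfolding fredholm_det_def \<Lambda>_def by (intro tendsto_Lim) auto
  then show "fredholm_det A > 0" by simp
  have "(\<lambda>n. exp (\<Sum>i<n. f i)) \<longlonglongrightarrow> exp (suminf f)"
    using fs unfolding sums_def by (rule tendsto_exp)
  then show "(\<lambda>n. \<Prod>i<n. 1 + l i) \<longlonglongrightarrow> fredholm_det A"
    unfolding eq using pos by (simp add: exp_sum f_def)
qed

text \<open>The diagonal operator with entries \<open>1 / (1 + l i)\<close>, bounded because the
  \<open>l i\<close> tend to 0 and exceed -1, provides preimages. Surjectivity is enough to evaluate
  \<open>inv\<close>: the coordinates of any preimage are determined by those of y.\<close>

lemma inv_id_plus_inner:
  fixes A :: "'a::{real_inner, complete_space} \<Rightarrow> 'a"
  assumes v: "basis_seq v" and A: "symmetric_op A" and Av: "\<And>i. A (v i) = l i *\<^sub>R v i"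
    and l0: "l \<longlonglongrightarrow> 0" and pos: "\<And>i. 0 < 1 + l i"
  shows "inv (\<lambda>w. w + A w) y \<bullet> v i = (y \<bullet> v i) / (1 + l i)"
proof -
  have sym: "\<And>x y. A x \<bullet> y = x \<bullet> A y" using A by (auto simp: symmetric_op_def)
  have e: "(x + A x) \<bullet> v j = (1 + l j) * (x \<bullet> v j)" for x j
    by (simp add: inner_add_left sym Av algebra_simps)
  have "(\<lambda>i. 1 / (1 + l i)) \<longlonglongrightarrow> 1 / (1 + 0)" by (intro tendsto_intros l0) simp
  then have "Bseq (\<lambda>i. 1 / (1 + l i))" by (intro convergent_imp_Bseq convergentI)
  then obtain K where K: "\<And>i. \<bar>1 / (1 + l i)\<bar> \<le> K" by (auto simp: Bseq_def)
  have "surj (\<lambda>w. w + A w)"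
  proof (rule surjI)
    show "diag_op v (\<lambda>i. 1 / (1 + l i)) x + A (diag_op v (\<lambda>i. 1 / (1 + l i)) x) = x" for x
    proof (rule basis_seq_eqI[OF v])
      fix i
      show "(diag_op v (\<lambda>i. 1 / (1 + l i)) x + A (diag_op v (\<lambda>i. 1 / (1 + l i)) x)) \<bullet> v i = x \<bullet> v i"
        unfolding e diag_op_inner[OF v K] using pos[of i] by simp
    qed
  qed
  then have "inv (\<lambda>w. w + A w) y + A (inv (\<lambda>w. w + A w) y) = y"
    by (rule surj_f_inv_f)
  then have "(1 + l i) * (inv (\<lambda>w. w + A w) y \<bullet> v i) = y \<bullet> v i" using e by metis
  then show ?thesis using pos[of i] by (simp add: field_simps)
qed

section \<open>Second derivatives and stationarity\<close>

text \<open>The mean value theorem in direction w, applied to the difference of f along the two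
  parallel segments, leaves a difference of two values of \<open>Df\<close>. Each is linearised at
  \<open>a\<close> with an error controlled by e, which explains the factor 2.\<close>

lemma second_difference_bound:
  fixes f :: "'a::real_normed_vector \<Rightarrow> real" and Df :: "'a \<Rightarrow> 'a \<Rightarrow>\<^sub>L real" and H :: "'a \<Rightarrow> 'a \<Rightarrow>\<^sub>L real"
  assumes U: "open U" "a \<in> U" and f: "\<And>x. x \<in> U \<Longrightarrow> (f has_derivative blinfun_apply (Df x)) (at x)"
    and Df: "(Df has_derivative H) (at a)" and e: "e > 0"
  obtains d where "d > 0" "\<And>t. 0 < t \<Longrightarrow> t < d \<Longrightarrow>
    \<bar>f (a + t *\<^sub>R v + t *\<^sub>R w) - f (a + t *\<^sub>R v) - f (a + t *\<^sub>R w) + f a - t\<^sup>2 * H v w\<bar>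
      \<le> t\<^sup>2 * (2 * e * (norm v + norm w)\<^sup>2)"
proof -
  have bl: "bounded_linear H" using Df by (rule has_derivative_bounded_linear)
  note lin = bounded_linear.linear[OF bl]
  obtain r where r: "r > 0" "ball a r \<subseteq> U" using U by (auto simp: open_contains_ball)
  obtain d where d: "d > 0" "\<And>y. norm (y - a) < d \<Longrightarrow> norm (Df y - Df a - H (y - a)) \<le> e * norm (y - a)"
    using Df e unfolding has_derivative_at_alt by blast
  define N where "N = norm v + norm w"
  have N: "N \<ge> 0" "norm v \<le> N" "norm w \<le> N" by (auto simp: N_def)
  \<comment> \<open>For t below this bound the whole parallelogram spanned by
    \<open>t *\<^sub>R v\<close> and \<open>t *\<^sub>R w\<close> at \<open>a\<close> lies in
    \<open>U\<close> and within the range where the linearisation error holds; \<open>N + 1\<close>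
    avoids division by 0.\<close>
  define \<delta> where "\<delta> = min r d / (N + 1)"
  have "\<delta> > 0" using r d N by (auto simp: \<delta>_def)
  moreover have "\<bar>f (a + t *\<^sub>R v + t *\<^sub>R w) - f (a + t *\<^sub>R v) - f (a + t *\<^sub>R w) + f a - t\<^sup>2 * H v w\<bar>
      \<le> t\<^sup>2 * (2 * e * (norm v + norm w)\<^sup>2)" if t: "0 < t" "t < \<delta>" for t
  proof -
    have tN: "t * N < min r d"
    proof -
      have "t * N \<le> t * (N + 1)" using t by simp
      also have "\<dots> < \<delta> * (N + 1)" using t N by (intro mult_strict_right_mono) auto
      also have "\<dots> = min r d" using N by (simp add: \<delta>_def)
      finally show ?thesis .
    qed
    have bd: "norm (c *\<^sub>R v + s *\<^sub>R w) \<le> t * N" if "0 \<le> c" "c \<le> t" "0 \<le> s" "s \<le> t" for c s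
    proof -
      have "norm (c *\<^sub>R v + s *\<^sub>R w) \<le> c * norm v + s * norm w"
        using norm_triangle_ineq[of "c *\<^sub>R v" "s *\<^sub>R w"] that by simp
      also have "\<dots> \<le> t * norm v + t * norm w" using that by (intro add_mono mult_right_mono) auto
      finally show ?thesis by (simp add: N_def algebra_simps)
    qed
    have D: "((\<lambda>s. f (a + c *\<^sub>R v + s *\<^sub>R w)) has_real_derivative Df (a + c *\<^sub>R v + s *\<^sub>R w) w) (at s)"
      if "0 \<le> c" "c \<le> t" "0 \<le> s" "s \<le> t" for c s
    proof -
      have "a + c *\<^sub>R v + s *\<^sub>R w \<in> U"
      proof (rule subsetD[OF r(2)])
        have "dist a (a + c *\<^sub>R v + s *\<^sub>R w) = norm (c *\<^sub>R v + s *\<^sub>R w)"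
          by (metis add.assoc add_diff_cancel_left' dist_commute dist_norm)
        then show "a + c *\<^sub>R v + s *\<^sub>R w \<in> ball a r" using bd[OF that] tN by simp
      qed
      then have "((\<lambda>s. f (a + c *\<^sub>R v + s *\<^sub>R w)) has_derivative (\<lambda>h. Df (a + c *\<^sub>R v + s *\<^sub>R w) (h *\<^sub>R w))) (at s)"
        by (intro has_derivative_compose[OF _ f]) (auto intro!: derivative_eq_intros)
      then show ?thesis
        unfolding has_field_derivative_def by (simp add: blinfun.scaleR_right mult.commute[of _ "blinfun_apply _ _"])
    qed
    define g where "g s = f (a + t *\<^sub>R v + s *\<^sub>R w) - f (a + 0 *\<^sub>R v + s *\<^sub>R w)" for s
    define g' where "g' s = Df (a + t *\<^sub>R v + s *\<^sub>R w) w - Df (a + 0 *\<^sub>R v + s *\<^sub>R w) w" for s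
    have "\<exists>z>0. z < t \<and> g t - g 0 = (t - 0) * g' z"
      unfolding g_def g'_def using t by (intro MVT2 DERIV_diff D) auto
    then obtain s where s: "0 < s" "s < t" "g t - g 0 = t * g' s" by auto
    have err: "\<bar>Df (a + c *\<^sub>R v + s *\<^sub>R w) w - Df a w - (c * H v w + s * H w w)\<bar> \<le> e * (t * N) * N"
      if c: "0 \<le> c" "c \<le> t" for c
    proof -
      let ?y = "a + c *\<^sub>R v + s *\<^sub>R w"
      have ya: "?y - a = c *\<^sub>R v + s *\<^sub>R w" by simp
      have le: "norm (?y - a) \<le> t * N" unfolding ya using bd c s by auto
      then have "norm (Df ?y - Df a - H (?y - a)) \<le> e * norm (?y - a)" using tN by (intro d(2)) auto
      also have "\<dots> \<le> e * (t * N)" using le e by (intro mult_left_mono) auto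
      finally have n: "norm (Df ?y - Df a - H (?y - a)) \<le> e * (t * N)" .
      have "\<bar>(Df ?y - Df a - H (?y - a)) w\<bar> \<le> norm (Df ?y - Df a - H (?y - a)) * norm w"
        using norm_blinfun[of "Df ?y - Df a - H (?y - a)" w] by simp
      also have "\<dots> \<le> e * (t * N) * N" using n N e t by (intro mult_mono) auto
      finally show ?thesis
        unfolding ya by (simp add: blinfun.diff_left linear_add[OF lin] linear_scale[OF lin] blinfun.add_left blinfun.scaleR_left)
    qed
    have "\<bar>g' s - t * H v w\<bar> \<le> 2 * (e * (t * N) * N)"
      using err[of t] err[of 0] t unfolding g'_def by (auto simp: abs_le_iff)
    then have "t * \<bar>g' s - t * H v w\<bar> \<le> t * (2 * (e * (t * N) * N))" using t by (intro mult_left_mono) auto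
    moreover have "t * \<bar>g' s - t * H v w\<bar> = \<bar>g t - g 0 - t\<^sup>2 * H v w\<bar>"
    proof -
      have "g t - g 0 - t\<^sup>2 * H v w = t * (g' s - t * H v w)"
        unfolding s(3) by (simp add: power2_eq_square algebra_simps)
      then show ?thesis using t by (simp add: abs_mult)
    qed
    ultimately show ?thesis
      by (simp add: g_def N_def[symmetric] power2_eq_square algebra_simps)
  qed
  ultimately show thesis using that by blast
qed

text \<open>The second difference is symmetric in v and w and approximates both
  \<open>t\<^sup>2 * H v w\<close> and \<open>t\<^sup>2 * H w v\<close>.\<close>

theorem second_derivative_symmetric:
  fixes f :: "'a::real_normed_vector \<Rightarrow> real" and Df :: "'a \<Rightarrow> 'a \<Rightarrow>\<^sub>L real" and H :: "'a \<Rightarrow> 'a \<Rightarrow>\<^sub>L real"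
  assumes U: "open U" "a \<in> U" and f: "\<And>x. x \<in> U \<Longrightarrow> (f has_derivative blinfun_apply (Df x)) (at x)"
    and Df: "(Df has_derivative H) (at a)"
  shows "H v w = H w v"
proof (rule ccontr)
  assume ne: "H v w \<noteq> H w v"
  define N where "N = (norm v + norm w)\<^sup>2"
  have N: "N \<ge> 0" by (simp add: N_def)
  \<comment> \<open>The two approximation errors add up to \<open>4 * e * N\<close>, while the gap
    equals \<open>5 * (N + 1) * e\<close>, strictly more.\<close>
  define e where "e = \<bar>H v w - H w v\<bar> / (5 * (N + 1))"
  have e: "e > 0" using ne N by (simp add: e_def)
  obtain d1 where d1: "d1 > 0" "\<And>t. 0 < t \<Longrightarrow> t < d1 \<Longrightarrow>
    \<bar>f (a + t *\<^sub>R v + t *\<^sub>R w) - f (a + t *\<^sub>R v) - f (a + t *\<^sub>R w) + f a - t\<^sup>2 * H v w\<bar> \<le> t\<^sup>2 * (2 * e * N)"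
    using second_difference_bound[OF U f Df e, of v w] unfolding N_def by blast
  obtain d2 where d2: "d2 > 0" "\<And>t. 0 < t \<Longrightarrow> t < d2 \<Longrightarrow>
    \<bar>f (a + t *\<^sub>R w + t *\<^sub>R v) - f (a + t *\<^sub>R w) - f (a + t *\<^sub>R v) + f a - t\<^sup>2 * H w v\<bar> \<le> t\<^sup>2 * (2 * e * N)"
    using second_difference_bound[OF U f Df e, of w v] unfolding N_def add.commute[of "norm w" "norm v"] by blast
  define t where "t = min d1 d2 / 2"
  have t: "0 < t" "t < d1" "t < d2" using d1(1) d2(1) by (auto simp: t_def)
  have sw: "a + t *\<^sub>R w + t *\<^sub>R v = a + t *\<^sub>R v + t *\<^sub>R w" by simp
  have "\<bar>t\<^sup>2 * H v w - t\<^sup>2 * H w v\<bar> \<le> t\<^sup>2 * (2 * e * N) + t\<^sup>2 * (2 * e * N)"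
    using d1(2)[OF t(1,2)] d2(2)[OF t(1,3)] unfolding sw by linarith
  then have "t\<^sup>2 * \<bar>H v w - H w v\<bar> \<le> t\<^sup>2 * (4 * e * N)"
    unfolding right_diff_distrib[symmetric] abs_mult by (simp add: algebra_simps)
  then have "\<bar>H v w - H w v\<bar> \<le> 4 * e * N" using t(1) by simp
  also have "\<dots> < 5 * (N + 1) * e" 
  proof -
    have "0 \<le> N * e" using e N by simp
    then show ?thesis using e by (simp add: algebra_simps)
  qed
  also have "\<dots> = \<bar>H v w - H w v\<bar>" using N by (simp add: e_def)
  finally show False by simp
qed

text \<open>The perturbation is made in the coordinate h rather than in the point
  \<open>S h\<close>: along \<open>h + t *\<^sub>R k\<close> the penalty is a differentiable
  quadratic with derivative \<open>h \<bullet> k\<close> at 0, although it is infinite off the range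
  of the square root.\<close>

lemma tikhonov_stationary:
  fixes f :: "'a::real_inner \<Rightarrow> real"
  assumes S: "bounded_linear S" and f: "(f has_derivative f') (at (S h))"
    and min: "\<And>k. f (S h) + (norm h)\<^sup>2 / 2 \<le> f (S k) + (norm k)\<^sup>2 / 2"
  shows "f' (S k) = - (h \<bullet> k)"
proof -
  note lin = bounded_linear.linear[OF S]
  have bf: "bounded_linear f'" using f by (rule has_derivative_bounded_linear)
  define j where "j t = f (S (h + t *\<^sub>R k)) + ((h + t *\<^sub>R k) \<bullet> (h + t *\<^sub>R k)) / 2" for t
  have "((\<lambda>t. f (S (h + t *\<^sub>R k))) has_derivative (\<lambda>t. f' (S (t *\<^sub>R k)))) (at 0)"
  proof (rule has_derivative_compose[where g=f and f="\<lambda>t. S (h + t *\<^sub>R k)"])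
    show "((\<lambda>t. S (h + t *\<^sub>R k)) has_derivative (\<lambda>t. S (t *\<^sub>R k))) (at 0)"
      by (rule bounded_linear.has_derivative[OF S]) (auto intro!: derivative_eq_intros)
    show "(f has_derivative f') (at (S (h + 0 *\<^sub>R k)))" using f by simp
  qed
  then have "((\<lambda>t. f (S (h + t *\<^sub>R k))) has_real_derivative f' (S k)) (at 0)"
    unfolding has_field_derivative_def
    by (simp add: linear_scale[OF lin] linear_scale[OF bounded_linear.linear[OF bf]] mult_commute_abs)
  moreover have "((\<lambda>t. ((h + t *\<^sub>R k) \<bullet> (h + t *\<^sub>R k)) / 2) has_real_derivative h \<bullet> k) (at 0)"
    unfolding has_field_derivative_def
    by (auto intro!: derivative_eq_intros simp: inner_commute fun_eq_iff)
  ultimately have "(j has_real_derivative f' (S k) + h \<bullet> k) (at 0)"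
    unfolding j_def by (rule DERIV_add)
  moreover have "\<forall>y. \<bar>0 - y\<bar> < 1 \<longrightarrow> j 0 \<le> j y"
    using min by (simp add: j_def power2_norm_eq_inner)
  ultimately have "f' (S k) + h \<bullet> k = 0" by (intro DERIV_local_min[of j _ 0 1]) auto
  then show ?thesis by simp
qed

text \<open>Riesz representation of each functional \<open>K w\<close> supplies the witness for the
  definite description in \<open>form_op\<close>; linearity and boundedness are then inherited from
  \<open>K\<close>.\<close>

lemma form_op:
  fixes v :: "nat \<Rightarrow> 'a::{real_inner, complete_space}" and K :: "'a \<Rightarrow>\<^sub>L 'a \<Rightarrow>\<^sub>L real"
  assumes v: "basis_seq v"
  shows "K w z = form_op K w \<bullet> z" "bounded_linear (form_op K)"
proof -
  have "\<exists>u. \<forall>z. K w z = u \<bullet> z" for w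
    using riesz_representation[OF v blinfun.bounded_linear_right[of "K w"]] by metis
  then obtain T where T: "\<And>w z. K w z = T w \<bullet> z" by metis
  have "form_op K = T"
    unfolding form_op_def
  proof (rule the_equality)
    fix T' assume "\<forall>w z. K w z = T' w \<bullet> z"
    then have "T' w \<bullet> z = T w \<bullet> z" for w z using T by metis
    then show "T' = T" by (intro ext basis_seq_eqI[OF v])
  qed (use T in blast)
  moreover have "bounded_linear T"
  proof (rule bounded_linear_intro[where K="norm K"])
    show "T (x + y) = T x + T y" for x y
      by (rule basis_seq_eqI[OF v]) (simp add: T[symmetric] inner_add_left blinfun.add_left blinfun.add_right)
    show "T (r *\<^sub>R x) = r *\<^sub>R T x" for r x
      by (rule basis_seq_eqI[OF v]) (simp add: T[symmetric] blinfun.scaleR_left blinfun.scaleR_right)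
    show "norm (T x) \<le> norm x * norm K" for x
    proof (cases "T x = 0")
      case False
      have "norm (T x) * norm (T x) = K x (T x)" by (simp add: T power2_norm_eq_inner[symmetric] power2_eq_square)
      also have "\<dots> \<le> norm (K x) * norm (T x)" using norm_blinfun[of "K x" "T x"] by simp
      also have "\<dots> \<le> norm K * norm x * norm (T x)" by (intro mult_right_mono norm_blinfun) auto
      finally show ?thesis using False by (simp add: mult.commute)
    qed simp
  qed
  ultimately show "K w z = form_op K w \<bullet> z" "bounded_linear (form_op K)" using T by auto
qed

text \<open>Converts the angle estimate for the squared Hellinger distance, the left side, into the
  square of the constant in the main theorem.\<close>

lemma one_minus_sqrt_le:
  fixes K :: real
  assumes "0 < K" "K < 1"
  shows "1 - sqrt (1 - K\<^sup>2) \<le> K\<^sup>2 / (1 + (1 - K)\<^sup>2)"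
proof -
  let ?D = "1 + (1 - K)\<^sup>2"
  have D: "?D > 0" by (simp add: add_pos_nonneg)
  have "(2 * (1 - K) / ?D)\<^sup>2 \<le> 1 - K\<^sup>2"
  proof -
    \<comment> \<open>After clearing the denominator the difference factors, and its only
      non-obvious factor is a quadratic with negative discriminant.\<close>
    have "(1 - K\<^sup>2) * ?D\<^sup>2 - (2 * (1 - K))\<^sup>2 = (1 - K) * (K ^ 3 * (K\<^sup>2 - 3 * K + 4))"
      by (simp add: power2_eq_square power3_eq_cube algebra_simps)
    moreover have "K\<^sup>2 - 3 * K + 4 = (K - 3/2)\<^sup>2 + 7/4" by (simp add: power2_eq_square algebra_simps)
    then have "0 \<le> K\<^sup>2 - 3 * K + 4" by simp
    then have "0 \<le> (1 - K) * (K ^ 3 * (K\<^sup>2 - 3 * K + 4))" using assms by (intro mult_nonneg_nonneg) auto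
    ultimately have "(2 * (1 - K))\<^sup>2 \<le> (1 - K\<^sup>2) * ?D\<^sup>2" by linarith
    then show ?thesis using D by (simp add: power_divide divide_le_eq)
  qed
  then have "2 * (1 - K) / ?D \<le> sqrt (1 - K\<^sup>2)" by (rule real_le_rsqrt)
  moreover have "1 - K\<^sup>2 / ?D = 2 * (1 - K) / ?D"
    using D by (simp add: field_simps power2_eq_square)
  ultimately show ?thesis by linarith
qed

section \<open>Borel measures on a separable Hilbert space\<close>

text \<open>The type is not assumed second countable, so measurability of vector-valued maps is reduced
  to that of their coordinates.\<close>

lemma borel_measurable_basis:
  fixes X :: "'b \<Rightarrow> 'a::real_inner"
  assumes v: "basis_seq v" and X: "\<And>i. (\<lambda>\<omega>. X \<omega> \<bullet> v i) \<in> borel_measurable M"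
  shows "X \<in> borel_measurable M"
proof (rule borel_measurableI)
  fix S :: "'a set" assume S: "open S"
  obtain D :: "'a set" where D: "countable D" "\<And>x e. e > 0 \<Longrightarrow> \<exists>d\<in>D. dist d x < e"
    using basis_seq_countable_dense[OF v] by blast
  \<comment> \<open>Balls with centres in the countable dense set and rational radii form a
    countable base, so \<open>S\<close> is a countable union of them and only balls have to be
    treated.\<close>
  define I where "I = {p \<in> D \<times> \<rat>. ball (fst p) (snd p) \<subseteq> S}"
  have I: "countable I" unfolding I_def by (rule countable_subset[of _ "D \<times> \<rat>"]) (auto intro: D countable_rat)
  have S_eq: "S = (\<Union>p\<in>I. ball (fst p) (snd p))"
  proof (intro equalityI subsetI)
    fix x assume "x \<in> S"
    then obtain r where r: "r > 0" "ball x r \<subseteq> S" using S by (auto simp: open_contains_ball)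
    obtain d where d: "d \<in> D" "dist d x < r / 4" using D(2)[of "r/4" x] r by auto
    obtain q where q: "q \<in> \<rat>" "r / 4 < q" "q < r / 2" using Rats_dense_in_real[of "r/4" "r/2"] r by auto
    have "ball d q \<subseteq> ball x r"
    proof
      fix z assume "z \<in> ball d q"
      then show "z \<in> ball x r"
        using dist_triangle[of x z d] d(2) q r(1) by (auto simp: dist_commute)
    qed
    then have "(d, q) \<in> I" using d q r by (auto simp: I_def)
    moreover have "x \<in> ball d q" using d q by simp
    ultimately show "x \<in> (\<Union>p\<in>I. ball (fst p) (snd p))" by force
  qed (auto simp: I_def)
  have "X -` S \<inter> space M = (\<Union>p\<in>I. {\<omega> \<in> space M. X \<omega> \<in> ball (fst p) (snd p)})"
    by (subst S_eq) blast
  also have "\<dots> \<in> sets M"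
  proof (rule sets.countable_UN''[OF I])
    fix p assume "p \<in> I"
    have meas: "(\<lambda>\<omega>. (norm (X \<omega> - fst p))\<^sup>2) \<in> borel_measurable M"
    proof -
      \<comment> \<open>Parseval writes the distance to the centre in terms of the coordinates, the
        only quantities known to be measurable.\<close>
      have "(norm (X \<omega> - fst p))\<^sup>2 = (\<Sum>i. (X \<omega> \<bullet> v i - fst p \<bullet> v i)\<^sup>2)" for \<omega>
        using sums_unique[OF parseval[OF v, of "X \<omega> - fst p"]] by (simp add: inner_diff_left)
      moreover have "(\<lambda>\<omega>. \<Sum>i. (X \<omega> \<bullet> v i - fst p \<bullet> v i)\<^sup>2) \<in> borel_measurable M"
        using X by measurable
      ultimately show ?thesis by simp
    qed
    have "X \<omega> \<in> ball (fst p) (snd p) \<longleftrightarrow> sqrt ((norm (X \<omega> - fst p))\<^sup>2) < snd p" for \<omega>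
      by (simp add: dist_norm norm_minus_commute)
    then have "{\<omega> \<in> space M. X \<omega> \<in> ball (fst p) (snd p)}
        = {\<omega> \<in> space M. sqrt ((norm (X \<omega> - fst p))\<^sup>2) < snd p}" by blast
    also have "\<dots> \<in> sets M" using meas by measurable
    finally show "{\<omega> \<in> space M. X \<omega> \<in> ball (fst p) (snd p)} \<in> sets M" .
  qed
  finally show "X -` S \<inter> space M \<in> sets M" .
qed

text \<open>With the weight h normalised to total mass 1, the image under g is a probability measure
  on the line, and the cosine and sine integrals are the parts of its characteristic function;
  Levy's uniqueness theorem applies. The bound 2 accommodates weights such as
  \<open>1 + cos\<close>.\<close>

lemma weighted_char_unique:
  fixes g :: "'a \<Rightarrow> real"
  assumes M: "finite_measure M" "finite_measure N" and sets: "sets M = sets N"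
    and g: "g \<in> borel_measurable M"
    and h: "h \<in> borel_measurable M" "\<And>x. 0 \<le> h x" "\<And>x. h x \<le> (2::real)"
    and c: "\<And>t. (LINT x|M. h x * cos (t * g x)) = (LINT x|N. h x * cos (t * g x))"
    and s: "\<And>t. (LINT x|M. h x * sin (t * g x)) = (LINT x|N. h x * sin (t * g x))"
    and A: "A \<in> sets borel"
  shows "(LINT x|M. h x * indicator A (g x)) = (LINT x|N. h x * indicator A (g x))"
proof -
  have space: "space M = space N" using sets by (rule sets_eq_imp_space_eq)
  have meas_eq: "f \<in> borel_measurable M \<longleftrightarrow> f \<in> borel_measurable N" for f :: "'a \<Rightarrow> real"
    using measurable_cong_sets[OF sets refl] by blast
  define c0 where "c0 = (LINT x|M. h x)"
  \<comment> \<open>At t = 0 the cosine is 1, so both weights have the same total mass.\<close>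
  have c0N: "c0 = (LINT x|N. h x)" using c[of 0] by (simp add: c0_def)
  have key: "integrable L h \<and> (LINT x|L. h x * indicator A (g x)) = c0 * measure (distr (density L (\<lambda>x. ennreal (h x / c0))) borel g) A
      \<and> real_distribution (distr (density L (\<lambda>x. ennreal (h x / c0))) borel g)
      \<and> char (distr (density L (\<lambda>x. ennreal (h x / c0))) borel g) t
          = Complex ((LINT x|L. h x * cos (t * g x)) / c0) ((LINT x|L. h x * sin (t * g x)) / c0)"
    if L: "finite_measure L" "h \<in> borel_measurable L" "g \<in> borel_measurable L" "c0 = (LINT x|L. h x)" "c0 > 0" for L t
  proof -
    interpret finite_measure L by fact
    note [measurable] = L(2,3) A
    have hint: "integrable L h" using h by (intro integrable_const_bound[where B=2]) auto
    define D where "D = density L (\<lambda>x. ennreal (h x / c0))"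
    have hc: "0 \<le> h x / c0" for x using h(2) L(5) by simp
    have "emeasure D (space D) = (\<integral>\<^sup>+x. ennreal (h x / c0) \<partial>L)"
      by (simp add: D_def emeasure_density)
    also have "\<dots> = ennreal (LINT x|L. h x / c0)"
      using hint hc by (intro nn_integral_eq_integral) auto
    also have "(LINT x|L. h x / c0) = 1" using L(4,5) by simp
    finally interpret D: prob_space D by (intro prob_spaceI) simp
    have gD: "g \<in> borel_measurable D" using L(3) by (simp add: D_def)
    have rd: "real_distribution (distr D borel g)" using gD by (rule D.real_distribution_distr)
    have "measure (distr D borel g) A = (LINT x|D. indicator A (g x))"
    proof -
      have "measure (distr D borel g) A = (LINT x|distr D borel g. indicator A x)"
        by simp
      also have "\<dots> = (LINT x|D. indicator A (g x))"
        using gD by (intro integral_distr) auto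
      finally show ?thesis .
    qed
    also have "\<dots> = (LINT x|L. (h x / c0) * indicator A (g x))"
      unfolding D_def by (subst integral_density) (auto simp: hc)
    also have "\<dots> = (LINT x|L. h x * indicator A (g x)) / c0"
      by simp
    finally have m: "(LINT x|L. h x * indicator A (g x)) = c0 * measure (distr D borel g) A"
      using L(5) by simp
    have "char (distr D borel g) t = (CLINT x|D. iexp (t * g x))"
      unfolding char_def using gD by (subst integral_distr) auto
    also have "\<dots> = (CLINT x|L. (h x / c0) *\<^sub>R iexp (t * g x))"
      unfolding D_def by (subst integral_density) (auto simp: hc)
    also have "\<dots> = Complex ((LINT x|L. h x * cos (t * g x)) / c0) ((LINT x|L. h x * sin (t * g x)) / c0)"
    proof -
      have "integrable L (\<lambda>x. (h x / c0) *\<^sub>R iexp (t * g x))"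
        using h L(5) by (intro integrable_const_bound[where B="2 / c0"]) (auto simp: divide_right_mono)
      from integral_Re[OF this] integral_Im[OF this] show ?thesis
        by (simp add: complex_eq_iff Re_exp Im_exp)
    qed
    finally show ?thesis using hint m rd by (simp add: D_def)
  qed
  have hN: "h \<in> borel_measurable N" "g \<in> borel_measurable N" using h(1) g meas_eq by auto
  have c0nn: "c0 \<ge> 0" unfolding c0_def by (simp add: h(2))
  show ?thesis
  \<comment> \<open>Mass 0 cannot be normalised; in that case h vanishes almost everywhere for both
    measures.\<close>
  proof (cases "c0 = 0")
    case True
    have zero: "(LINT x|L. h x * indicator A (g x)) = 0"
      if L: "finite_measure L" "h \<in> borel_measurable L" "g \<in> borel_measurable L" "c0 = (LINT x|L. h x)" for L
    proof -
      interpret finite_measure L by fact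
      note [measurable] = L(2,3) A
      have hint: "integrable L h" using h by (intro integrable_const_bound[where B=2]) auto
      have "AE x in L. h x = 0"
        using integral_nonneg_eq_0_iff_AE[OF hint] h(2) L(4) True by simp
      then have "(LINT x|L. h x * indicator A (g x)) = (LINT x|L. 0)"
        by (intro integral_cong_AE) auto
      then show ?thesis by simp
    qed
    show ?thesis using zero[OF M(1) h(1) g c0_def] zero[OF M(2) hN c0N] by simp
  next
    case False
    then have pos: "c0 > 0" using c0nn by simp
    note kM = key[OF M(1) h(1) g c0_def pos] and kN = key[OF M(2) hN c0N pos]
    have "distr (density M (\<lambda>x. ennreal (h x / c0))) borel g = distr (density N (\<lambda>x. ennreal (h x / c0))) borel g"
    proof (rule Levy_uniqueness)
      show "char (distr (density M (\<lambda>x. ennreal (h x / c0))) borel g) = char (distr (density N (\<lambda>x. ennreal (h x / c0))) borel g)"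
        using kM kN by (auto simp: c s fun_eq_iff)
    qed (use kM kN in auto)
    then show ?thesis using kM kN by simp
  qed
qed

text \<open>Levy's one-dimensional theorem suffices: if \<open>M\<close> and \<open>N\<close> restricted to \<open>B\<close> have the same
  characteristic function, then applying it to the image of \<open>(1 + cos \<langle>x, w\<rangle>) 1\<^sub>B\<close> (and with \<open>sin\<close>)
  under \<open>\<langle>_, e\<rangle>\<close> shows the same for the restrictions to \<open>B \<inter> {x. \<langle>x, e\<rangle> \<in> A}\<close>.\<close>

definition char_agree :: "'a::real_inner measure \<Rightarrow> 'a measure \<Rightarrow> 'a set \<Rightarrow> bool" where
  "char_agree M N B \<longleftrightarrow> (\<forall>w. (LINT x|M. indicator B x * cos (x \<bullet> w)) = (LINT x|N. indicator B x * cos (x \<bullet> w)) \<and>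
      (LINT x|M. indicator B x * sin (x \<bullet> w)) = (LINT x|N. indicator B x * (sin (x \<bullet> w) :: real)))"

lemma char_agree_Int:
  fixes M N :: "'a::real_inner measure"
  assumes M: "finite_measure M" "finite_measure N" and sets: "sets M = sets borel" "sets N = sets borel"
    and B: "B \<in> sets borel" and agree: "char_agree M N B" and A: "A \<in> sets borel"
  shows "char_agree M N (B \<inter> {x. x \<bullet> e \<in> A})"
proof -
  have inner_meas: "(\<lambda>x. x \<bullet> w) \<in> borel_measurable borel" for w :: 'a
    by (intro borel_measurable_continuous_onI continuous_intros)
  have int: "integrable L (\<lambda>x. indicator B x * cos (x \<bullet> w))" "integrable L (\<lambda>x. indicator B x * sin (x \<bullet> w))"
    "integrable L (\<lambda>x. indicator B x * f (x \<bullet> w) * indicator A (x \<bullet> e))"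
    if L: "L = M \<or> L = N" and f: "f = cos \<or> f = sin" for w L and f :: "real \<Rightarrow> real"
  proof -
    interpret finite_measure L using M L by auto
    have sL: "sets L = sets borel" using L sets by auto
    have [measurable]: "B \<in> sets L" "A \<in> sets borel" "\<And>w. (\<lambda>x. x \<bullet> w) \<in> borel_measurable L"
      using B A sL inner_meas measurable_cong_sets[OF sL refl] by auto
    have [measurable]: "f \<in> borel_measurable borel" using f by auto
    have f1: "\<bar>f y\<bar> \<le> 1" for y using f by auto
    show "integrable L (\<lambda>x. indicator B x * cos (x \<bullet> w))" "integrable L (\<lambda>x. indicator B x * sin (x \<bullet> w))"
      by (intro integrable_const_bound[where B=1]; auto simp: abs_mult indicator_def)+
    show "integrable L (\<lambda>x. indicator B x * f (x \<bullet> w) * indicator A (x \<bullet> e))"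
      using f1 by (intro integrable_const_bound[where B=1]; auto simp: abs_mult indicator_def)
  qed
  have c: "(LINT x|M. indicator B x * cos (x \<bullet> w)) = (LINT x|N. indicator B x * cos (x \<bullet> w))"
    and s: "(LINT x|M. indicator B x * sin (x \<bullet> w)) = (LINT x|N. indicator B x * sin (x \<bullet> w))" for w
    using agree by (auto simp: char_agree_def)
  \<comment> \<open>Levy's theorem needs a nonnegative weight, hence \<open>1 + f\<close> in place
    of the signed f. The choice f = 0 gives the plain weight, which is subtracted afterwards to
    isolate the cosine or sine term.\<close>
  have gen: "(LINT x|M. (indicator B x * (1 + f (x \<bullet> w))) * indicator A (x \<bullet> e))
      = (LINT x|N. (indicator B x * (1 + f (x \<bullet> w))) * indicator A (x \<bullet> e))"
    if f: "f = cos \<or> f = sin \<or> f = (\<lambda>_. 0)" for w and f :: "real \<Rightarrow> real"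
  proof (rule weighted_char_unique[OF M])
    show "sets M = sets N" using sets by simp
    have sM: "borel_measurable M = borel_measurable borel" using measurable_cong_sets[OF sets(1) refl] by auto
    show "(\<lambda>x. x \<bullet> e) \<in> borel_measurable M" using inner_meas sM by auto
    have "f \<in> borel_measurable borel" using f by auto
    then show "(\<lambda>x. indicator B x * (1 + f (x \<bullet> w))) \<in> borel_measurable M"
      unfolding sM using B inner_meas[of w] by measurable
    have f1: "\<bar>f y\<bar> \<le> 1" for y using f by auto
    show "0 \<le> indicator B x * (1 + f (x \<bullet> w))" for x using f1[of "x \<bullet> w"] by (auto simp: indicator_def)
    show "indicator B x * (1 + f (x \<bullet> w)) \<le> 2" for x using f1[of "x \<bullet> w"] by (auto simp: indicator_def)
    have r: "t * (x \<bullet> e) = x \<bullet> (t *\<^sub>R e)" for t x by simp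
    \<comment> \<open>Product-to-sum formulas: the products become cosines and sines with
      frequencies z, \<open>w - z\<close> and \<open>w + z\<close>, at all of which the two measures
      agree on \<open>B\<close> by hypothesis.\<close>
    have 1: "(LINT x|L. indicator B x * (1 + cos (x \<bullet> w)) * cos (x \<bullet> z))
        = (LINT x|L. indicator B x * cos (x \<bullet> z)) + ((LINT x|L. indicator B x * cos (x \<bullet> (w - z))) + (LINT x|L. indicator B x * cos (x \<bullet> (w + z)))) / 2"
      "(LINT x|L. indicator B x * (1 + cos (x \<bullet> w)) * sin (x \<bullet> z))
        = (LINT x|L. indicator B x * sin (x \<bullet> z)) + ((LINT x|L. indicator B x * sin (x \<bullet> (w + z))) - (LINT x|L. indicator B x * sin (x \<bullet> (w - z)))) / 2"
      "(LINT x|L. indicator B x * (1 + sin (x \<bullet> w)) * cos (x \<bullet> z))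
        = (LINT x|L. indicator B x * cos (x \<bullet> z)) + ((LINT x|L. indicator B x * sin (x \<bullet> (w + z))) + (LINT x|L. indicator B x * sin (x \<bullet> (w - z)))) / 2"
      "(LINT x|L. indicator B x * (1 + sin (x \<bullet> w)) * sin (x \<bullet> z))
        = (LINT x|L. indicator B x * sin (x \<bullet> z)) + ((LINT x|L. indicator B x * cos (x \<bullet> (w - z))) - (LINT x|L. indicator B x * cos (x \<bullet> (w + z)))) / 2"
      if L: "L = M \<or> L = N" for L z
    proof -
      note i = int(1,2)[OF L disjI1[OF refl]]
      have e1: "indicator B x * (1 + cos (x \<bullet> w)) * cos (x \<bullet> z) = indicator B x * cos (x \<bullet> z) + (indicator B x * cos (x \<bullet> (w - z)) + indicator B x * cos (x \<bullet> (w + z))) / 2"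
        and e2: "indicator B x * (1 + cos (x \<bullet> w)) * sin (x \<bullet> z) = indicator B x * sin (x \<bullet> z) + (indicator B x * sin (x \<bullet> (w + z)) - indicator B x * sin (x \<bullet> (w - z))) / 2"
        and e3: "indicator B x * (1 + sin (x \<bullet> w)) * cos (x \<bullet> z) = indicator B x * cos (x \<bullet> z) + (indicator B x * sin (x \<bullet> (w + z)) + indicator B x * sin (x \<bullet> (w - z))) / 2"
        and e4: "indicator B x * (1 + sin (x \<bullet> w)) * sin (x \<bullet> z) = indicator B x * sin (x \<bullet> z) + (indicator B x * cos (x \<bullet> (w - z)) - indicator B x * cos (x \<bullet> (w + z))) / 2"
        for x :: 'a
        by (simp_all add: inner_add_right inner_diff_right cos_add cos_diff sin_add sin_diff indicator_def algebra_simps)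
      show "(LINT x|L. indicator B x * (1 + cos (x \<bullet> w)) * cos (x \<bullet> z))
        = (LINT x|L. indicator B x * cos (x \<bullet> z)) + ((LINT x|L. indicator B x * cos (x \<bullet> (w - z))) + (LINT x|L. indicator B x * cos (x \<bullet> (w + z)))) / 2"
        unfolding e1 by (simp add: i)
      show "(LINT x|L. indicator B x * (1 + cos (x \<bullet> w)) * sin (x \<bullet> z))
        = (LINT x|L. indicator B x * sin (x \<bullet> z)) + ((LINT x|L. indicator B x * sin (x \<bullet> (w + z))) - (LINT x|L. indicator B x * sin (x \<bullet> (w - z)))) / 2"
        unfolding e2 by (simp add: i)
      show "(LINT x|L. indicator B x * (1 + sin (x \<bullet> w)) * cos (x \<bullet> z))
        = (LINT x|L. indicator B x * cos (x \<bullet> z)) + ((LINT x|L. indicator B x * sin (x \<bullet> (w + z))) + (LINT x|L. indicator B x * sin (x \<bullet> (w - z)))) / 2"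
        unfolding e3 by (simp add: i)
      show "(LINT x|L. indicator B x * (1 + sin (x \<bullet> w)) * sin (x \<bullet> z))
        = (LINT x|L. indicator B x * sin (x \<bullet> z)) + ((LINT x|L. indicator B x * cos (x \<bullet> (w - z))) - (LINT x|L. indicator B x * cos (x \<bullet> (w + z)))) / 2"
        unfolding e4 by (simp add: i)
    qed
    note 1 = 1[OF disjI1[OF refl]] 1[OF disjI2[OF refl]]
    show "(LINT x|M. indicator B x * (1 + f (x \<bullet> w)) * cos (t * (x \<bullet> e))) = (LINT x|N. indicator B x * (1 + f (x \<bullet> w)) * cos (t * (x \<bullet> e)))" for t
      using f by (elim disjE; simp only: r 1 c s add_0_right mult_1_right)
    show "(LINT x|M. indicator B x * (1 + f (x \<bullet> w)) * sin (t * (x \<bullet> e))) = (LINT x|N. indicator B x * (1 + f (x \<bullet> w)) * sin (t * (x \<bullet> e)))" for t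
      using f by (elim disjE; simp only: r 1 c s add_0_right mult_1_right)
  qed (rule A)
  have split: "(LINT x|L. (indicator B x * (1 + f (x \<bullet> w))) * indicator A (x \<bullet> e))
      = (LINT x|L. indicator B x * indicator A (x \<bullet> e)) + (LINT x|L. indicator B x * f (x \<bullet> w) * indicator A (x \<bullet> e))"
    if L: "L = M \<or> L = N" and f: "f = cos \<or> f = sin" for L w and f :: "real \<Rightarrow> real"
  proof -
    have "integrable L (\<lambda>x. indicator B x * indicator A (x \<bullet> e) :: real)"
      using int(3)[OF L, of cos 0] by simp
    moreover have "(indicator B x * (1 + f (x \<bullet> w))) * indicator A (x \<bullet> e)
        = indicator B x * indicator A (x \<bullet> e) + indicator B x * f (x \<bullet> w) * indicator A (x \<bullet> e)" for x
      by (simp add: algebra_simps)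
    ultimately show ?thesis using int(3)[OF L f, of w] by (simp only: Bochner_Integration.integral_add)
  qed
  have ind: "indicator (B \<inter> {x. x \<bullet> e \<in> A}) x * y = indicator B x * y * (indicator A (x \<bullet> e) :: real)" for x and y :: real
    by (simp add: indicator_def)
  have base: "(LINT x|M. indicator B x * indicator A (x \<bullet> e)) = (LINT x|N. indicator B x * (indicator A (x \<bullet> e) :: real))"
    using gen[of "\<lambda>_. 0" 0] by simp
  have "(LINT x|M. indicator B x * f (x \<bullet> w) * indicator A (x \<bullet> e)) = (LINT x|N. indicator B x * f (x \<bullet> w) * indicator A (x \<bullet> e))"
    if f: "f = cos \<or> f = sin" for w and f :: "real \<Rightarrow> real"
    using gen[of f w] f base split[OF disjI1[OF refl] f, of w] split[OF disjI2[OF refl] f, of w] by auto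
  then show ?thesis unfolding char_agree_def ind by blast
qed

text \<open>Agreement of characteristic functions is transferred to every cylinder set by adding one
  coordinate condition at a time. Cylinders form an intersection-stable generator of the Borel sets,
  so equal values there suffice.\<close>

theorem measure_eqI_char:
  fixes M N :: "'a::real_inner measure"
  assumes v: "basis_seq (v :: nat \<Rightarrow> 'a)"
    and M: "prob_space M" "prob_space N" and sets: "sets M = sets borel" "sets N = sets borel"
    and char: "\<And>w. (CLINT x|M. iexp (x \<bullet> w)) = (CLINT x|N. iexp (x \<bullet> w))"
  shows "M = N"
proof -
  have fin: "finite_measure M" "finite_measure N" using M by (auto intro: prob_space.finite_measure)
  have inner_meas: "(\<lambda>x. x \<bullet> w) \<in> borel_measurable borel" for w :: 'a
    by (intro borel_measurable_continuous_onI continuous_intros)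
  define cyl where "cyl n A = {x::'a. \<forall>i<n. x \<bullet> v i \<in> A i}" for n :: nat and A :: "nat \<Rightarrow> real set"
  define \<P> where "\<P> = {cyl n A | n A. \<forall>i. A i \<in> sets borel}"
  have cyl_Suc: "cyl (Suc n) A = cyl n A \<inter> {x. x \<bullet> v n \<in> A n}" for n A
    by (auto simp: cyl_def less_Suc_eq)
  have cyl_meas: "cyl n A \<in> sets borel" if "\<forall>i. A i \<in> sets borel" for n A
  proof (induction n)
    case (Suc n)
    have "{x. x \<bullet> v n \<in> A n} = (\<lambda>x. x \<bullet> v n) -` A n \<inter> space borel" by auto
    also have "\<dots> \<in> sets borel" using that by (intro measurable_sets[OF inner_meas]) auto
    finally show ?case unfolding cyl_Suc using Suc by blast
  qed (simp add: cyl_def)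
  have Re: "(LINT x|L. cos (x \<bullet> w)) = Re (CLINT x|L. iexp (x \<bullet> w))" "(LINT x|L. sin (x \<bullet> w)) = Im (CLINT x|L. iexp (x \<bullet> w))"
    if L: "prob_space L" "sets L = sets borel" for L and w :: 'a
  proof -
    interpret prob_space L by fact
    have "(\<lambda>x. x \<bullet> w) \<in> borel_measurable L" using inner_meas measurable_cong_sets[OF L(2) refl] by auto
    then have "integrable L (\<lambda>x. iexp (x \<bullet> w))" by (intro integrable_iexp) auto
    then show "(LINT x|L. cos (x \<bullet> w)) = Re (CLINT x|L. iexp (x \<bullet> w))" "(LINT x|L. sin (x \<bullet> w)) = Im (CLINT x|L. iexp (x \<bullet> w))"
      by (simp_all flip: integral_Re integral_Im add: Re_exp Im_exp)
  qed
  have agree: "char_agree M N (cyl n A)" if "\<forall>i. A i \<in> sets borel" for n A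
  proof (induction n)
    case 0
    then show ?case using Re[OF M(1) sets(1)] Re[OF M(2) sets(2)] char by (simp add: cyl_def char_agree_def)
  next
    case (Suc n)
    then show ?case unfolding cyl_Suc using that by (intro char_agree_Int fin sets cyl_meas) auto
  qed
  have borel: "sets borel = sigma_sets UNIV \<P>"
  proof
    show "sigma_sets UNIV \<P> \<subseteq> sets borel"
      using cyl_meas sets.sigma_sets_subset[of \<P> borel] by (auto simp: \<P>_def)
    let ?S = "sigma (UNIV :: 'a set) \<P>"
    \<comment> \<open>The identity is measurable from the cylinder sigma-algebra because its
      coordinates are; hence every Borel set lies in that sigma-algebra.\<close>
    have "(\<lambda>x. x) \<in> borel_measurable ?S"
    proof (rule borel_measurable_basis[OF v])
      fix j
      show "(\<lambda>x. x \<bullet> v j) \<in> borel_measurable ?S"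
      proof (rule measurableI)
        fix B :: "real set" assume B: "B \<in> sets borel"
        have "cyl (Suc j) (\<lambda>i. if i = j then B else UNIV) = {x. x \<bullet> v j \<in> B}"
          by (auto simp: cyl_def)
        moreover have "\<forall>i. (if i = j then B else UNIV) \<in> sets borel" using B by simp
        then have "cyl (Suc j) (\<lambda>i. if i = j then B else UNIV) \<in> \<P>" unfolding \<P>_def by blast
        ultimately show "(\<lambda>x. x \<bullet> v j) -` B \<inter> space ?S \<in> sets ?S" by (simp add: vimage_def)
      qed simp
    qed
    then have "A \<in> sets ?S" if "A \<in> sets borel" for A
      using measurable_sets[OF _ that, of "\<lambda>x. x" ?S] by simp
    then show "sets borel \<subseteq> sigma_sets UNIV \<P>" by auto
  qed
  show ?thesis
  proof (rule measure_eqI_generator_eq[where E=\<P> and \<Omega>=UNIV and A="\<lambda>_. UNIV"])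
    show "Int_stable \<P>"
    proof (rule Int_stableI)
      fix a b assume "a \<in> \<P>" "b \<in> \<P>"
      then obtain n A m B where ab: "a = cyl n A" "\<forall>i. A i \<in> sets borel" "b = cyl m B" "\<forall>i. B i \<in> sets borel"
        by (auto simp: \<P>_def)
      have "a \<inter> b = cyl (max n m) (\<lambda>i. (if i < n then A i else UNIV) \<inter> (if i < m then B i else UNIV))"
        unfolding ab cyl_def by (auto simp: less_max_iff_disj)
      moreover have "\<forall>i. (if i < n then A i else UNIV) \<inter> (if i < m then B i else UNIV) \<in> sets borel"
        using ab by (auto intro!: sets.Int)
      ultimately show "a \<inter> b \<in> \<P>" unfolding \<P>_def by blast
    qed
    show "range (\<lambda>_. UNIV) \<subseteq> \<P>" by (auto simp: \<P>_def cyl_def intro!: exI[of _ 0])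
    show "emeasure M X = emeasure N X" if X: "X \<in> \<P>" for X
    proof -
      have "measure M X = measure N X"
      proof -
        have "char_agree M N X" "X \<in> sets borel" using X agree cyl_meas by (auto simp: \<P>_def)
        \<comment> \<open>At frequency 0 the cosine integral over the cylinder is its
          measure.\<close>
        then show ?thesis using sets unfolding char_agree_def by (auto dest!: spec[of _ 0])
      qed
      then show ?thesis using fin by (simp add: finite_measure.emeasure_eq_measure)
    qed
    show "emeasure M UNIV \<noteq> \<infinity>" using fin(1) by (simp add: finite_measure.emeasure_eq_measure)
  qed (use sets borel in auto)
qed

section \<open>Sequences of independent Gaussian variables\<close>

abbreviation normal_measure :: "real \<Rightarrow> real \<Rightarrow> real measure" where
  "normal_measure \<mu> \<sigma> \<equiv> density lborel (\<lambda>x. ennreal (normal_density \<mu> \<sigma> x))"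

lemma char_normal_measure:
  assumes "\<sigma> > 0"
  shows "char (normal_measure \<mu> \<sigma>) t = iexp (t * \<mu>) * exp (- (\<sigma>\<^sup>2 * t\<^sup>2) / 2)"
proof -
  interpret std: real_distribution std_normal_distribution by (rule real_dist_normal_dist)
  have "distributed std_normal_distribution lborel (\<lambda>x. x) std_normal_density"
    unfolding distributed_def by (auto simp: distr_id2)
  from std.normal_density_affine[OF this zero_less_one, of \<sigma> \<mu>]
  have "distributed std_normal_distribution lborel (\<lambda>x. \<mu> + \<sigma> * x) (normal_density \<mu> \<sigma>)"
    using assms by simp
  then have "normal_measure \<mu> \<sigma> = distr std_normal_distribution lborel (\<lambda>x. \<mu> + \<sigma> * x)"
    by (simp add: distributed_distr_eq_density)
  then have "char (normal_measure \<mu> \<sigma>) t = (CLINT x|std_normal_distribution. iexp (t * (\<mu> + \<sigma> * x)))"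
    unfolding char_def by (simp add: integral_distr)
  also have "\<dots> = (CLINT x|std_normal_distribution. iexp (t * \<mu>) * iexp ((t * \<sigma>) * x))"
    by (simp add: algebra_simps exp_add)
  also have "\<dots> = iexp (t * \<mu>) * char std_normal_distribution (t * \<sigma>)"
    unfolding char_def by simp
  also have "\<dots> = iexp (t * \<mu>) * exp (- (\<sigma>\<^sup>2 * t\<^sup>2) / 2)"
    by (simp add: char_std_normal_distribution power_mult_distrib mult.commute)
  finally show ?thesis .
qed

lemma char_real_gaussian:
  assumes "v \<ge> 0"
  shows "char (real_gaussian a v) t = iexp (t * a) * exp (- (v * t\<^sup>2) / 2)"
proof (cases "v = 0")
  case True
  then show ?thesis by (simp add: real_gaussian_def char_def integral_return)
next
  case False
  then show ?thesis using assms char_normal_measure[of "sqrt v" a t] by (simp add: real_gaussian_def)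
qed

lemma char_gaussian_measure:
  fixes M :: "'a::real_inner measure"
  assumes M: "gaussian_measure M m C" and C: "0 \<le> C w \<bullet> w"
  shows "(CLINT u|M. iexp (u \<bullet> w)) = iexp (m \<bullet> w) * exp (- (C w \<bullet> w) / 2)"
proof -
  have sM: "sets M = sets borel" and D: "distr M borel (\<lambda>u. u \<bullet> w) = real_gaussian (m \<bullet> w) (C w \<bullet> w)"
    using M by (auto simp: gaussian_measure_def)
  have "(\<lambda>u. u \<bullet> w) \<in> borel_measurable borel"
    by (intro borel_measurable_continuous_onI continuous_intros)
  then have [measurable]: "(\<lambda>u. u \<bullet> w) \<in> borel_measurable M"
    using measurable_cong_sets[OF sM refl] by auto
  have "char (distr M borel (\<lambda>u. u \<bullet> w)) 1 = (CLINT u|M. iexp (u \<bullet> w))"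
    unfolding char_def by (subst integral_distr) auto
  then show ?thesis unfolding D char_real_gaussian[OF C] by simp
qed

text \<open>The entries of s are standard deviations, not variances. The measure lives on all real
  sequences, since unit variances already make a sequence almost surely not square summable.\<close>

definition gauss_seq :: "(nat \<Rightarrow> real) \<Rightarrow> (nat \<Rightarrow> real) \<Rightarrow> (nat \<Rightarrow> real) measure" where
  "gauss_seq a s = PiM UNIV (\<lambda>i. normal_measure (a i) (s i))"

lemma sets_gauss_seq [measurable_cong]: "sets (gauss_seq a s) = sets (PiM UNIV (\<lambda>_. borel))"
  unfolding gauss_seq_def by (intro sets_PiM_cong) auto

lemma gauss_seq_component [measurable]: "(\<lambda>\<omega>. \<omega> i) \<in> borel_measurable (gauss_seq a s)"
  by measurable

context
  fixes a s :: "nat \<Rightarrow> real"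
  assumes s: "\<And>i. 0 < s i"
begin

lemma product_prob_space_normal: "product_prob_space (\<lambda>i. normal_measure (a i) (s i))"
  by (intro product_prob_spaceI prob_space_normal_density s)

lemma prob_space_gauss_seq: "prob_space (gauss_seq a s)"
  unfolding gauss_seq_def by (intro prob_space_PiM prob_space_normal_density s)

lemma distr_gauss_seq: "distr (gauss_seq a s) borel (\<lambda>\<omega>. \<omega> i) = normal_measure (a i) (s i)"
proof -
  interpret product_prob_space "\<lambda>i. normal_measure (a i) (s i)" UNIV by (rule product_prob_space_normal)
  have "distr (gauss_seq a s) borel (\<lambda>\<omega>. \<omega> i) = distr (gauss_seq a s) (normal_measure (a i) (s i)) (\<lambda>\<omega>. \<omega> i)"
    by (rule distr_cong) auto
  then show ?thesis unfolding gauss_seq_def by (simp add: PiM_component)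
qed

lemma indep_vars_gauss_seq: "prob_space.indep_vars (gauss_seq a s) (\<lambda>_. borel) (\<lambda>i \<omega>. \<omega> i) UNIV"
proof -
  interpret prob_space "gauss_seq a s" by (rule prob_space_gauss_seq)
  have "distr (gauss_seq a s) (PiM UNIV (\<lambda>_. borel)) (\<lambda>x. \<lambda>i\<in>UNIV. x i) = gauss_seq a s"
    unfolding restrict_UNIV by (rule distr_id2) (simp add: sets_gauss_seq)
  then show ?thesis
    by (subst indep_vars_iff_distr_eq_PiM') (auto simp: distr_gauss_seq gauss_seq_def[symmetric])
qed

lemma gauss_seq_char:
  "(CLINT \<omega>|gauss_seq a s. iexp (c + (\<Sum>i<n. \<omega> i * y i)))
    = iexp (c + (\<Sum>i<n. a i * y i)) * exp (- (\<Sum>i<n. (s i)\<^sup>2 * (y i)\<^sup>2) / 2)"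
proof -
  interpret prob_space "gauss_seq a s" by (rule prob_space_gauss_seq)
  have "indep_vars (\<lambda>_. borel) (\<lambda>i \<omega>. \<omega> i * y i) {..<n}"
    by (rule indep_vars_compose2[where Y="\<lambda>i z. z * y i", OF indep_vars_subset[OF indep_vars_gauss_seq]]) auto
  from char_distr_sum[OF this, of 1]
  have "(CLINT \<omega>|gauss_seq a s. iexp (\<Sum>i<n. \<omega> i * y i))
      = (\<Prod>i<n. char (distr (gauss_seq a s) borel (\<lambda>\<omega>. \<omega> i * y i)) 1)"
    unfolding char_def by (subst (asm) integral_distr) auto
  also have "\<dots> = (\<Prod>i<n. iexp (y i * a i) * exp (- ((s i)\<^sup>2 * (y i)\<^sup>2) / 2))"
  proof (rule prod.cong)
    fix i
    have "char (distr (gauss_seq a s) borel (\<lambda>\<omega>. \<omega> i * y i)) 1 = (CLINT \<omega>|gauss_seq a s. iexp (y i * \<omega> i))"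
      unfolding char_def by (subst integral_distr) (auto simp: mult.commute)
    also have "\<dots> = (CLINT z|distr (gauss_seq a s) borel (\<lambda>\<omega>. \<omega> i). iexp (y i * z))"
      by (subst integral_distr) auto
    also have "\<dots> = char (normal_measure (a i) (s i)) (y i)" by (simp add: distr_gauss_seq char_def)
    finally show "char (distr (gauss_seq a s) borel (\<lambda>\<omega>. \<omega> i * y i)) 1
        = iexp (y i * a i) * exp (- ((s i)\<^sup>2 * (y i)\<^sup>2) / 2)"
      by (simp only: char_normal_measure[OF s])
  qed simp
  also have "\<dots> = iexp (\<Sum>i<n. a i * y i) * exp (- (\<Sum>i<n. (s i)\<^sup>2 * (y i)\<^sup>2) / 2)"
    by (simp add: prod.distrib exp_sum[symmetric] sum_distrib_left sum_divide_distrib sum_negf mult.commute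
        flip: of_real_prod exp_sum)
  finally have e: "(CLINT \<omega>|gauss_seq a s. iexp (\<Sum>i<n. \<omega> i * y i))
      = iexp (\<Sum>i<n. a i * y i) * exp (- (\<Sum>i<n. (s i)\<^sup>2 * (y i)\<^sup>2) / 2)" .
  have "(CLINT \<omega>|gauss_seq a s. iexp (c + (\<Sum>i<n. \<omega> i * y i)))
      = (CLINT \<omega>|gauss_seq a s. iexp c * iexp (\<Sum>i<n. \<omega> i * y i))"
    by (simp only: of_real_add ring_distribs exp_add)
  also have "\<dots> = iexp c * (CLINT \<omega>|gauss_seq a s. iexp (\<Sum>i<n. \<omega> i * y i))"
    by (rule integral_mult_right_zero)
  also have "\<dots> = iexp (c + (\<Sum>i<n. a i * y i)) * exp (- (\<Sum>i<n. (s i)\<^sup>2 * (y i)\<^sup>2) / 2)"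
    unfolding e by (simp only: of_real_add ring_distribs exp_add mult.assoc)
  finally show ?thesis .
qed

lemma gauss_seq_moments:
  shows "integrable (gauss_seq a s) (\<lambda>\<omega>. \<omega> i * \<omega> j)"
    and "(LINT \<omega>|gauss_seq a s. \<omega> i * \<omega> j) = a i * a j + (if i = j then (s i)\<^sup>2 else 0)"
proof -
  interpret prob_space "gauss_seq a s" by (rule prob_space_gauss_seq)
  have D: "integrable (gauss_seq a s) (\<lambda>\<omega>. f (\<omega> k)) = integrable lborel (\<lambda>z. normal_density (a k) (s k) z * f z)"
    "(LINT \<omega>|gauss_seq a s. f (\<omega> k)) = (LINT z|lborel. normal_density (a k) (s k) z * f z)"
    if [measurable]: "f \<in> borel_measurable borel" for f :: "real \<Rightarrow> real" and k
  proof -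
    have "integrable (gauss_seq a s) (\<lambda>\<omega>. f (\<omega> k)) = integrable (distr (gauss_seq a s) borel (\<lambda>\<omega>. \<omega> k)) f"
      by (subst integrable_distr_eq) auto
    then show "integrable (gauss_seq a s) (\<lambda>\<omega>. f (\<omega> k)) = integrable lborel (\<lambda>z. normal_density (a k) (s k) z * f z)"
      unfolding distr_gauss_seq by (subst (asm) integrable_density) auto
    have "(LINT \<omega>|gauss_seq a s. f (\<omega> k)) = (LINT z|distr (gauss_seq a s) borel (\<lambda>\<omega>. \<omega> k). f z)"
      by (subst integral_distr) auto
    then show "(LINT \<omega>|gauss_seq a s. f (\<omega> k)) = (LINT z|lborel. normal_density (a k) (s k) z * f z)"
      unfolding distr_gauss_seq by (subst (asm) integral_density) auto
  qed
  have 1: "integrable (gauss_seq a s) (\<lambda>\<omega>. \<omega> k)" "(LINT \<omega>|gauss_seq a s. \<omega> k) = a k" for k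
    using D[of "\<lambda>z. z" k] normal_moment_nz_1[OF s, of "a k" k] by (auto simp: has_bochner_integral_iff)
  have 2: "integrable (gauss_seq a s) (\<lambda>\<omega>. (\<omega> k - a k)\<^sup>2)" "(LINT \<omega>|gauss_seq a s. (\<omega> k - a k)\<^sup>2) = (s k)\<^sup>2" for k
    using D[of "\<lambda>z. (z - a k)\<^sup>2" k] normal_moment_even[OF s[of k], where \<mu>="a k" and k=1] by (auto simp: has_bochner_integral_iff fact_numeral)
  have sq: "\<omega> k * \<omega> k = (\<omega> k - a k)\<^sup>2 + 2 * a k * \<omega> k - (a k)\<^sup>2" for \<omega> k
    by (simp add: power2_eq_square algebra_simps)
  have 3: "integrable (gauss_seq a s) (\<lambda>\<omega>. \<omega> k * \<omega> k)" "(LINT \<omega>|gauss_seq a s. \<omega> k * \<omega> k) = a k * a k + (s k)\<^sup>2" for k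
    unfolding sq using 1[of k] 2[of k] by (auto simp: power2_eq_square prob_space)
  have "integrable (gauss_seq a s) (\<lambda>\<omega>. \<omega> i * \<omega> j) \<and>
      (LINT \<omega>|gauss_seq a s. \<omega> i * \<omega> j) = a i * a j + (if i = j then (s i)\<^sup>2 else 0)"
  proof (cases "i = j")
    case True then show ?thesis using 3 by auto
  next
    case False
    have iv: "indep_vars (\<lambda>_. borel) (\<lambda>i \<omega>. \<omega> i) {i, j}"
      by (rule indep_vars_subset[OF indep_vars_gauss_seq]) simp
    show ?thesis
      using indep_vars_integrable[OF _ iv 1(1)] indep_vars_lebesgue_integral[OF _ iv 1(1)] 1(2) False by simp
  qed
  then show "integrable (gauss_seq a s) (\<lambda>\<omega>. \<omega> i * \<omega> j)"
    and "(LINT \<omega>|gauss_seq a s. \<omega> i * \<omega> j) = a i * a j + (if i = j then (s i)\<^sup>2 else 0)" by auto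
qed

text \<open>Means and fluctuations separate: Cauchy-Schwarz bounds the mean part, and off-diagonal
  covariances vanish in the other. The bound is a multiple of a block sum of
  \<open>(norm (x i))\<^sup>2\<close>, so tails of that series control tails of the random
  series.\<close>

lemma gauss_seq_second_moment:
  fixes x :: "nat \<Rightarrow> 'a::real_inner"
  assumes I: "finite I" and \<sigma>: "\<And>i. s i \<le> \<sigma>"
  shows "integrable (gauss_seq a s) (\<lambda>\<omega>. (norm (\<Sum>i\<in>I. \<omega> i *\<^sub>R x i))\<^sup>2)"
    and "(LINT \<omega>|gauss_seq a s. (norm (\<Sum>i\<in>I. \<omega> i *\<^sub>R x i))\<^sup>2)
      \<le> ((\<Sum>i\<in>I. (a i)\<^sup>2) + \<sigma>\<^sup>2) * (\<Sum>i\<in>I. (norm (x i))\<^sup>2)"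
proof -
  have e: "(norm (\<Sum>i\<in>I. \<omega> i *\<^sub>R x i))\<^sup>2 = (\<Sum>i\<in>I. \<Sum>j\<in>I. (\<omega> i * \<omega> j) * (x i \<bullet> x j))" for \<omega> :: "nat \<Rightarrow> real"
    unfolding power2_norm_eq_inner inner_sum_left unfolding inner_sum_right by (simp add: mult.assoc mult.left_commute)
  note m = gauss_seq_moments
  show "integrable (gauss_seq a s) (\<lambda>\<omega>. (norm (\<Sum>i\<in>I. \<omega> i *\<^sub>R x i))\<^sup>2)"
    unfolding e by (intro Bochner_Integration.integrable_sum integrable_mult_left m)
  have "(LINT \<omega>|gauss_seq a s. (norm (\<Sum>i\<in>I. \<omega> i *\<^sub>R x i))\<^sup>2)
      = (\<Sum>i\<in>I. \<Sum>j\<in>I. (a i * a j + (if i = j then (s i)\<^sup>2 else 0)) * (x i \<bullet> x j))"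
    unfolding e
    by (subst Bochner_Integration.integral_sum, intro Bochner_Integration.integrable_sum integrable_mult_left m,
        intro sum.cong refl, subst Bochner_Integration.integral_sum, intro integrable_mult_left m)
      (simp add: m)
  also have "\<dots> = (\<Sum>i\<in>I. \<Sum>j\<in>I. (a i * a j) * (x i \<bullet> x j)) + (\<Sum>i\<in>I. \<Sum>j\<in>I. if i = j then (s i)\<^sup>2 * (x i \<bullet> x i) else 0)"
    unfolding sum.distrib[symmetric] by (intro sum.cong refl) (simp add: algebra_simps)
  also have "\<dots> = (norm (\<Sum>i\<in>I. a i *\<^sub>R x i))\<^sup>2 + (\<Sum>i\<in>I. (s i)\<^sup>2 * (norm (x i))\<^sup>2)"
    unfolding e using I by (simp add: power2_norm_eq_inner)
  also have "\<dots> \<le> (\<Sum>i\<in>I. (a i)\<^sup>2) * (\<Sum>i\<in>I. (norm (x i))\<^sup>2) + \<sigma>\<^sup>2 * (\<Sum>i\<in>I. (norm (x i))\<^sup>2)"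
  proof (rule add_mono)
    have "norm (\<Sum>i\<in>I. a i *\<^sub>R x i) \<le> (\<Sum>i\<in>I. \<bar>a i\<bar> * \<bar>norm (x i)\<bar>)"
      by (rule order_trans[OF norm_sum]) simp
    also have "\<dots> \<le> L2_set a I * L2_set (\<lambda>i. norm (x i)) I" by (rule L2_set_mult_ineq)
    finally have "(norm (\<Sum>i\<in>I. a i *\<^sub>R x i))\<^sup>2 \<le> (L2_set a I * L2_set (\<lambda>i. norm (x i)) I)\<^sup>2"
      by (intro power_mono) auto
    then show "(norm (\<Sum>i\<in>I. a i *\<^sub>R x i))\<^sup>2 \<le> (\<Sum>i\<in>I. (a i)\<^sup>2) * (\<Sum>i\<in>I. (norm (x i))\<^sup>2)"
      by (simp add: L2_set_def power_mult_distrib sum_nonneg)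
    show "(\<Sum>i\<in>I. (s i)\<^sup>2 * (norm (x i))\<^sup>2) \<le> \<sigma>\<^sup>2 * (\<Sum>i\<in>I. (norm (x i))\<^sup>2)"
      unfolding sum_distrib_left
      using s \<sigma> by (intro sum_mono mult_right_mono power_mono) (auto intro: less_imp_le)
  qed
  finally show "(LINT \<omega>|gauss_seq a s. (norm (\<Sum>i\<in>I. \<omega> i *\<^sub>R x i))\<^sup>2)
      \<le> ((\<Sum>i\<in>I. (a i)\<^sup>2) + \<sigma>\<^sup>2) * (\<Sum>i\<in>I. (norm (x i))\<^sup>2)"
    by (simp add: algebra_simps)
qed

text \<open>For functions of finitely many coordinates the infinite product reduces to Lebesgue
  measure with a product density, where two Gaussian laws can be compared pointwise.\<close>

lemma nn_integral_gauss_seq_restrict: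
  assumes f: "f \<in> borel_measurable (PiM {..<n} (\<lambda>_. borel :: real measure))"
  shows "(\<integral>\<^sup>+\<omega>. f (restrict \<omega> {..<n}) \<partial>gauss_seq a s)
    = (\<integral>\<^sup>+z. (\<Prod>i<n. ennreal (normal_density (a i) (s i) (z i))) * f z \<partial>PiM {..<n} (\<lambda>_. lborel))"
proof -
  interpret product_prob_space "\<lambda>i. normal_measure (a i) (s i)" UNIV by (rule product_prob_space_normal)
  interpret L: product_sigma_finite "\<lambda>_::nat. lborel :: real measure" by standard
  let ?p = "\<lambda>z. \<Prod>i<n. ennreal (normal_density (a i) (s i) (z i))"
  have sN: "sets (PiM {..<n} (\<lambda>i. normal_measure (a i) (s i))) = sets (PiM {..<n} (\<lambda>_. borel))"
    by (intro sets_PiM_cong) auto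
  have sL: "sets (PiM {..<n} (\<lambda>_. lborel)) = sets (PiM {..<n} (\<lambda>_. borel :: real measure))"
    by (intro sets_PiM_cong) auto
  have pm: "?p \<in> borel_measurable (PiM {..<n} (\<lambda>_. lborel))"
  proof (rule borel_measurable_prod_ennreal)
    fix i assume "i \<in> {..<n}"
    then have [measurable]: "(\<lambda>z. z i) \<in> borel_measurable (PiM {..<n} (\<lambda>_. lborel))"
      using measurable_component_singleton[of i "{..<n}" "\<lambda>_. lborel"] by simp
    show "(\<lambda>z. ennreal (normal_density (a i) (s i) (z i))) \<in> borel_measurable (PiM {..<n} (\<lambda>_. lborel))"
      by measurable
  qed
  have dens: "density (PiM {..<n} (\<lambda>_. lborel)) ?p = PiM {..<n} (\<lambda>i. normal_measure (a i) (s i))"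
  proof (rule PiM_eqI)
    show "sets (density (PiM {..<n} (\<lambda>_. lborel)) ?p) = sets (PiM {..<n} (\<lambda>i. normal_measure (a i) (s i)))"
      by (simp only: sets_density sN sL)
    fix A assume A: "\<And>i. i \<in> {..<n} \<Longrightarrow> A i \<in> sets (normal_measure (a i) (s i))"
    then have A': "\<And>i. i < n \<Longrightarrow> A i \<in> sets borel" by simp
    have box: "Pi\<^sub>E {..<n} A \<in> sets (PiM {..<n} (\<lambda>_. lborel))"
      using A' by (intro sets_PiM_I_finite) auto
    have "emeasure (density (PiM {..<n} (\<lambda>_. lborel)) ?p) (Pi\<^sub>E {..<n} A)
        = (\<integral>\<^sup>+z. ?p z * indicator (Pi\<^sub>E {..<n} A) z \<partial>PiM {..<n} (\<lambda>_. lborel))"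
      using pm box by (rule emeasure_density)
    also have "\<dots> = (\<integral>\<^sup>+z. (\<Prod>i<n. ennreal (normal_density (a i) (s i) (z i)) * indicator (A i) (z i)) \<partial>PiM {..<n} (\<lambda>_. lborel))"
    proof (rule nn_integral_cong)
      fix z assume z: "z \<in> space (PiM {..<n} (\<lambda>_. lborel :: real measure))"
      have "indicator (Pi\<^sub>E {..<n} A) z = (\<Prod>i<n. indicator (A i) (z i) :: ennreal)"
      proof (cases "z \<in> Pi\<^sub>E {..<n} A")
        case False
        then obtain i where "i < n" "z i \<notin> A i" using z by (auto simp: space_PiM PiE_iff)
        then have "(\<Prod>i<n. indicator (A i) (z i) :: ennreal) = 0" by (intro prod_zero) (auto intro!: bexI[of _ i])
        then show ?thesis using False by simp
      qed (auto simp: PiE_iff)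
      then show "?p z * indicator (Pi\<^sub>E {..<n} A) z = (\<Prod>i<n. ennreal (normal_density (a i) (s i) (z i)) * indicator (A i) (z i))"
        by (simp add: prod.distrib)
    qed
    also have "\<dots> = (\<Prod>i<n. \<integral>\<^sup>+z. ennreal (normal_density (a i) (s i) z) * indicator (A i) z \<partial>lborel)"
      using A' by (intro L.product_nn_integral_prod) auto
    also have "\<dots> = (\<Prod>i<n. emeasure (normal_measure (a i) (s i)) (A i))"
      using A' by (intro prod.cong refl) (simp add: emeasure_density)
    finally show "emeasure (density (PiM {..<n} (\<lambda>_. lborel)) ?p) (Pi\<^sub>E {..<n} A)
        = (\<Prod>i<n. emeasure (normal_measure (a i) (s i)) (A i))" .
  qed simp
  have "(\<integral>\<^sup>+\<omega>. f (restrict \<omega> {..<n}) \<partial>gauss_seq a s)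
      = (\<integral>\<^sup>+z. f z \<partial>distr (gauss_seq a s) (PiM {..<n} (\<lambda>i. normal_measure (a i) (s i))) (\<lambda>\<omega>. restrict \<omega> {..<n}))"
  proof -
    have "f \<in> borel_measurable (PiM {..<n} (\<lambda>i. normal_measure (a i) (s i)))"
      using f measurable_cong_sets[OF sN refl] by blast
    moreover have "(\<lambda>\<omega>. restrict \<omega> {..<n}) \<in> measurable (gauss_seq a s) (PiM {..<n} (\<lambda>i. normal_measure (a i) (s i)))"
      unfolding gauss_seq_def by (rule measurable_restrict_subset) simp
    ultimately show ?thesis by (simp add: nn_integral_distr)
  qed
  also have "\<dots> = (\<integral>\<^sup>+z. f z \<partial>density (PiM {..<n} (\<lambda>_. lborel)) ?p)"
    unfolding dens gauss_seq_def by (subst distr_PiM_restrict_finite) auto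
  also have "\<dots> = (\<integral>\<^sup>+z. ?p z * f z \<partial>PiM {..<n} (\<lambda>_. lborel))"
    using f measurable_cong_sets[OF sL refl, of "borel :: ennreal measure"] pm
    by (intro nn_integral_density) auto
  finally show ?thesis .
qed

end

section \<open>Gaussian series\<close>

definition partial_series :: "'a::real_vector \<Rightarrow> (nat \<Rightarrow> 'a) \<Rightarrow> nat \<Rightarrow> (nat \<Rightarrow> real) \<Rightarrow> 'a" where
  "partial_series m x n \<omega> = m + (\<Sum>i<n. \<omega> i *\<^sub>R x i)"

lemma partial_series_measurable:
  fixes m :: "'a::real_inner" and L :: "(nat \<Rightarrow> real) measure"
  assumes v: "basis_seq (v :: nat \<Rightarrow> 'a)" and L: "\<And>i. i < n \<Longrightarrow> (\<lambda>\<omega>. \<omega> i) \<in> borel_measurable L"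
  shows "partial_series m x n \<in> borel_measurable L"
proof (rule borel_measurable_basis[OF v])
  fix j
  show "(\<lambda>\<omega>. partial_series m x n \<omega> \<bullet> v j) \<in> borel_measurable L"
    unfolding partial_series_def inner_add_left inner_sum_left inner_scaleR_left
    using L by (intro borel_measurable_add borel_measurable_sum borel_measurable_times) auto
qed

text \<open>The rate 4^(-k) for squared norms makes the expected k-th block increment of the random
  series of order 2^(-k), which is summable.\<close>

lemma tail_subsequence:
  fixes y :: "nat \<Rightarrow> real"
  assumes y: "summable y" "\<And>i. 0 \<le> y i"
  obtains r where "strict_mono r" "\<And>k n. (\<Sum>i=r k..<n. y i) \<le> (1/4) ^ k"
proof -
  have "\<exists>N. \<forall>m\<ge>N. \<forall>n. norm (\<Sum>i=m..<n. y i) < (1/4) ^ k" for k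
    using y(1)[unfolded summable_Cauchy, rule_format, of "(1/4) ^ k"] by simp
  then obtain N where N: "\<And>k m n. m \<ge> N k \<Longrightarrow> norm (\<Sum>i=m..<n. y i) < (1/4) ^ k" by metis
  \<comment> \<open>Summing successors makes r strictly increasing and at the same time larger than
    \<open>N k\<close>.\<close>
  define r where "r k = (\<Sum>j\<le>k. Suc (N j))" for k
  have "strict_mono r" by (rule strict_monoI_Suc) (simp add: r_def)
  moreover have "(\<Sum>i=r k..<n. y i) \<le> (1/4) ^ k" for k n
  proof -
    have "Suc (N k) \<le> r k" unfolding r_def by (rule member_le_sum) auto
    then show ?thesis using N[of k "r k" n] by (simp add: abs_less_iff)
  qed
  ultimately show thesis using that by blast
qed

text \<open>The subsequence r depends only on x. The limit function \<open>U\<close> built below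
  involves \<open>x\<close>, \<open>m\<close> and \<open>r\<close> but neither \<open>a\<close> nor
  \<open>s\<close>, so the same function can be pushed forward under the product measures of the
  prior and of the Laplace approximation.\<close>

locale gauss_series =
  fixes v x :: "nat \<Rightarrow> 'a::{real_inner, complete_space}" and a s :: "nat \<Rightarrow> real" and \<sigma> :: real
    and m :: 'a and r :: "nat \<Rightarrow> nat"
  assumes basis: "basis_seq v" and s_pos: "\<And>i. 0 < s i" and s_le: "\<And>i. s i \<le> \<sigma>"
    and a_sq: "summable (\<lambda>i. (a i)\<^sup>2)"
    and r_mono: "strict_mono r" and tail: "\<And>k n. (\<Sum>i=r k..<n. (norm (x i))\<^sup>2) \<le> (1/4) ^ k"
begin

abbreviation "G \<equiv> gauss_seq a s"
abbreviation "T \<equiv> partial_series m x"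

lemma T_measurable [measurable]: "T n \<in> borel_measurable G"
  by (rule partial_series_measurable[OF basis]) simp

lemma increment:
  "T (r (Suc k)) \<omega> - T (r k) \<omega> = (\<Sum>i=r k..<r (Suc k). \<omega> i *\<^sub>R x i)"
proof -
  have "r k \<le> r (Suc k)" using r_mono by (simp add: strict_mono_less_eq)
  then have "(\<Sum>i<r (Suc k). \<omega> i *\<^sub>R x i) - (\<Sum>i<r k. \<omega> i *\<^sub>R x i) = (\<Sum>i=r k..<r (Suc k). \<omega> i *\<^sub>R x i)"
    unfolding lessThan_atLeast0 by (intro sum_diff_nat_ivl) auto
  then show ?thesis by (simp add: partial_series_def)
qed

lemma increment_measurable [measurable]:
  "(\<lambda>\<omega>. norm (T (r (Suc k)) \<omega> - T (r k) \<omega>)) \<in> borel_measurable G"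
proof -
  have "(\<lambda>\<omega>. T (r (Suc k)) \<omega> - T (r k) \<omega>) \<in> borel_measurable G"
  proof (rule borel_measurable_basis[OF basis])
    show "(\<lambda>\<omega>. (T (r (Suc k)) \<omega> - T (r k) \<omega>) \<bullet> v i) \<in> borel_measurable G" for i
      unfolding increment inner_sum_left inner_scaleR_left by measurable
  qed
  then show ?thesis
    by (rule measurable_compose) (intro borel_measurable_continuous_onI continuous_intros)
qed

lemma increment_nn_integral:
  "(\<integral>\<^sup>+\<omega>. ennreal (norm (T (r (Suc k)) \<omega> - T (r k) \<omega>)) \<partial>G) \<le> ennreal (((\<Sum>i. (a i)\<^sup>2) + \<sigma>\<^sup>2 + 1) * (1/2) ^ k)"
proof -
  interpret prob_space G by (rule prob_space_gauss_seq[OF s_pos])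
  let ?Z = "\<lambda>\<omega>. T (r (Suc k)) \<omega> - T (r k) \<omega>" and ?C = "(\<Sum>i. (a i)\<^sup>2) + \<sigma>\<^sup>2"
  have int: "integrable G (\<lambda>\<omega>. (norm (?Z \<omega>))\<^sup>2)"
    unfolding increment by (rule gauss_seq_second_moment[OF s_pos _ s_le]) simp
  have C0: "0 \<le> ?C" by (intro add_nonneg_nonneg suminf_nonneg a_sq) auto
  have "(LINT \<omega>|G. (norm (?Z \<omega>))\<^sup>2) \<le> ((\<Sum>i=r k..<r (Suc k). (a i)\<^sup>2) + \<sigma>\<^sup>2) * (\<Sum>i=r k..<r (Suc k). (norm (x i))\<^sup>2)"
    unfolding increment by (rule gauss_seq_second_moment[OF s_pos _ s_le]) simp
  also have "\<dots> \<le> ?C * (1/4) ^ k"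
    using C0 by (intro mult_mono add_right_mono sum_le_suminf a_sq tail) (auto intro: sum_nonneg)
  finally have le: "(LINT \<omega>|G. (norm (?Z \<omega>))\<^sup>2) \<le> ?C * (1/4) ^ k" .
  \<comment> \<open>Either the norm is at most 2^(-k), or multiplying it by 2^k times itself
    increases it. This trades the second moment, of order 4^(-k), for a first moment of order
    2^(-k).\<close>
  have pt: "norm (?Z \<omega>) \<le> 2 ^ k * (norm (?Z \<omega>))\<^sup>2 + (1/2) ^ k" for \<omega>
  proof (cases "norm (?Z \<omega>) \<le> (1/2) ^ k")
    case False
    then have "1 \<le> 2 ^ k * norm (?Z \<omega>)" by (simp add: power_divide field_simps)
    then have "norm (?Z \<omega>) * 1 \<le> norm (?Z \<omega>) * (2 ^ k * norm (?Z \<omega>))" by (intro mult_left_mono) auto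
    then have "norm (?Z \<omega>) \<le> 2 ^ k * (norm (?Z \<omega>))\<^sup>2" by (simp add: power2_eq_square ac_simps)
    also have "\<dots> \<le> 2 ^ k * (norm (?Z \<omega>))\<^sup>2 + (1/2) ^ k" by simp
    finally show ?thesis .
  qed (simp add: add_increasing)
  have "(\<integral>\<^sup>+\<omega>. ennreal (norm (?Z \<omega>)) \<partial>G) \<le> (\<integral>\<^sup>+\<omega>. ennreal (2 ^ k * (norm (?Z \<omega>))\<^sup>2 + (1/2) ^ k) \<partial>G)"
    by (intro nn_integral_mono ennreal_leI pt)
  also have "\<dots> = ennreal (LINT \<omega>|G. 2 ^ k * (norm (?Z \<omega>))\<^sup>2 + (1/2) ^ k)"
    using int by (intro nn_integral_eq_integral) auto
  also have "(LINT \<omega>|G. 2 ^ k * (norm (?Z \<omega>))\<^sup>2 + (1/2) ^ k) = 2 ^ k * (LINT \<omega>|G. (norm (?Z \<omega>))\<^sup>2) + (1/2) ^ k"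
    using int by (simp add: prob_space)
  also have "\<dots> \<le> 2 ^ k * (?C * (1/4) ^ k) + (1/2) ^ k"
    using le by (intro add_right_mono mult_left_mono) auto
  also have "\<dots> = (?C + 1) * (1/2) ^ k"
  proof -
    have "(2::real) ^ k * (1/4) ^ k = (1/2) ^ k" by (simp add: power_mult_distrib[symmetric])
    then show ?thesis by (simp add: algebra_simps)
  qed
  finally show ?thesis by (simp add: ennreal_leI)
qed

text \<open>The expected total length of the increments is bounded by a geometric series, so that
  length is almost surely finite.\<close>

lemma AE_increments_summable:
  "AE \<omega> in G. (\<Sum>k. ennreal (norm (T (r (Suc k)) \<omega> - T (r k) \<omega>))) < top"
proof -
  let ?C = "(\<Sum>i. (a i)\<^sup>2) + \<sigma>\<^sup>2 + 1"
  have C: "0 \<le> ?C" by (intro add_nonneg_nonneg suminf_nonneg a_sq) auto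
  have "(\<integral>\<^sup>+\<omega>. (\<Sum>k. ennreal (norm (T (r (Suc k)) \<omega> - T (r k) \<omega>))) \<partial>G)
      = (\<Sum>k. \<integral>\<^sup>+\<omega>. ennreal (norm (T (r (Suc k)) \<omega> - T (r k) \<omega>)) \<partial>G)"
    by (rule nn_integral_suminf) measurable
  also have "\<dots> \<le> (\<Sum>k. ennreal (?C * (1/2) ^ k))"
    by (intro suminf_le increment_nn_integral) auto
  also have "\<dots> = ennreal (\<Sum>k. ?C * (1/2) ^ k)"
    using C by (intro suminf_ennreal2) (auto intro!: summable_mult summable_geometric)
  also have "\<dots> < top" by simp
  finally have "(\<integral>\<^sup>+\<omega>. (\<Sum>k. ennreal (norm (T (r (Suc k)) \<omega> - T (r k) \<omega>))) \<partial>G) \<noteq> \<infinity>" by simp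
  then have "AE \<omega> in G. (\<Sum>k. ennreal (norm (T (r (Suc k)) \<omega> - T (r k) \<omega>))) \<noteq> \<infinity>"
    by (intro nn_integral_noteq_infinite) measurable
  then show ?thesis by eventually_elim (simp add: top.not_eq_extremum)
qed

lemma convergent_T:
  assumes "(\<Sum>k. ennreal (norm (T (r (Suc k)) \<omega> - T (r k) \<omega>))) < top"
  shows "convergent (\<lambda>k. T (r k) \<omega>)"
proof (rule Cauchy_convergent, rule metric_CauchyI)
  let ?z = "\<lambda>k. norm (T (r (Suc k)) \<omega> - T (r k) \<omega>)"
  fix e :: real assume e: "e > 0"
  have "summable ?z" using assms by (intro summable_suminf_not_top) auto
  from this[unfolded summable_Cauchy, rule_format, OF e]
  obtain N where N: "\<And>m n. m \<ge> N \<Longrightarrow> norm (\<Sum>k=m..<n. ?z k) < e" by blast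
  have *: "dist (T (r n) \<omega>) (T (r m) \<omega>) < e" if "m \<ge> N" "n \<ge> m" for m n
  proof -
    have "T (r n) \<omega> - T (r m) \<omega> = (\<Sum>k=m..<n. T (r (Suc k)) \<omega> - T (r k) \<omega>)"
      using sum_Suc_diff'[OF that(2), of "\<lambda>k. T (r k) \<omega>"] by simp
    then have "dist (T (r n) \<omega>) (T (r m) \<omega>) \<le> (\<Sum>k=m..<n. ?z k)"
      unfolding dist_norm by (simp add: norm_sum)
    also have "\<dots> < e" using N[OF that(1), of n] by (simp add: abs_less_iff)
    finally show ?thesis .
  qed
  show "\<exists>M. \<forall>m\<ge>M. \<forall>n\<ge>M. dist (T (r m) \<omega>) (T (r n) \<omega>) < e"
  proof (intro exI[of _ N] allI impI)
    fix m n assume "N \<le> m" "N \<le> n"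
    then show "dist (T (r m) \<omega>) (T (r n) \<omega>) < e"
      using *[of m n] *[of n m] by (cases "m \<le> n") (auto simp: dist_commute)
  qed
qed

text \<open>The guard is finiteness of the total increment length instead of convergence itself: it
  is visibly a measurable condition, it implies convergence by completeness, and it holds almost
  surely. The value 0 elsewhere is a default on a null set.\<close>

definition U :: "(nat \<Rightarrow> real) \<Rightarrow> 'a" where
  "U \<omega> = (if (\<Sum>k. ennreal (norm (T (r (Suc k)) \<omega> - T (r k) \<omega>))) < top then lim (\<lambda>k. T (r k) \<omega>) else 0)"

lemma AE_tendsto_U: "AE \<omega> in G. (\<lambda>k. T (r k) \<omega>) \<longlonglongrightarrow> U \<omega>"
  using AE_increments_summable
  by eventually_elim (use convergent_T in \<open>simp add: U_def convergent_LIMSEQ_iff\<close>)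

lemma U_measurable [measurable]: "U \<in> borel_measurable G"
proof (rule borel_measurable_basis[OF basis])
  fix j
  let ?P = "\<lambda>\<omega>. (\<Sum>k. ennreal (norm (T (r (Suc k)) \<omega> - T (r k) \<omega>))) < top"
  have "U \<omega> \<bullet> v j = (if ?P \<omega> then lim (\<lambda>k. T (r k) \<omega> \<bullet> v j) else 0)" for \<omega>
  proof (cases "?P \<omega>")
    case True
    then have "(\<lambda>k. T (r k) \<omega>) \<longlonglongrightarrow> U \<omega>" using convergent_T[OF True] by (simp add: U_def convergent_LIMSEQ_iff)
    then have "(\<lambda>k. T (r k) \<omega> \<bullet> v j) \<longlonglongrightarrow> U \<omega> \<bullet> v j" by (intro tendsto_intros)
    then show ?thesis using True by (simp add: limI)
  qed (simp add: U_def)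
  moreover have "(\<lambda>\<omega>. T (r k) \<omega> \<bullet> v j) \<in> borel_measurable G" for k
    by (rule measurable_compose[OF T_measurable]) (intro borel_measurable_continuous_onI continuous_intros)
  then have "(\<lambda>\<omega>. if ?P \<omega> then lim (\<lambda>k. T (r k) \<omega> \<bullet> v j) else 0) \<in> borel_measurable G"
    by measurable
  ultimately show "(\<lambda>\<omega>. U \<omega> \<bullet> v j) \<in> borel_measurable G" by simp
qed

text \<open>Characteristic functions of the partial sums are explicit. They converge to that of
  \<open>U\<close> by dominated convergence, all integrands having modulus 1, and to that of
  \<open>M\<close> by the mean and variance hypotheses.\<close>

lemma distr_U_eq:
  assumes M: "gaussian_measure M b C" and C: "\<And>w. 0 \<le> C w \<bullet> w"
    and mean: "\<And>w. (\<lambda>i. a i * (x i \<bullet> w)) sums ((b - m) \<bullet> w)"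
    and var: "\<And>w. (\<lambda>i. (s i)\<^sup>2 * (x i \<bullet> w)\<^sup>2) sums (C w \<bullet> w)"
  shows "distr G borel U = M"
proof (rule measure_eqI_char[OF basis])
  interpret prob_space G by (rule prob_space_gauss_seq[OF s_pos])
  show "prob_space (distr G borel U)" by (rule prob_space_distr) measurable
  show "prob_space M" "sets M = sets borel" using M by (auto simp: gaussian_measure_def)
  fix w :: 'a
  have inner_meas: "(\<lambda>u. u \<bullet> w) \<in> borel_measurable borel"
    by (intro borel_measurable_continuous_onI continuous_intros)
  have [measurable]: "(\<lambda>\<omega>. U \<omega> \<bullet> w) \<in> borel_measurable G" "(\<lambda>\<omega>. T n \<omega> \<bullet> w) \<in> borel_measurable G" for n
    by (rule measurable_compose[OF _ inner_meas]; measurable)+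
  have "(\<lambda>k. CLINT \<omega>|G. iexp (T (r k) \<omega> \<bullet> w)) \<longlonglongrightarrow> (CLINT \<omega>|G. iexp (U \<omega> \<bullet> w))"
  proof (rule integral_dominated_convergence[where w="\<lambda>_. 1"])
    show "AE \<omega> in G. (\<lambda>k. iexp (T (r k) \<omega> \<bullet> w)) \<longlonglongrightarrow> iexp (U \<omega> \<bullet> w)"
      using AE_tendsto_U by eventually_elim (intro tendsto_intros)
  qed auto
  moreover have "(\<lambda>k. CLINT \<omega>|G. iexp (T (r k) \<omega> \<bullet> w)) \<longlonglongrightarrow> iexp (b \<bullet> w) * exp (- (C w \<bullet> w) / 2)"
  proof -
    have "(CLINT \<omega>|G. iexp (T n \<omega> \<bullet> w))
        = iexp (m \<bullet> w + (\<Sum>i<n. a i * (x i \<bullet> w))) * exp (- (\<Sum>i<n. (s i)\<^sup>2 * (x i \<bullet> w)\<^sup>2) / 2)" for n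
      using gauss_seq_char[OF s_pos, where c="m \<bullet> w" and y="\<lambda>i. x i \<bullet> w"]
      by (simp add: partial_series_def inner_add_left inner_sum_left)
    moreover have "(\<lambda>n. iexp (m \<bullet> w + (\<Sum>i<n. a i * (x i \<bullet> w))) * exp (- (\<Sum>i<n. (s i)\<^sup>2 * (x i \<bullet> w)\<^sup>2) / 2))
        \<longlonglongrightarrow> iexp (m \<bullet> w + (b - m) \<bullet> w) * exp (- (C w \<bullet> w) / 2)"
      using mean[of w] var[of w] unfolding sums_def by (intro tendsto_intros) simp_all
    ultimately have "(\<lambda>n. CLINT \<omega>|G. iexp (T n \<omega> \<bullet> w)) \<longlonglongrightarrow> iexp (b \<bullet> w) * exp (- (C w \<bullet> w) / 2)"
      by (simp add: inner_diff_left)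
    from LIMSEQ_subseq_LIMSEQ[OF this r_mono] show ?thesis by (simp add: o_def)
  qed
  ultimately have "(CLINT \<omega>|G. iexp (U \<omega> \<bullet> w)) = iexp (b \<bullet> w) * exp (- (C w \<bullet> w) / 2)"
    by (rule LIMSEQ_unique)
  moreover have "(CLINT u|distr G borel U. iexp (u \<bullet> w)) = (CLINT \<omega>|G. iexp (U \<omega> \<bullet> w))"
    using inner_meas by (subst integral_distr) auto
  ultimately show "(CLINT u|distr G borel U. iexp (u \<bullet> w)) = (CLINT u|M. iexp (u \<bullet> w))"
    by (simp only: char_gaussian_measure[OF M C])
qed simp

end

section \<open>Densities between Gaussian series\<close>

text \<open>Both integrands depend on the first n coordinates only, so each side is an integral over
  n-dimensional Lebesgue measure and \<open>dens\<close> identifies the integrands.\<close>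

lemma gauss_seq_density_exchange:
  fixes F g :: "'a::real_inner \<Rightarrow> real"
  assumes v: "basis_seq (v :: nat \<Rightarrow> 'a)" and s: "\<And>i. 0 < s i" and t: "\<And>i. 0 < t i"
    and F: "continuous_on UNIV F" "\<And>u. 0 \<le> F u" and g: "continuous_on UNIV g" "\<And>u. 0 \<le> g u" and c: "0 \<le> c"
    and dens: "\<And>z. F (partial_series m x n z) * (\<Prod>i<n. normal_density (a i) (s i) (z i))
      = c * (\<Prod>i<n. normal_density (b i) (t i) (z i))"
  shows "(\<integral>\<^sup>+\<omega>. ennreal (g (partial_series m x n \<omega>) * F (partial_series m x n \<omega>)) \<partial>gauss_seq a s)
    = ennreal c * (\<integral>\<^sup>+\<omega>. ennreal (g (partial_series m x n \<omega>)) \<partial>gauss_seq b t)"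
proof -
  let ?T = "partial_series m x n" and ?B = "PiM {..<n} (\<lambda>_. borel :: real measure)" and ?L = "PiM {..<n} (\<lambda>_. lborel :: real measure)"
  have T: "?T (restrict \<omega> {..<n}) = ?T \<omega>" for \<omega> by (simp add: partial_series_def)
  have TB: "?T \<in> borel_measurable ?B"
    by (rule partial_series_measurable[OF v]) simp
  have gF: "(\<lambda>u. g u * F u) \<in> borel_measurable borel" "g \<in> borel_measurable borel"
    using F(1) g(1) by (auto intro!: borel_measurable_continuous_onI continuous_intros)
  have meas: "(\<lambda>z. ennreal (g (?T z) * F (?T z))) \<in> borel_measurable ?B" "(\<lambda>z. ennreal (g (?T z))) \<in> borel_measurable ?B"
    using measurable_compose[OF TB gF(1)] measurable_compose[OF TB gF(2)] by auto
  have sL: "sets ?L = sets ?B" by (intro sets_PiM_cong) auto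
  have measL: "(\<lambda>z. \<Prod>i<n. ennreal (normal_density (b i) (t i) (z i))) \<in> borel_measurable ?L"
  proof (rule borel_measurable_prod_ennreal)
    fix i assume "i \<in> {..<n}"
    then have [measurable]: "(\<lambda>z. z i) \<in> borel_measurable ?L"
      using measurable_component_singleton[of i "{..<n}" "\<lambda>_. lborel"] by simp
    show "(\<lambda>z. ennreal (normal_density (b i) (t i) (z i))) \<in> borel_measurable ?L" by measurable
  qed
  have measL': "(\<lambda>z. ennreal (g (?T z))) \<in> borel_measurable ?L"
    using meas(2) measurable_cong_sets[OF sL refl] by blast
  have "(\<integral>\<^sup>+\<omega>. ennreal (g (?T \<omega>) * F (?T \<omega>)) \<partial>gauss_seq a s)
      = (\<integral>\<^sup>+z. (\<Prod>i<n. ennreal (normal_density (a i) (s i) (z i))) * ennreal (g (?T z) * F (?T z)) \<partial>?L)"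
    using nn_integral_gauss_seq_restrict[OF s meas(1), where a=a] by (simp only: T)
  also have "\<dots> = (\<integral>\<^sup>+z. ennreal c * ((\<Prod>i<n. ennreal (normal_density (b i) (t i) (z i))) * ennreal (g (?T z))) \<partial>?L)"
  proof (rule nn_integral_cong)
    fix z
    have "(\<Prod>i<n. ennreal (normal_density (a i) (s i) (z i))) * ennreal (g (?T z) * F (?T z))
        = ennreal ((F (?T z) * (\<Prod>i<n. normal_density (a i) (s i) (z i))) * g (?T z))"
      using F(2) g(2) by (simp add: prod_ennreal prod_nonneg ennreal_mult'[symmetric] ac_simps)
    also have "\<dots> = ennreal (c * ((\<Prod>i<n. normal_density (b i) (t i) (z i)) * g (?T z)))"
      unfolding dens by (simp add: mult.assoc)
    also have "\<dots> = ennreal c * ((\<Prod>i<n. ennreal (normal_density (b i) (t i) (z i))) * ennreal (g (?T z)))"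
      using c g(2) by (simp add: prod_ennreal prod_nonneg ennreal_mult)
    finally show "(\<Prod>i<n. ennreal (normal_density (a i) (s i) (z i))) * ennreal (g (?T z) * F (?T z))
      = ennreal c * ((\<Prod>i<n. ennreal (normal_density (b i) (t i) (z i))) * ennreal (g (?T z)))" .
  qed
  also have "\<dots> = ennreal c * (\<integral>\<^sup>+z. (\<Prod>i<n. ennreal (normal_density (b i) (t i) (z i))) * ennreal (g (?T z)) \<partial>?L)"
    using measL measL' by (intro nn_integral_cmult borel_measurable_times_ennreal)
  also have "(\<integral>\<^sup>+z. (\<Prod>i<n. ennreal (normal_density (b i) (t i) (z i))) * ennreal (g (?T z)) \<partial>?L)
      = (\<integral>\<^sup>+\<omega>. ennreal (g (?T \<omega>)) \<partial>gauss_seq b t)"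
    using nn_integral_gauss_seq_restrict[OF t meas(2), where a=b] by (simp only: T)
  finally show ?thesis .
qed

text \<open>On the left \<open>F\<close> may be unbounded, so Fatou's lemma is used and only an
  inequality results. On the right just the bounded \<phi> remains, and dominated convergence gives
  the exact limit.\<close>

lemma gauss_series_compare_bounded:
  fixes F \<phi> :: "'a::{real_inner, complete_space} \<Rightarrow> real"
  assumes P: "gauss_series v x a s \<sigma> r" and Q: "gauss_series v x b t \<tau> r"
    and M: "distr (gauss_seq a s) borel (gauss_series.U x m r) = M"
    and N: "distr (gauss_seq b t) borel (gauss_series.U x m r) = N"
    and F: "continuous_on UNIV F" "\<And>u. 0 \<le> F u" and c: "\<And>n. 0 \<le> c n" "c \<longlonglongrightarrow> c'"
    and dens: "\<And>n z. F (partial_series m x n z) * (\<Prod>i<n. normal_density (a i) (s i) (z i))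
      = c n * (\<Prod>i<n. normal_density (b i) (t i) (z i))"
    and \<phi>: "continuous_on UNIV \<phi>" "\<And>u. 0 \<le> \<phi> u" "\<And>u. \<phi> u \<le> B"
  shows "(\<integral>\<^sup>+u. ennreal (\<phi> u * F u) \<partial>M) \<le> ennreal c' * (\<integral>\<^sup>+u. ennreal (\<phi> u) \<partial>N)"
proof -
  interpret P: gauss_series v x a s \<sigma> m r by (rule P)
  interpret Q: gauss_series v x b t \<tau> m r by (rule Q)
  interpret QP: prob_space Q.G by (rule prob_space_gauss_seq[OF Q.s_pos])
  let ?T = "\<lambda>k. partial_series m x (r k)" and ?U = "gauss_series.U x m r"
  have meas: "(\<lambda>u. \<phi> u * F u) \<in> borel_measurable borel" "\<phi> \<in> borel_measurable borel"
    using F(1) \<phi>(1) by (auto intro!: borel_measurable_continuous_onI continuous_intros)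
  have cont: "isCont F u" "isCont \<phi> u" for u
    using F(1) \<phi>(1) by (auto simp: continuous_on_eq_continuous_at)
  have B: "0 \<le> B" using \<phi>(2,3) order_trans by blast
  have "(\<integral>\<^sup>+u. ennreal (\<phi> u * F u) \<partial>M) = (\<integral>\<^sup>+\<omega>. ennreal (\<phi> (?U \<omega>) * F (?U \<omega>)) \<partial>P.G)"
    unfolding M[symmetric] using meas by (subst nn_integral_distr) (auto intro: P.U_measurable)
  also have "\<dots> = (\<integral>\<^sup>+\<omega>. liminf (\<lambda>k. ennreal (\<phi> (?T k \<omega>) * F (?T k \<omega>))) \<partial>P.G)"
  proof (rule nn_integral_cong_AE)
    show "AE \<omega> in P.G. ennreal (\<phi> (?U \<omega>) * F (?U \<omega>)) = liminf (\<lambda>k. ennreal (\<phi> (?T k \<omega>) * F (?T k \<omega>)))"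
      using P.AE_tendsto_U
    proof eventually_elim
      case (elim \<omega>)
      have "(\<lambda>k. ennreal (\<phi> (?T k \<omega>) * F (?T k \<omega>))) \<longlonglongrightarrow> ennreal (\<phi> (?U \<omega>) * F (?U \<omega>))"
        by (intro tendsto_ennrealI tendsto_mult isCont_tendsto_compose[OF cont(1)] isCont_tendsto_compose[OF cont(2)] elim)
      then show ?case by (simp add: lim_imp_Liminf)
    qed
  qed
  also have "\<dots> \<le> liminf (\<lambda>k. \<integral>\<^sup>+\<omega>. ennreal (\<phi> (?T k \<omega>) * F (?T k \<omega>)) \<partial>P.G)"
    by (rule nn_integral_liminf) (use measurable_compose[OF P.T_measurable meas(1)] in measurable)
  also have "(\<lambda>k. \<integral>\<^sup>+\<omega>. ennreal (\<phi> (?T k \<omega>) * F (?T k \<omega>)) \<partial>P.G)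
      = (\<lambda>k. ennreal (c (r k)) * (\<integral>\<^sup>+\<omega>. ennreal (\<phi> (?T k \<omega>)) \<partial>Q.G))"
    using gauss_seq_density_exchange[OF P.basis P.s_pos Q.s_pos F \<phi>(1,2) c(1) dens] by simp
  also have "liminf \<dots> = ennreal c' * (\<integral>\<^sup>+\<omega>. ennreal (\<phi> (?U \<omega>)) \<partial>Q.G)"
  proof -
    have int: "integrable Q.G (\<lambda>\<omega>. \<phi> (?T k \<omega>))" for k
      using measurable_compose[OF Q.T_measurable meas(2)] \<phi>(2,3)
      by (intro QP.integrable_const_bound[where B=B]) auto
    have mU: "(\<lambda>\<omega>. \<phi> (?U \<omega>)) \<in> borel_measurable Q.G"
      by (rule measurable_compose[OF Q.U_measurable meas(2)])
    have intU: "integrable Q.G (\<lambda>\<omega>. \<phi> (?U \<omega>))"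
      using mU \<phi>(2,3) by (intro QP.integrable_const_bound[where B=B]) auto
    have "(\<lambda>k. LINT \<omega>|Q.G. \<phi> (?T k \<omega>)) \<longlonglongrightarrow> (LINT \<omega>|Q.G. \<phi> (?U \<omega>))"
    proof (rule integral_dominated_convergence[where w="\<lambda>_. B"])
      show "AE \<omega> in Q.G. (\<lambda>k. \<phi> (?T k \<omega>)) \<longlonglongrightarrow> \<phi> (?U \<omega>)"
        using Q.AE_tendsto_U by eventually_elim (rule isCont_tendsto_compose[OF cont(2)])
    qed (use mU int \<phi>(2,3) in auto)
    then have "(\<lambda>k. c (r k) * (LINT \<omega>|Q.G. \<phi> (?T k \<omega>))) \<longlonglongrightarrow> c' * (LINT \<omega>|Q.G. \<phi> (?U \<omega>))"
      using LIMSEQ_subseq_LIMSEQ[OF c(2) Q.r_mono] by (intro tendsto_mult) (auto simp: o_def)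
    then have "(\<lambda>k. ennreal (c (r k) * (LINT \<omega>|Q.G. \<phi> (?T k \<omega>)))) \<longlonglongrightarrow> ennreal (c' * (LINT \<omega>|Q.G. \<phi> (?U \<omega>)))"
      by (rule tendsto_ennrealI)
    moreover have "c' \<ge> 0" using c by (intro LIMSEQ_le_const) auto
    ultimately have "(\<lambda>k. ennreal (c (r k)) * (\<integral>\<^sup>+\<omega>. ennreal (\<phi> (?T k \<omega>)) \<partial>Q.G)) \<longlonglongrightarrow> ennreal c' * (\<integral>\<^sup>+\<omega>. ennreal (\<phi> (?U \<omega>)) \<partial>Q.G)"
      using c(1) by (simp add: nn_integral_eq_integral[OF int] nn_integral_eq_integral[OF intU] \<phi>(2) ennreal_mult')
    then show ?thesis by (simp add: lim_imp_Liminf)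
  qed
  also have "(\<integral>\<^sup>+\<omega>. ennreal (\<phi> (?U \<omega>)) \<partial>Q.G) = (\<integral>\<^sup>+u. ennreal (\<phi> u) \<partial>N)"
    unfolding N[symmetric] using meas by (subst nn_integral_distr) (auto intro: Q.U_measurable)
  finally show ?thesis .
qed

text \<open>Boundedness of \<phi> is removed by truncation and monotone convergence, since the
  reverse inequality is obtained with the possibly unbounded test function
  \<open>\<phi> u * F u\<close>.\<close>

lemma gauss_series_compare:
  fixes F \<phi> :: "'a::{real_inner, complete_space} \<Rightarrow> real"
  assumes P: "gauss_series v x a s \<sigma> r" and Q: "gauss_series v x b t \<tau> r"
    and M: "distr (gauss_seq a s) borel (gauss_series.U x m r) = M"
    and N: "distr (gauss_seq b t) borel (gauss_series.U x m r) = N"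
    and F: "continuous_on UNIV F" "\<And>u. 0 \<le> F u" and c: "\<And>n. 0 \<le> c n" "c \<longlonglongrightarrow> c'"
    and dens: "\<And>n z. F (partial_series m x n z) * (\<Prod>i<n. normal_density (a i) (s i) (z i))
      = c n * (\<Prod>i<n. normal_density (b i) (t i) (z i))"
    and \<phi>: "continuous_on UNIV \<phi>" "\<And>u. 0 \<le> \<phi> u"
  shows "(\<integral>\<^sup>+u. ennreal (\<phi> u * F u) \<partial>M) \<le> ennreal c' * (\<integral>\<^sup>+u. ennreal (\<phi> u) \<partial>N)"
proof -
  have sM: "sets M = sets borel" using M by auto
  define g where "g k u = min (\<phi> u) (real k) * F u" for k u
  have gm: "(\<lambda>u. ennreal (g k u)) \<in> borel_measurable M" for k
  proof -
    have "g k \<in> borel_measurable borel"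
      unfolding g_def using F(1) \<phi>(1) by (intro borel_measurable_continuous_onI continuous_intros)
    then have "g k \<in> borel_measurable M" using measurable_cong_sets[OF sM refl] by blast
    then show ?thesis by measurable
  qed
  have inc: "incseq (\<lambda>k u. ennreal (g k u))"
    unfolding g_def using F(2) by (intro incseq_SucI le_funI ennreal_leI mult_right_mono) auto
  have lim: "(\<lambda>k. ennreal (g k u)) \<longlonglongrightarrow> ennreal (\<phi> u * F u)" for u
  proof (rule tendsto_eventually, rule eventually_sequentiallyI[of "nat \<lceil>\<phi> u\<rceil>"])
    fix k assume "nat \<lceil>\<phi> u\<rceil> \<le> k"
    then have "\<phi> u \<le> real k" by linarith
    then show "ennreal (g k u) = ennreal (\<phi> u * F u)" by (simp add: g_def min_absorb1)
  qed
  have "(\<lambda>k. \<integral>\<^sup>+u. ennreal (g k u) \<partial>M) \<longlonglongrightarrow> (\<integral>\<^sup>+u. ennreal (\<phi> u * F u) \<partial>M)"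
    by (rule nn_integral_LIMSEQ[OF inc gm lim])
  moreover have "(\<integral>\<^sup>+u. ennreal (g k u) \<partial>M) \<le> ennreal c' * (\<integral>\<^sup>+u. ennreal (\<phi> u) \<partial>N)" for k
  proof -
    have "(\<integral>\<^sup>+u. ennreal (g k u) \<partial>M) \<le> ennreal c' * (\<integral>\<^sup>+u. ennreal (min (\<phi> u) (real k)) \<partial>N)"
      unfolding g_def using \<phi>
      by (intro gauss_series_compare_bounded[OF P Q M N F c dens, where B="real k"] continuous_intros) auto
    also have "\<dots> \<le> ennreal c' * (\<integral>\<^sup>+u. ennreal (\<phi> u) \<partial>N)"
      by (intro mult_left_mono nn_integral_mono ennreal_leI) auto
    finally show ?thesis .
  qed
  ultimately show ?thesis by (intro LIMSEQ_le_const2) auto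
qed

text \<open>Applying the Fatou bound in both directions, the second time with \<open>1/F\<close> and the test function
  \<open>\<phi> F\<close>, turns it into an identity; no uniform integrability is needed.\<close>

lemma gauss_series_density_eq:
  fixes F :: "'a::{real_inner, complete_space} \<Rightarrow> real"
  assumes P: "gauss_series v x a s \<sigma> r" and Q: "gauss_series v x b t \<tau> r"
    and M: "distr (gauss_seq a s) borel (gauss_series.U x m r) = M"
    and N: "distr (gauss_seq b t) borel (gauss_series.U x m r) = N"
    and F: "continuous_on UNIV F" "\<And>u. 0 < F u" and c: "\<And>n. 0 < c n" "c \<longlonglongrightarrow> c'" "0 < c'"
    and dens: "\<And>n z. F (partial_series m x n z) * (\<Prod>i<n. normal_density (a i) (s i) (z i))
      = c n * (\<Prod>i<n. normal_density (b i) (t i) (z i))"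
  shows "density M (\<lambda>u. ennreal (F u)) = density N (\<lambda>_. ennreal c')"
proof -
  have sM: "sets M = sets borel" and sN: "sets N = sets borel" using M N by auto
  have meas: "f \<in> borel_measurable M" "f \<in> borel_measurable N" if "continuous_on UNIV f" for f :: "'a \<Rightarrow> real"
    using borel_measurable_continuous_onI[OF that] measurable_cong_sets[OF sM refl] measurable_cong_sets[OF sN refl] by blast+
  have eq: "(\<integral>\<^sup>+u. ennreal (\<phi> u * F u) \<partial>M) = ennreal c' * (\<integral>\<^sup>+u. ennreal (\<phi> u) \<partial>N)"
    if \<phi>: "continuous_on UNIV \<phi>" "\<And>u. 0 \<le> \<phi> u" for \<phi>
  proof (rule antisym)
    show "(\<integral>\<^sup>+u. ennreal (\<phi> u * F u) \<partial>M) \<le> ennreal c' * (\<integral>\<^sup>+u. ennreal (\<phi> u) \<partial>N)"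
      by (rule gauss_series_compare[OF P Q M N F(1) less_imp_le[OF F(2)] less_imp_le[OF c(1)] c(2) dens \<phi>])
    have cont: "continuous_on UNIV (\<lambda>u. inverse (F u))" "continuous_on UNIV (\<lambda>u. \<phi> u * F u)"
      using F \<phi>(1) by (auto intro!: continuous_intros simp: less_imp_neq[symmetric])
    have "(\<integral>\<^sup>+u. ennreal ((\<phi> u * F u) * inverse (F u)) \<partial>N) \<le> ennreal (inverse c') * (\<integral>\<^sup>+u. ennreal (\<phi> u * F u) \<partial>M)"
    proof (rule gauss_series_compare[OF Q P N M cont(1) _ _ _ _ cont(2)])
      show "(\<lambda>n. inverse (c n)) \<longlonglongrightarrow> inverse c'" using c(2,3) by (intro tendsto_inverse) auto
      show "inverse (F (partial_series m x n z)) * (\<Prod>i<n. normal_density (b i) (t i) (z i))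
          = inverse (c n) * (\<Prod>i<n. normal_density (a i) (s i) (z i))" for n z
        using dens[of n z] F(2)[of "partial_series m x n z"] c(1)[of n] by (simp add: field_simps)
    qed (use F(2) c(1) \<phi>(2) in \<open>auto intro: less_imp_le intro!: mult_nonneg_nonneg\<close>)
    moreover have "(\<phi> u * F u) * inverse (F u) = \<phi> u" for u using F(2)[of u] by simp
    ultimately have "(\<integral>\<^sup>+u. ennreal (\<phi> u) \<partial>N) \<le> ennreal (inverse c') * (\<integral>\<^sup>+u. ennreal (\<phi> u * F u) \<partial>M)" by simp
    then have "ennreal c' * (\<integral>\<^sup>+u. ennreal (\<phi> u) \<partial>N) \<le> ennreal c' * (ennreal (inverse c') * (\<integral>\<^sup>+u. ennreal (\<phi> u * F u) \<partial>M))"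
      by (rule mult_left_mono) simp
    also have "\<dots> = (\<integral>\<^sup>+u. ennreal (\<phi> u * F u) \<partial>M)"
      using c(3) by (simp add: mult.assoc[symmetric] ennreal_mult[symmetric])
    finally show "ennreal c' * (\<integral>\<^sup>+u. ennreal (\<phi> u) \<partial>N) \<le> (\<integral>\<^sup>+u. ennreal (\<phi> u * F u) \<partial>M)" .
  qed
  have eq_open: "emeasure (density M (\<lambda>u. ennreal (F u))) S = emeasure (density N (\<lambda>_. ennreal c')) S"
    if S: "open S" for S
  proof -
    \<comment> \<open>Continuous functions increasing to the indicator of the open set
      \<open>S\<close>. The whole space is separated because \<open>infdist\<close> to the empty
      complement is 0 and would give the limit 0.\<close>
    define g where "g k u = (if S = UNIV then 1 else min 1 (real k * infdist u (- S)))" for k u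
    have gc: "continuous_on UNIV (g k)" for k
      unfolding g_def by (cases "S = UNIV") (auto intro!: continuous_intros)
    have g0: "0 \<le> g k u" for k u by (simp add: g_def infdist_nonneg)
    have ginc: "g k u \<le> g (Suc k) u" for k u
      by (auto simp: g_def infdist_nonneg algebra_simps min.coboundedI2 intro!: min.mono add_increasing)
    have glim: "eventually (\<lambda>k. g k u = indicator S u) sequentially" for u
    proof (cases "u \<in> S \<and> S \<noteq> UNIV")
      case True
      then have "infdist u (- S) > 0"
        using S by (intro infdist_pos_not_in_closed) auto
      then obtain k0 where k0: "1 < real k0 * infdist u (- S)" using reals_Archimedean3 by blast
      show ?thesis
      proof (rule eventually_sequentiallyI[of k0])
        fix k assume "k0 \<le> k"
        then have "real k0 * infdist u (- S) \<le> real k * infdist u (- S)"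
          by (intro mult_right_mono infdist_nonneg) auto
        then show "g k u = indicator S u" using k0 True by (simp add: g_def)
      qed
    qed (auto simp: g_def)
    have "(\<lambda>k. \<integral>\<^sup>+u. ennreal (g k u * F u) \<partial>M) \<longlonglongrightarrow> (\<integral>\<^sup>+u. ennreal (F u) * indicator S u \<partial>M)"
    proof (rule nn_integral_LIMSEQ)
      show "incseq (\<lambda>k u. ennreal (g k u * F u))"
        using ginc F(2) by (intro incseq_SucI le_funI ennreal_leI mult_right_mono) (auto intro: less_imp_le)
      show "(\<lambda>u. ennreal (g k u * F u)) \<in> borel_measurable M" for k
        using meas(1)[OF gc] meas(1)[OF F(1)] by measurable
      show "(\<lambda>k. ennreal (g k u * F u)) \<longlonglongrightarrow> ennreal (F u) * indicator S u" for u
        by (rule tendsto_eventually, rule eventually_mono[OF glim[of u]]) (auto simp: indicator_def)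
    qed
    moreover have "(\<lambda>k. \<integral>\<^sup>+u. ennreal (g k u) \<partial>N) \<longlonglongrightarrow> (\<integral>\<^sup>+u. indicator S u \<partial>N)"
    proof (rule nn_integral_LIMSEQ)
      show "incseq (\<lambda>k u. ennreal (g k u))"
        using ginc by (intro incseq_SucI le_funI ennreal_leI) auto
      show "(\<lambda>u. ennreal (g k u)) \<in> borel_measurable N" for k
        using meas(2)[OF gc] by measurable
      show "(\<lambda>k. ennreal (g k u)) \<longlonglongrightarrow> indicator S u" for u
        by (rule tendsto_eventually, rule eventually_mono[OF glim[of u]]) (auto simp: indicator_def)
    qed
    then have "(\<lambda>k. ennreal c' * (\<integral>\<^sup>+u. ennreal (g k u) \<partial>N)) \<longlonglongrightarrow> ennreal c' * (\<integral>\<^sup>+u. indicator S u \<partial>N)"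
      by (intro ennreal_tendsto_cmult) auto
    ultimately have "(\<integral>\<^sup>+u. ennreal (F u) * indicator S u \<partial>M) = ennreal c' * (\<integral>\<^sup>+u. indicator S u \<partial>N)"
      unfolding eq[OF gc g0] by (rule LIMSEQ_unique)
    moreover have "S \<in> sets M" "S \<in> sets N" using S sM sN by auto
    ultimately show ?thesis
      using meas(1)[OF F(1)] by (simp add: emeasure_density nn_integral_cmult_indicator)
  qed
  show ?thesis
  proof (rule measure_eqI_generator_eq[where E="{S. open S}" and \<Omega>=UNIV and A="\<lambda>_. UNIV"])
    show "Int_stable {S :: 'a set. open S}" by (auto intro: Int_stableI)
    show "sets (density M (\<lambda>u. ennreal (F u))) = sigma_sets UNIV {S. open S}"
      by (simp add: sM borel_def)
    show "sets (density N (\<lambda>_. ennreal c')) = sigma_sets UNIV {S. open S}"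
      by (simp add: sN borel_def)
    have "prob_space N"
      unfolding N[symmetric] using gauss_series.U_measurable[OF Q]
      by (intro prob_space.prob_space_distr prob_space_gauss_seq) (auto intro: gauss_series.s_pos[OF Q])
    then interpret N: prob_space N .
    have "emeasure (density N (\<lambda>_. ennreal c')) UNIV = ennreal c' * emeasure N UNIV"
      using sN by (subst emeasure_density_const) auto
    then show "emeasure (density M (\<lambda>u. ennreal (F u))) UNIV \<noteq> \<infinity>"
      using eq_open[of UNIV] by (simp add: ennreal_mult_eq_top_iff N.emeasure_eq_measure)
  qed (use eq_open in auto)
qed

section \<open>The Laplace approximation\<close>

text \<open>Completing the square, h z - l z^2 / 2 - (z + h)^2 / 2 = - h^2 / 2 - (1 + l) z^2 / 2.
  This is the one-coordinate form of the change of measure, and \<open>sqrt (1 + l)\<close> is the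
  factor that assembles into the determinant.\<close>

lemma normal_density_tilt:
  assumes "0 < 1 + l"
  shows "exp (h * z - l * z\<^sup>2 / 2) * normal_density (- h) 1 z
    = exp (- h\<^sup>2 / 2) / sqrt (1 + l) * normal_density 0 (1 / sqrt (1 + l)) z"
proof -
  have "h * z - l * z\<^sup>2 / 2 + (- (z + h)\<^sup>2 / 2) = - h\<^sup>2 / 2 + (- z\<^sup>2 * (1 + l) / 2)"
    by (simp add: power2_eq_square field_simps)
  then have "exp (h * z - l * z\<^sup>2 / 2) * exp (- (z + h)\<^sup>2 / 2) = exp (- h\<^sup>2 / 2) * exp (- z\<^sup>2 * (1 + l) / 2)"
    unfolding exp_add[symmetric] by (rule arg_cong)
  moreover have "normal_density (- h) 1 z = exp (- (z + h)\<^sup>2 / 2) / sqrt (2 * pi)"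
    by (simp add: normal_density_def)
  moreover have "normal_density 0 (1 / sqrt (1 + l)) z = sqrt (1 + l) * exp (- z\<^sup>2 * (1 + l) / 2) / sqrt (2 * pi)"
    using assms by (simp add: normal_density_def power_divide real_sqrt_divide)
  ultimately show ?thesis using assms by simp
qed

text \<open>Here \<alpha> stands for the misfit at the MAP point. \<open>T\<Phi>\<close> is
  prescribed only on the range of \<open>op_sqrt C0\<close>, a null set of the prior in infinite
  dimension, but all partial sums of the series lie there and \<open>cont\<close> carries the
  comparison to their limits.\<close>

lemma laplace_density:
  fixes C0 H :: "'a::{real_inner, complete_space} \<Rightarrow> 'a" and T\<Phi> :: "'a \<Rightarrow> real"
  assumes C0: "covariance_op C0" "positive_definite_op C0" and prior: "gaussian_measure \<mu>0 0 C0"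
    and H: "symmetric_op H"
    and pos: "\<And>w. w \<noteq> 0 \<Longrightarrow> 0 < (w + prior_conj C0 H w) \<bullet> w"
    and laplace: "gaussian_measure \<nu> (op_sqrt C0 h) (laplace_cov C0 H)"
    and T\<Phi>: "\<And>k. T\<Phi> (op_sqrt C0 h + op_sqrt C0 k) = \<alpha> - h \<bullet> k + (H (op_sqrt C0 k) \<bullet> op_sqrt C0 k) / 2"
    and cont: "continuous_on UNIV T\<Phi>"
  shows "fredholm_det (prior_conj C0 H) > 0"
    and "density \<mu>0 (\<lambda>u. ennreal (exp (- T\<Phi> u)))
      = density \<nu> (\<lambda>_. ennreal (exp (- \<alpha> - (norm h)\<^sup>2 / 2) / sqrt (fredholm_det (prior_conj C0 H))))"
proof -
  define S where "S = op_sqrt C0"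
  define A where "A = prior_conj C0 H"
  have SS: "S (S x) = C0 x" and Ssym': "symmetric_op S" for x
    using op_sqrt[OF C0] by (auto simp: S_def)
  then have Sbl: "bounded_linear S" and Ssym: "S x \<bullet> y = x \<bullet> S y" for x y by (auto simp: symmetric_op_def)
  have Hbl: "bounded_linear H" and Hsym: "H x \<bullet> y = x \<bullet> H y" for x y using H by (auto simp: symmetric_op_def)
  note Slin = bounded_linear.linear[OF Sbl]
  have A: "A x = S (H (S x))" for x by (simp add: A_def prior_conj_def S_def)
  have Asym: "symmetric_op A"
    unfolding symmetric_op_def A
    using bounded_linear_compose[OF Sbl bounded_linear_compose[OF Hbl Sbl]] by (auto simp: A Ssym Hsym)
  obtain e where e: "basis_seq e" "summable (\<lambda>i. C0 (e i) \<bullet> e i)" using covariance_basis[OF C0] by blast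
  have nS: "(norm (S x))\<^sup>2 = C0 x \<bullet> x" for x by (simp add: power2_norm_eq_inner SS[symmetric] Ssym)
  have Shs: "summable (\<lambda>i. (norm (S (e i)))\<^sup>2)" unfolding nS by (rule e(2))
  obtain K where K: "K > 0" "\<And>x. norm (S (H x)) \<le> norm x * K"
    using bounded_linear.pos_bounded[OF bounded_linear_compose[OF Sbl Hbl]] by auto
  obtain KH where KH: "KH > 0" "\<And>x. norm (H x) \<le> norm x * KH"
    using bounded_linear.pos_bounded[OF Hbl] by auto
  \<comment> \<open>The trace condition on \<open>C0\<close> makes \<open>S\<close> Hilbert-Schmidt,
    and \<open>A\<close> is a bounded operator after \<open>S\<close>.\<close>
  have "summable (\<lambda>i. (norm (A (e i)))\<^sup>2)"
  proof (rule summable_comparison_test'[OF summable_mult[OF Shs, of "K\<^sup>2"]])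
    show "norm ((norm (A (e i)))\<^sup>2) \<le> K\<^sup>2 * (norm (S (e i)))\<^sup>2" for i
      using power_mono[OF K(2)[of "S (e i)"], of 2] by (simp add: A power_mult_distrib mult.commute)
  qed
  from hs_spectral[OF e(1) Asym this] obtain v l where v: "basis_seq v"
    and Av: "\<And>i. A (v i) = l i *\<^sub>R v i" and v0: "\<And>i. v i = 0 \<Longrightarrow> l i = 0" by blast
  note o = basis_seqD[OF v]
  have lpos: "0 < 1 + l i" for i
  proof (cases "v i = 0")
    case False
    then have "v i \<bullet> v i = 1" using basis_seq_cases[OF v] by auto
    then show ?thesis using pos[OF False] by (simp add: A_def[symmetric] Av inner_add_left)
  qed (simp add: v0)
  define x where "x i = S (v i)" for i
  have xhs: "summable (\<lambda>i. (norm (x i))\<^sup>2)" unfolding x_def by (rule hs_norm_basis[OF Ssym' e(1) o Shs])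
  \<comment> \<open>Absolute summability of the eigenvalues uses both factors \<open>S\<close>:
    \<open>l i = H (x i) \<bullet> x i\<close>, which is at most a constant times the squared norm
    of \<open>S (v i)\<close>.\<close>
  have labs: "summable (\<lambda>i. \<bar>l i\<bar>)"
  proof (rule summable_comparison_test'[OF summable_mult[OF xhs, of KH]])
    show "norm \<bar>l i\<bar> \<le> KH * (norm (x i))\<^sup>2" for i
    proof (cases "v i = 0")
      case False
      then have "v i \<bullet> v i = 1" using basis_seq_cases[OF v] by auto
      then have "l i = H (x i) \<bullet> x i" using Av[of i] Ssym[of "H (x i)" "v i"] by (simp add: A x_def)
      then have "\<bar>l i\<bar> \<le> norm (H (x i)) * norm (x i)" by (simp add: Cauchy_Schwarz_ineq2)
      also have "\<dots> \<le> norm (x i) * KH * norm (x i)" by (intro mult_right_mono KH) auto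
      finally show ?thesis by (simp add: power2_eq_square ac_simps)
    qed (use v0 KH in auto)
  qed
  have l0: "l \<longlonglongrightarrow> 0" using summable_LIMSEQ_zero[OF labs] by (simp add: tendsto_rabs_zero_iff)
  note fred = fredholm_det_eigenbasis[OF v Asym Av v0 labs lpos]
  show "fredholm_det (prior_conj C0 H) > 0" using fred(1) by (simp add: A_def)
  \<comment> \<open>The series is centred at \<open>S h\<close> while the prior has mean 0, so the
    coordinates must have means that cancel \<open>h\<close>.\<close>
  define a where "a i = - (h \<bullet> v i)" for i
  define t where "t i = 1 / sqrt (1 + l i)" for i
  have tpos: "0 < t i" for i using lpos by (simp add: t_def)
  have t2: "(t i)\<^sup>2 = 1 / (1 + l i)" for i using lpos[of i] by (simp add: t_def power_divide)
  have "t \<longlonglongrightarrow> 1 / sqrt (1 + 0)" unfolding t_def by (intro tendsto_intros l0) simp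
  then have "Bseq t" by (intro convergent_imp_Bseq convergentI)
  then obtain \<tau> where \<tau>: "\<And>i. \<bar>t i\<bar> \<le> \<tau>" by (auto simp: Bseq_def)
  obtain r where r: "strict_mono r" "\<And>k n. (\<Sum>i=r k..<n. (norm (x i))\<^sup>2) \<le> (1/4) ^ k"
    using tail_subsequence[OF xhs] by auto
  have P: "gauss_series v x a (\<lambda>_. 1) 1 r"
    by standard (use v r bessel_summable[OF o, of h] in \<open>auto simp: a_def\<close>)
  have Q: "gauss_series v x (\<lambda>_. 0) t \<tau> r"
    by standard (use v r tpos abs_le_D1[OF \<tau>] in auto)
  define m where "m = S h"
  have xw: "x i \<bullet> w = S w \<bullet> v i" for i w by (simp add: x_def Ssym inner_commute)
  have M: "distr (gauss_seq a (\<lambda>_. 1)) borel (gauss_series.U x m r) = \<mu>0"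
  proof (rule gauss_series.distr_U_eq[OF P prior])
    show "0 \<le> C0 w \<bullet> w" for w using C0(1) by (simp add: covariance_op_def)
    show "(\<lambda>i. a i * (x i \<bullet> w)) sums ((0 - m) \<bullet> w)" for w
      using sums_minus[OF parseval_inner[OF v, of h "S w"]] by (simp add: a_def xw m_def Ssym)
    show "(\<lambda>i. 1\<^sup>2 * (x i \<bullet> w)\<^sup>2) sums (C0 w \<bullet> w)" for w
      using parseval[OF v, of "S w"] by (simp add: xw nS)
  qed
  have var: "(\<lambda>i. (t i)\<^sup>2 * (x i \<bullet> w)\<^sup>2) sums (laplace_cov C0 H w \<bullet> w)" for w
  proof -
    have "laplace_cov C0 H w \<bullet> w = inv (\<lambda>w. w + A w) (S w) \<bullet> S w"
      by (simp add: laplace_cov_def A_def[symmetric] S_def[symmetric] Ssym)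
    moreover have "(\<lambda>i. (t i)\<^sup>2 * (x i \<bullet> w)\<^sup>2) sums (inv (\<lambda>w. w + A w) (S w) \<bullet> S w)"
    proof -
      have "(inv (\<lambda>w. w + A w) (S w) \<bullet> v i) * (S w \<bullet> v i) = (t i)\<^sup>2 * (x i \<bullet> w)\<^sup>2" for i
        unfolding inv_id_plus_inner[OF v Asym Av l0 lpos] t2 xw by (simp add: power2_eq_square)
      then show ?thesis using parseval_inner[OF v, of "inv (\<lambda>w. w + A w) (S w)" "S w"] by simp
    qed
    ultimately show ?thesis by simp
  qed
  have N: "distr (gauss_seq (\<lambda>_. 0) t) borel (gauss_series.U x m r) = \<nu>"
  proof (rule gauss_series.distr_U_eq[OF Q])
    show "gaussian_measure \<nu> m (laplace_cov C0 H)" using laplace by (simp add: m_def S_def)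
    show "0 \<le> laplace_cov C0 H w \<bullet> w" for w by (rule sums_le[OF _ sums_zero var]) simp
  qed (use var in auto)
  \<comment> \<open>The first n factors of the normalising constant. Parseval for \<open>h\<close>
    and the index-wise determinant limit give its convergence.\<close>
  define c where "c n = exp (- \<alpha>) * (\<Prod>i<n. exp (- (h \<bullet> v i)\<^sup>2 / 2) / sqrt (1 + l i))" for n
  have "density \<mu>0 (\<lambda>u. ennreal (exp (- T\<Phi> u))) = density \<nu> (\<lambda>_. ennreal (exp (- \<alpha>) * (exp (- (norm h)\<^sup>2 / 2) / sqrt (fredholm_det A))))"
  proof (rule gauss_series_density_eq[OF P Q M N])
    show "continuous_on UNIV (\<lambda>u. exp (- T\<Phi> u))" by (intro continuous_intros cont)
    show "0 < c n" for n unfolding c_def using lpos by (intro mult_pos_pos prod_pos) auto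
    have "(\<lambda>n. exp (- (\<Sum>i<n. (h \<bullet> v i)\<^sup>2) / 2) / sqrt (\<Prod>i<n. 1 + l i)) \<longlonglongrightarrow> exp (- (norm h)\<^sup>2 / 2) / sqrt (fredholm_det A)"
      using parseval[OF v, of h] fred unfolding sums_def by (intro tendsto_intros) auto
    moreover have "exp (- (\<Sum>i<n. (h \<bullet> v i)\<^sup>2) / 2) / sqrt (\<Prod>i<n. 1 + l i) = (\<Prod>i<n. exp (- (h \<bullet> v i)\<^sup>2 / 2) / sqrt (1 + l i))" for n
    proof -
      have "sqrt (\<Prod>i<n. 1 + l i) = (\<Prod>i<n. sqrt (1 + l i))" by (induction n) (simp_all add: real_sqrt_mult)
      then show ?thesis by (simp add: prod_dividef exp_sum[symmetric] sum_negf sum_divide_distrib)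
    qed
    ultimately show "c \<longlonglongrightarrow> exp (- \<alpha>) * (exp (- (norm h)\<^sup>2 / 2) / sqrt (fredholm_det A))"
      unfolding c_def by (intro tendsto_mult tendsto_const) simp
    show "0 < exp (- \<alpha>) * (exp (- (norm h)\<^sup>2 / 2) / sqrt (fredholm_det A))" using fred(1) by simp
    show "exp (- T\<Phi> (partial_series m x n z)) * (\<Prod>i<n. normal_density (a i) 1 (z i))
        = c n * (\<Prod>i<n. normal_density 0 (t i) (z i))" for n z
    proof -
      define k where "k = (\<Sum>i<n. z i *\<^sub>R v i)"
      have Sk: "partial_series m x n z = S h + S k"
        by (simp add: partial_series_def m_def k_def x_def linear_sum[OF Slin] linear_scale[OF Slin])
      have hk: "h \<bullet> k = (\<Sum>i<n. (h \<bullet> v i) * z i)"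
        by (simp add: k_def inner_sum_right mult.commute)
      have Ak: "A k = (\<Sum>i<n. z i *\<^sub>R l i *\<^sub>R v i)"
        using Asym unfolding k_def symmetric_op_def
        by (simp add: linear_sum[OF bounded_linear.linear] linear_scale[OF bounded_linear.linear] Av)
      \<comment> \<open>Moving one \<open>S\<close> across makes the Hessian term diagonal in the
        eigenbasis, so the exponent splits into one-coordinate terms.\<close>
      have "H (S k) \<bullet> S k = A k \<bullet> k" by (simp add: A Ssym)
      also have "\<dots> = (\<Sum>i<n. (l i * z i) * (k \<bullet> v i))"
        unfolding Ak inner_sum_left by (simp add: inner_commute[of "v _"] ac_simps)
      also have "\<dots> = (\<Sum>i<n. l i * (z i)\<^sup>2)"
      proof (rule sum.cong)
        fix i assume "i \<in> {..<n}"
        then have "k \<bullet> v i = z i * (v i \<bullet> v i)" unfolding k_def by (intro orthonormal_seq_inner_sum[OF o]) auto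
        then show "(l i * z i) * (k \<bullet> v i) = l i * (z i)\<^sup>2"
          using basis_seq_cases[OF v, of i] v0[of i] by (auto simp: power2_eq_square)
      qed simp
      finally have HS: "H (S k) \<bullet> S k = (\<Sum>i<n. l i * (z i)\<^sup>2)" .
      have "- T\<Phi> (partial_series m x n z) = - \<alpha> + (\<Sum>i<n. (h \<bullet> v i) * z i - l i * (z i)\<^sup>2 / 2)"
        using T\<Phi>[of k] unfolding Sk S_def[symmetric] HS hk by (simp add: sum_subtractf sum_divide_distrib)
      then have "exp (- T\<Phi> (partial_series m x n z)) = exp (- \<alpha>) * (\<Prod>i<n. exp ((h \<bullet> v i) * z i - l i * (z i)\<^sup>2 / 2))"
        by (simp only: exp_add exp_sum[OF finite_lessThan])
      then have "exp (- T\<Phi> (partial_series m x n z)) * (\<Prod>i<n. normal_density (a i) 1 (z i))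
          = exp (- \<alpha>) * (\<Prod>i<n. exp ((h \<bullet> v i) * z i - l i * (z i)\<^sup>2 / 2) * normal_density (- (h \<bullet> v i)) 1 (z i))"
        by (simp add: prod.distrib a_def)
      also have "\<dots> = c n * (\<Prod>i<n. normal_density 0 (t i) (z i))"
        unfolding normal_density_tilt[OF lpos] c_def t_def by (simp only: prod.distrib mult.assoc)
      finally show ?thesis .
    qed
  qed simp
  moreover have "exp (- \<alpha>) * (exp (- (norm h)\<^sup>2 / 2) / sqrt (fredholm_det A)) = exp (- \<alpha> - (norm h)\<^sup>2 / 2) / sqrt (fredholm_det A)"
  proof -
    have "- \<alpha> - (norm h)\<^sup>2 / 2 = - \<alpha> + - (norm h)\<^sup>2 / 2" by simp
    then show ?thesis by (simp only: exp_add times_divide_eq_right)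
  qed
  ultimately show "density \<mu>0 (\<lambda>u. ennreal (exp (- T\<Phi> u)))
      = density \<nu> (\<lambda>_. ennreal (exp (- \<alpha> - (norm h)\<^sup>2 / 2) / sqrt (fredholm_det (prior_conj C0 H))))"
    by (simp only: A_def)
qed

text \<open>After normalisation one minus the squared distance is the cosine of the angle between f
  and g in L^2, here \<open>?J / q\<close>. Being within \<open>K\<close> times the norm of g bounds
  that cosine below by \<open>sqrt (1 - K\<^sup>2)\<close>, whatever the norm of f.\<close>

lemma hellinger_dist_le:
  fixes f g :: "'a \<Rightarrow> real"
  assumes M: "prob_space M" and meas: "f \<in> borel_measurable M" "g \<in> borel_measurable M"
    and nn: "\<And>x. 0 \<le> f x" "\<And>x. 0 \<le> g x"
    and int: "integrable M (\<lambda>x. (f x)\<^sup>2)" "integrable M (\<lambda>x. (g x)\<^sup>2)"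
    and Z: "Zf = (LINT x|M. (f x)\<^sup>2)" "Zg = (LINT x|M. (g x)\<^sup>2)" "0 < Zf" "0 < Zg"
    and \<mu>: "\<mu> = density M (\<lambda>x. ennreal ((f x)\<^sup>2 / Zf))" and \<nu>: "\<nu> = density M (\<lambda>x. ennreal ((g x)\<^sup>2 / Zg))"
    and K: "0 < K" "K < 1" and le: "(LINT x|M. (f x - g x)\<^sup>2) \<le> K\<^sup>2 * Zg"
  shows "hellinger_dist M \<mu> \<nu> \<le> K / sqrt (1 + (1 - K)\<^sup>2)"
proof -
  interpret prob_space M by fact
  note [measurable] = meas
  have RN: "AE x in M. enn2real (RN_deriv M (density M (\<lambda>x. ennreal ((k x)\<^sup>2 / Z))) x) = (k x)\<^sup>2 / Z"
    if [measurable]: "k \<in> borel_measurable M" and "0 < Z" for k :: "'a \<Rightarrow> real" and Z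
  proof -
    have "AE x in M. ennreal ((k x)\<^sup>2 / Z) = RN_deriv M (density M (\<lambda>x. ennreal ((k x)\<^sup>2 / Z))) x"
      by (intro RN_deriv_unique) auto
    then show ?thesis
    proof eventually_elim
      case (elim x)
      then show ?case using \<open>0 < Z\<close> by (simp flip: elim)
    qed
  qed
  have fg: "integrable M (\<lambda>x. f x * g x)"
  proof (rule Bochner_Integration.integrable_bound[where f="\<lambda>x. (f x)\<^sup>2 + (g x)\<^sup>2"])
    show "AE x in M. norm (f x * g x) \<le> norm ((f x)\<^sup>2 + (g x)\<^sup>2)"
    proof (rule AE_I2)
      fix x
      have "0 \<le> (f x - g x)\<^sup>2" by simp
      then have "2 * (f x * g x) \<le> (f x)\<^sup>2 + (g x)\<^sup>2" by (simp add: power2_diff)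
      then show "norm (f x * g x) \<le> norm ((f x)\<^sup>2 + (g x)\<^sup>2)" 
        using mult_nonneg_nonneg[OF nn(1)[of x] nn(2)[of x]] by simp
    qed
  qed (use int in auto)
  let ?J = "LINT x|M. f x * g x"
  define q where "q = sqrt (Zf * Zg)"
  have q: "q > 0" using Z by (simp add: q_def)
  have "(LINT x|M. (sqrt (enn2real (RN_deriv M \<mu> x)) - sqrt (enn2real (RN_deriv M \<nu> x)))\<^sup>2)
      = (LINT x|M. (f x)\<^sup>2 / Zf + (g x)\<^sup>2 / Zg - 2 * (f x * g x) / q)"
  proof (rule integral_cong_AE)
    show "AE x in M. (sqrt (enn2real (RN_deriv M \<mu> x)) - sqrt (enn2real (RN_deriv M \<nu> x)))\<^sup>2
        = (f x)\<^sup>2 / Zf + (g x)\<^sup>2 / Zg - 2 * (f x * g x) / q"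
      unfolding \<mu> \<nu> using RN[OF meas(1) Z(3)] RN[OF meas(2) Z(4)]
    proof eventually_elim
      case (elim x)
      show ?case
        unfolding elim using Z(3,4) nn by (simp add: q_def power2_diff real_sqrt_divide real_sqrt_mult power_divide)
    qed
  qed simp_all
  also have "\<dots> = (LINT x|M. (f x)\<^sup>2) / Zf + (LINT x|M. (g x)\<^sup>2) / Zg - 2 * ?J / q"
    using int fg by simp
  also have "\<dots> = 2 - 2 * ?J / q" using Z by simp
  finally have hell: "hellinger_dist M \<mu> \<nu> = sqrt (1 - ?J / q)"
    unfolding hellinger_dist_def by (simp add: diff_divide_distrib right_diff_distrib)
  have "(LINT x|M. (f x - g x)\<^sup>2) = Zf + Zg - 2 * ?J"
    unfolding power2_diff Z(1,2) using int fg by (simp add: mult.assoc)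
  with le have "2 * ?J \<ge> Zf + (1 - K\<^sup>2) * Zg" by (simp add: algebra_simps)
  \<comment> \<open>The arithmetic-geometric mean inequality eliminates the unknown ratio of
    \<open>Zf\<close> and \<open>Zg\<close>; it amounts to minimising the cosine over the length of
    f.\<close>
  moreover have "2 * sqrt (Zf * ((1 - K\<^sup>2) * Zg)) \<le> Zf + (1 - K\<^sup>2) * Zg"
    using arith_geo_mean_sqrt[of Zf "(1 - K\<^sup>2) * Zg"] Z(3,4) K by (simp add: power_le_one)
  moreover have "sqrt (Zf * ((1 - K\<^sup>2) * Zg)) = sqrt (1 - K\<^sup>2) * q"
    by (simp add: q_def real_sqrt_mult)
  ultimately have "sqrt (1 - K\<^sup>2) * q \<le> ?J" by linarith
  then have "sqrt (1 - K\<^sup>2) \<le> ?J / q" using q by (simp add: pos_le_divide_eq)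
  then have "1 - ?J / q \<le> K\<^sup>2 / (1 + (1 - K)\<^sup>2)" using one_minus_sqrt_le[OF K] by linarith
  then have "sqrt (1 - ?J / q) \<le> sqrt (K\<^sup>2 / (1 + (1 - K)\<^sup>2))" by (rule real_sqrt_le_mono)
  also have "\<dots> = K / sqrt (1 + (1 - K)\<^sup>2)" using K by (simp add: real_sqrt_divide)
  finally show ?thesis unfolding hell .
qed

theorem proposition2:
  fixes G :: "'a::{real_inner, complete_space} \<Rightarrow> 'b::{real_inner, complete_space}"
    and y :: 'b
    and \<Gamma> :: "'b \<Rightarrow> 'b" and noise :: "'b measure"
    and C0 :: "'a \<Rightarrow> 'a" and \<mu>0 \<mu> \<nu> :: "'a measure"
    and \<Phi> :: "'a \<Rightarrow> real"
    and D\<Phi> :: "'a \<Rightarrow> 'a \<Rightarrow>\<^sub>L real" and H\<Phi> :: "'a \<Rightarrow> 'a \<Rightarrow>\<^sub>L 'a \<Rightarrow>\<^sub>L real"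
    and I :: "'a \<Rightarrow> ereal" and T\<Phi> :: "'a \<Rightarrow> real"
    and U :: "'a set" and u_MAP :: 'a and H A :: "'a \<Rightarrow> 'a" and K :: real
  assumes noise_cov: "covariance_op \<Gamma>" "positive_definite_op \<Gamma>"
    and noise: "gaussian_measure noise 0 \<Gamma>"
    and prior_cov: "covariance_op C0" "positive_definite_op C0"
    and prior: "gaussian_measure \<mu>0 0 C0"
    and misfit: "\<And>u. ereal (\<Phi> u) = ereal (1/2) * (cov_norm \<Gamma> (y - G u))\<^sup>2"
    and misfit_measurable: "\<Phi> \<in> borel_measurable borel"
    and posterior: "\<mu> = posterior \<mu>0 \<Phi>"
    and I: "I = regularized_misfit C0 \<Phi>"
    and MAP: "is_arg_min I (\<lambda>_. True) u_MAP"
    and C2: "open U" "u_MAP \<in> U" "C2_on U \<Phi> D\<Phi> H\<Phi>"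
    and H: "H = form_op (H\<Phi> u_MAP)"
    and A: "A = prior_conj C0 H"
    and HI_pos: "\<And>w. w \<noteq> 0 \<Longrightarrow> 0 < (w + A w) \<bullet> w"
    and laplace: "gaussian_measure \<nu> u_MAP (laplace_cov C0 H)"
    and taylor: "T\<Phi> = second_order_taylor \<Phi> D\<Phi> H\<Phi> u_MAP"
    and K: "0 < K" "K < 1"
    and L2: "in_L2 \<mu>0 (\<lambda>u. exp (- \<Phi> u / 2) - exp (- T\<Phi> u / 2))"
    and bound: "L2_norm \<mu>0 (\<lambda>u. exp (- \<Phi> u / 2) - exp (- T\<Phi> u / 2))
        \<le> K * (exp (- 1/2 * real_of_ereal (I u_MAP)) / root 4 (fredholm_det A))"
  shows "hellinger_dist \<mu>0 \<mu> \<nu> \<le> K / sqrt (1 + (1 - K)\<^sup>2)"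
proof -
  define S where "S = op_sqrt C0"
  define m where "m = u_MAP"
  have SS: "S (S x) = C0 x" and Ssym: "symmetric_op S" for x
    using op_sqrt[OF prior_cov] by (auto simp: S_def)
  then have Sbl: "bounded_linear S" and Sself: "S x \<bullet> y = x \<bullet> S y" for x y by (auto simp: symmetric_op_def)
  note Slin = bounded_linear.linear[OF Sbl]
  \<comment> \<open>\<open>cov_norm\<close> is defined through \<open>inv\<close>, so injectivity is
    what gives \<open>S k\<close> the penalty \<open>(norm k)\<^sup>2 / 2\<close>.\<close>
  have "inj S"
  proof (rule injI, rule ccontr)
    fix x y assume xy: "S x = S y" "x \<noteq> y"
    then have "S (x - y) = 0" by (simp add: linear_diff[OF Slin])
    then have "C0 (x - y) \<bullet> (x - y) = 0" by (simp add: SS[symmetric] linear_0[OF Slin])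
    then show False
      using prior_cov(2)[unfolded positive_definite_op_def, rule_format, of "x - y"] xy(2) by simp
  qed
  then have I_S: "I (S k) = ereal (\<Phi> (S k) + (norm k)\<^sup>2 / 2)" for k
    by (simp add: I regularized_misfit_def cov_norm_def S_def[symmetric] power2_eq_square)
  have I_min: "I m \<le> I u" for u using MAP by (auto simp: is_arg_min_def m_def not_less)
  \<comment> \<open>Off the range the functional is infinite, while at \<open>S 0\<close> it is
    finite.\<close>
  have "m \<in> range S"
  proof (rule ccontr)
    assume "m \<notin> range S"
    then have "I m = \<infinity>" by (simp add: I regularized_misfit_def cov_norm_def S_def[symmetric] power2_eq_square)
    then show False using I_min[of "S 0"] by (simp add: I_S)
  qed
  then obtain h where h: "m = S h" by blast
  have \<Phi>D: "(\<Phi> has_derivative blinfun_apply (D\<Phi> x)) (at x)" if "x \<in> U" for x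
    using C2(3) that by (auto simp: C2_on_def)
  have D\<Phi>D: "(D\<Phi> has_derivative blinfun_apply (H\<Phi> m)) (at m)"
    using C2 by (auto simp: C2_on_def m_def)
  have stat: "D\<Phi> m (S k) = - (h \<bullet> k)" for k
  proof (rule tikhonov_stationary[OF Sbl, of \<Phi> "blinfun_apply (D\<Phi> m)" h])
    show "(\<Phi> has_derivative blinfun_apply (D\<Phi> m)) (at (S h))" using \<Phi>D[of m] C2(2) by (simp add: h m_def[symmetric])
    show "\<Phi> (S h) + (norm h)\<^sup>2 / 2 \<le> \<Phi> (S k) + (norm k)\<^sup>2 / 2" for k
      using I_min[of "S k"] unfolding h I_S by simp
  qed
  obtain e :: "nat \<Rightarrow> 'a" where e: "basis_seq e" using covariance_basis[OF prior_cov] by blast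
  have "H = form_op (H\<Phi> m)" by (simp add: H m_def)
  then have H_form: "H\<Phi> m w z = H w \<bullet> z" and Hbl: "bounded_linear H" for w z
    using form_op[OF e, where K="H\<Phi> m"] by simp_all
  have Hsym: "symmetric_op H"
  proof -
    have "H\<Phi> m w z = H\<Phi> m z w" for w z
      by (rule second_derivative_symmetric[OF C2(1) _ \<Phi>D D\<Phi>D]) (use C2(2) in \<open>simp_all add: m_def\<close>)
    then show ?thesis using Hbl by (auto simp: symmetric_op_def H_form inner_commute)
  qed
  have T_eq: "T\<Phi> (S h + S k) = \<Phi> m - h \<bullet> k + (H (S k) \<bullet> S k) / 2" for k
    by (simp add: taylor second_order_taylor_def m_def[symmetric] h[symmetric] stat H_form)
  have T_cont: "continuous_on UNIV T\<Phi>"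
    unfolding taylor second_order_taylor_def by (intro continuous_intros)
  define c where "c = exp (- \<Phi> m - (norm h)\<^sup>2 / 2) / sqrt (fredholm_det A)"
  have det: "fredholm_det A > 0" and dens: "density \<mu>0 (\<lambda>u. ennreal (exp (- T\<Phi> u))) = density \<nu> (\<lambda>_. ennreal c)"
    using laplace_density[OF prior_cov prior Hsym HI_pos[unfolded A] _ T_eq[unfolded S_def] T_cont] laplace h
    by (auto simp: A c_def m_def S_def)
  have c: "c > 0" using det by (simp add: c_def)
  have P0: "prob_space \<mu>0" and s0: "sets \<mu>0 = sets borel" using prior by (auto simp: gaussian_measure_def)
  interpret prob_space \<mu>0 by (rule P0)
  have Pn: "prob_space \<nu>" and sn: "sets \<nu> = sets borel" using laplace by (auto simp: gaussian_measure_def)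
  have meas_eq: "k \<in> borel_measurable \<mu>0" if "k \<in> borel_measurable borel" for k :: "'a \<Rightarrow> real"
    using that measurable_cong_sets[OF s0 refl] by blast
  have [measurable]: "\<Phi> \<in> borel_measurable \<mu>0" "T\<Phi> \<in> borel_measurable \<mu>0"
    by (rule meas_eq[OF misfit_measurable], rule meas_eq[OF borel_measurable_continuous_onI[OF T_cont]])
  define f where "f u = exp (- \<Phi> u / 2)" for u
  define g where "g u = exp (- T\<Phi> u / 2)" for u
  have f2: "(f u)\<^sup>2 = exp (- \<Phi> u)" and g2: "(g u)\<^sup>2 = exp (- T\<Phi> u)" for u
    by (simp_all add: f_def g_def exp_of_nat_mult[symmetric] flip: exp_double)
  have [measurable]: "f \<in> borel_measurable \<mu>0" "g \<in> borel_measurable \<mu>0" by (simp_all add: f_def[abs_def] g_def[abs_def])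
  have \<Phi>0: "0 \<le> \<Phi> u" for u
  proof -
    have "0 \<le> ereal (1/2) * (cov_norm \<Gamma> (y - G u))\<^sup>2" 
      by (auto simp: cov_norm_def power2_eq_square)
    then show ?thesis unfolding misfit[symmetric] by simp
  qed
  have intf: "integrable \<mu>0 (\<lambda>u. (f u)\<^sup>2)"
    unfolding f2 using \<Phi>0 by (intro integrable_const_bound[where B=1]) auto
  have intd: "integrable \<mu>0 (\<lambda>u. (f u - g u)\<^sup>2)" using L2 by (simp add: in_L2_def f_def g_def)
  have intg: "integrable \<mu>0 (\<lambda>u. (g u)\<^sup>2)"
  proof (rule Bochner_Integration.integrable_bound[where f="\<lambda>u. 2 * (f u)\<^sup>2 + 2 * (f u - g u)\<^sup>2"])
    show "AE u in \<mu>0. norm ((g u)\<^sup>2) \<le> norm (2 * (f u)\<^sup>2 + 2 * (f u - g u)\<^sup>2)"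
    proof (rule AE_I2)
      fix u
      \<comment> \<open>The square equals 2 f^2 + 2 (f - g)^2 - g^2, so integrability of g^2 follows
        from that of f^2 and of the L^2 hypothesis.\<close>
      have "0 \<le> (2 * f u - g u)\<^sup>2" by simp
      then show "norm ((g u)\<^sup>2) \<le> norm (2 * (f u)\<^sup>2 + 2 * (f u - g u)\<^sup>2)"
        by (simp add: power2_eq_square algebra_simps)
    qed
  qed (use intf intd in auto)
  \<comment> \<open>The density identity is evaluated on the whole space, where \<open>\<nu>\<close>
    has mass 1; so the right side of the hypothesis is \<open>K\<close> times the L^2 norm of
    g.\<close>
  have Zg: "(LINT u|\<mu>0. (g u)\<^sup>2) = c"
  proof -
    have "ennreal (LINT u|\<mu>0. (g u)\<^sup>2) = (\<integral>\<^sup>+u. ennreal (exp (- T\<Phi> u)) \<partial>\<mu>0)"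
      using intg unfolding g2 by (subst nn_integral_eq_integral) auto
    also have "\<dots> = emeasure (density \<mu>0 (\<lambda>u. ennreal (exp (- T\<Phi> u)))) (space \<mu>0)"
      by (simp add: emeasure_density nn_integral_multc[symmetric] cong: nn_integral_cong)
    also have "\<dots> = ennreal c * emeasure \<nu> (space \<nu>)"
      unfolding dens using sets_eq_imp_space_eq[OF s0] sets_eq_imp_space_eq[OF sn] sn
      by (subst emeasure_density_const) auto
    also have "\<dots> = ennreal c" using prob_space.emeasure_space_1[OF Pn] by simp
    finally show ?thesis using c by simp
  qed
  have \<nu>: "\<nu> = density \<mu>0 (\<lambda>u. ennreal ((g u)\<^sup>2 / c))"
  proof -
    have "density \<mu>0 (\<lambda>u. ennreal ((g u)\<^sup>2 / c)) = density \<mu>0 (\<lambda>u. ennreal (exp (- T\<Phi> u)) * ennreal (1 / c))"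
      unfolding g2 using c by (simp add: ennreal_mult'[symmetric])
    also have "\<dots> = density (density \<mu>0 (\<lambda>u. ennreal (exp (- T\<Phi> u)))) (\<lambda>_. ennreal (1 / c))"
      by (rule density_density_eq[symmetric]) auto
    also have "\<dots> = density \<nu> (\<lambda>_. ennreal c * ennreal (1 / c))"
      unfolding dens by (rule density_density_eq) auto
    also have "\<dots> = \<nu>" using c by (simp add: ennreal_mult'[symmetric] density_1)
    finally show ?thesis by simp
  qed
  have Zf: "0 < (LINT u|\<mu>0. (f u)\<^sup>2)"
  proof -
    have "AE u in \<mu>0. (f u)\<^sup>2 \<noteq> 0" by (simp add: f_def)
    then have "\<not> (AE u in \<mu>0. (f u)\<^sup>2 = 0)"
    proof (rule contrapos_pn)
      assume "AE u in \<mu>0. (f u)\<^sup>2 = 0"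
      then show "\<not> (AE u in \<mu>0. (f u)\<^sup>2 \<noteq> 0)" by (auto simp: f_def)
    qed
    then have "(LINT u|\<mu>0. (f u)\<^sup>2) \<noteq> 0" using integral_nonneg_eq_0_iff_AE[OF intf] by simp
    moreover have "0 \<le> (LINT u|\<mu>0. (f u)\<^sup>2)" by simp
    ultimately show ?thesis by linarith
  qed
  have le: "(LINT u|\<mu>0. (f u - g u)\<^sup>2) \<le> K\<^sup>2 * c"
  proof -
    let ?R = "K * (exp (- 1/2 * real_of_ereal (I u_MAP)) / root 4 (fredholm_det A))"
    have "0 \<le> (LINT u|\<mu>0. (f u - g u)\<^sup>2)" by simp
    then have "(LINT u|\<mu>0. (f u - g u)\<^sup>2) = (L2_norm \<mu>0 (\<lambda>u. exp (- \<Phi> u / 2) - exp (- T\<Phi> u / 2)))\<^sup>2"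
      by (simp add: L2_norm_def f_def g_def)
    also have "\<dots> \<le> ?R\<^sup>2" using bound by (rule power_mono) (simp add: L2_norm_def)
    also have "?R\<^sup>2 = K\<^sup>2 * ((exp (- 1/2 * real_of_ereal (I u_MAP)))\<^sup>2 / (root 4 (fredholm_det A))\<^sup>2)"
      by (simp add: power_mult_distrib power_divide)
    also have "(root 4 (fredholm_det A))\<^sup>2 = sqrt (fredholm_det A)"
    proof (rule real_sqrt_unique[symmetric])
      have "((root 4 (fredholm_det A))\<^sup>2)\<^sup>2 = root 4 (fredholm_det A) ^ 4" by (simp flip: power_mult)
      also have "\<dots> = fredholm_det A" using det by simp
      finally show "((root 4 (fredholm_det A))\<^sup>2)\<^sup>2 = fredholm_det A" .
    qed simp
    also have "real_of_ereal (I u_MAP) = \<Phi> m + (norm h)\<^sup>2 / 2"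
      using I_S[of h] by (simp add: m_def[symmetric] h[symmetric])
    also have "(exp (- 1/2 * (\<Phi> m + (norm h)\<^sup>2 / 2)))\<^sup>2 = exp (- \<Phi> m - (norm h)\<^sup>2 / 2)"
      by (simp add: exp_double[symmetric] algebra_simps)
    finally show ?thesis by (simp add: c_def)
  qed
  show ?thesis
  proof (rule hellinger_dist_le[OF P0 _ _ _ _ intf intg refl Zg[symmetric] Zf c _ \<nu> K le])
    show "\<mu> = density \<mu>0 (\<lambda>u. ennreal ((f u)\<^sup>2 / (LINT u|\<mu>0. (f u)\<^sup>2)))"
      unfolding f2 posterior posterior_def ..
  qed (simp_all add: f_def g_def)
qed

end
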